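(* Let $S$ be a spacelike codimension-two embedded submanifold of a spacetime $(M,g)$ of dimension $n+2\ge4$ with a lightlike normal vector field $\xi$, let $\Sigma=\Phi(\mathscr O)$ be the lightlike hypersurface emanating from $S$ by the normal exponential construction along $\xi$ (see context), and assume that $\Sigma$ is totally umbilical. If the conformal factor $\Omega$ is constant on $\Sigma$, then $\Omega\equiv1$ and $\Sigma$ is totally geodesic. Consequently, every leaf $L$ of the screen distribution $\mathcal S$ for which $F|_L\colon L\to S$ is a diffeomorphism is canonically isometric to $S$ (that is, $F|_L$ is an isometry); in particular, this holds for every canonical leaf $S_t$, $t\in D$.
   Context: A spacetime is a connected time-oriented Lorentzian manifold of signature $(-,+,\dots,+)$, with Levi-Civita connection $\widetilde\nabla$; lightlike vectors are nonzero null vectors; $S$ is connected of dimension $n$ with induced Riemannian metric. Normal exponential construction: choose an open neighborhood $\mathscr V$ of the zero section of the normal bundle $T^\perp S$, fiberwise star-shaped about $0$, such that the normal exponential map $\exp^\perp$ restricts to a diffeomorphism from $\mathscr V$ onto an open neighborhood of $S$ in $M$. Put $\mathscr O=\{(p,t)\in S\times\mathbb R: t\xi_p\in\mathscr V\}$, $\Phi\colon\mathscr O\to M$, $\Phi(p,t)=\exp^\perp_p(t\xi_p)$, and $\Sigma=\Phi(\mathscr O)$. Then $\Phi$ is an embedding, $\Sigma$ is a lightlike hypersurface (the induced metric is everywhere degenerate) containing $S=\Phi(S\times\{0\})$; $U=\Phi_*(\partial_t)$ is a lightlike vector field on $\Sigma$ with $\widetilde\nabla_UU=0$, $U|_S=\xi$;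 $\mathcal S$ is the integrable screen distribution given by the images under $\Phi_*$ of the tangent spaces to the slices $\{t=\text{const}\}$ of $\mathscr O$; $F=\pi\circ\Phi^{-1}\colon\Sigma\to S$ with $\pi\colon\mathscr O\to S$ the projection. $I_p=\{t:(p,t)\in\mathscr O\}$, $D=\bigcap_{p\in S}I_p$, and for $t\in D$, $S_t=\Phi(S\times\{t\})$. $B_U(X,Y)=-g(\widetilde\nabla_XU,Y)$ on $\Sigma$; $\Sigma$ is totally umbilical if $B_U=\mu g$ for a smooth function $\mu$ on $\Sigma$, and totally geodesic if $B_U=0$. The conformal factor is $\Omega(\Phi(p,t))=\exp\left(-2\int_0^t\mu(\Phi(p,s))\,ds\right)$. *)

theory Defs
  imports "HOL-Analysis.Analysis"
begin

section \<open>Smooth maps and smooth manifolds\<close>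

text \<open>Smoothness on an open subset of a Euclidean space: all iterated directional derivatives
  exist and are differentiable.\<close>

primrec times_differentiable_on ::
  "nat \<Rightarrow> ('e::euclidean_space \<Rightarrow> 'f::euclidean_space) \<Rightarrow> 'e set \<Rightarrow> bool" where
  "times_differentiable_on 0 f A \<longleftrightarrow> continuous_on A f"
| "times_differentiable_on (Suc k) f A \<longleftrightarrow>
     (\<forall>x\<in>A. f differentiable (at x)) \<and>
     (\<forall>v. times_differentiable_on k (\<lambda>x. frechet_derivative f (at x) v) A)"

definition smooth_on :: "('e::euclidean_space \<Rightarrow> 'f::euclidean_space) \<Rightarrow> 'e set \<Rightarrow> bool" where
  "smooth_on f A \<longleftrightarrow> (\<forall>k. times_differentiable_on k f A)"

text \<open>A chart is a domain with a coordinate map. A manifold is a topology on a set of points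
  (the \<^const>\<open>topspace\<close>) with an atlas. The atlas need not be maximal: all notions below depend only
  on the smooth structure that it generates. The dimension is that of the model space \<open>'e\<close>.\<close>

type_synonym ('a, 'e) chart = "'a set \<times> ('a \<Rightarrow> 'e)"

record ('a, 'e) manifold =
  mtop :: "'a topology"
  charts :: "('a, 'e) chart set"

abbreviation pts :: "('a, 'e) manifold \<Rightarrow> 'a set" where
  "pts X \<equiv> topspace (mtop X)"

abbreviation chart_inv :: "('a, 'e) chart \<Rightarrow> 'e \<Rightarrow> 'a" where
  "chart_inv c \<equiv> inv_into (fst c) (snd c)"

definition charts_at :: "('a, 'e) manifold \<Rightarrow> 'a \<Rightarrow> ('a, 'e) chart set" where
  "charts_at X p = {c \<in> charts X. p \<in> fst c}"

definition chart_at :: "('a, 'e) manifold \<Rightarrow> 'a \<Rightarrow> ('a, 'e) chart" where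
  "chart_at X p = (SOME c. c \<in> charts_at X p)"

definition smooth_manifold :: "('a, 'e::euclidean_space) manifold \<Rightarrow> bool" where
  "smooth_manifold X \<longleftrightarrow>
     pts X \<noteq> {} \<and> Hausdorff_space (mtop X) \<and> second_countable (mtop X) \<and>
     (\<forall>c\<in>charts X. openin (mtop X) (fst c) \<and> open (snd c ` fst c) \<and>
        homeomorphic_map (subtopology (mtop X) (fst c)) (top_of_set (snd c ` fst c)) (snd c)) \<and>
     (\<Union>c\<in>charts X. fst c) = pts X \<and>
     (\<forall>c\<in>charts X. \<forall>d\<in>charts X. smooth_on (snd d \<circ> chart_inv c) (snd c ` (fst c \<inter> fst d)))"

definition smooth_map :: "('a, 'e::euclidean_space) manifold \<Rightarrow> ('b, 'f::euclidean_space) manifold \<Rightarrow>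
    ('a \<Rightarrow> 'b) \<Rightarrow> bool" where
  "smooth_map X Y f \<longleftrightarrow> continuous_map (mtop X) (mtop Y) f \<and>
     (\<forall>c\<in>charts X. \<forall>d\<in>charts Y.
        smooth_on (snd d \<circ> f \<circ> chart_inv c) (snd c ` (fst c \<inter> f -` fst d)))"

definition diffeomorphism :: "('a, 'e::euclidean_space) manifold \<Rightarrow>
    ('b, 'f::euclidean_space) manifold \<Rightarrow> ('a \<Rightarrow> 'b) \<Rightarrow> bool" where
  "diffeomorphism X Y f \<longleftrightarrow> bij_betw f (pts X) (pts Y) \<and> smooth_map X Y f \<and>
     smooth_map Y X (inv_into (pts X) f)"

definition euclidean_mfd :: "('e::euclidean_space, 'e) manifold" where
  "euclidean_mfd = \<lparr>mtop = euclidean, charts = {(UNIV, id)}\<rparr>"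

text \<open>The open submanifold on an open set \<open>W\<close>.\<close>

definition open_submfd :: "('a, 'e) manifold \<Rightarrow> 'a set \<Rightarrow> ('a, 'e) manifold" where
  "open_submfd X W = \<lparr>mtop = subtopology (mtop X) W,
     charts = (\<lambda>c. (fst c \<inter> W, snd c)) ` charts X\<rparr>"

definition product_line :: "('a, 'e) manifold \<Rightarrow> ('a \<times> real, 'e \<times> real) manifold" where
  "product_line X = \<lparr>mtop = prod_topology (mtop X) euclideanreal,
     charts = (\<lambda>c. (fst c \<times> UNIV, \<lambda>(p, t). (snd c p, t))) ` charts X\<rparr>"

text \<open>The manifold structure on the image of an injective map \<open>f\<close> for which \<open>f\<close> is a
  diffeomorphism onto its image; for an embedding \<open>f\<close> this is the submanifold structure
  of the image.\<close>

definition image_mfd :: "('a \<Rightarrow> 'b) \<Rightarrow> ('a, 'e) manifold \<Rightarrow> ('b, 'e) manifold" where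
  "image_mfd f X = \<lparr>
     mtop = pullback_topology (f ` pts X) (inv_into (pts X) f) (mtop X),
     charts = (\<lambda>c. (f ` fst c, snd c \<circ> inv_into (pts X) f)) ` charts X\<rparr>"


section \<open>Tangent vectors\<close>

text \<open>A tangent vector at \<open>p\<close> assigns to every chart at \<open>p\<close> its components, which are related by
  the derivatives of the chart transitions. The value at all other charts is set to 0, so that
  a tangent vector is determined by its components.\<close>

type_synonym ('a, 'e) tvec = "('a, 'e) chart \<Rightarrow> 'e"

definition tangent_space :: "('a, 'e::euclidean_space) manifold \<Rightarrow> 'a \<Rightarrow> ('a, 'e) tvec set" where
  "tangent_space X p = {v.
     (\<forall>c\<in>charts_at X p. \<forall>d\<in>charts_at X p.
        v d = frechet_derivative (snd d \<circ> chart_inv c) (at (snd c p)) (v c)) \<and>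
     (\<forall>c. c \<notin> charts_at X p \<longrightarrow> v c = 0)}"

text \<open>The tangent vector at \<open>p\<close> whose components in the chart \<open>c\<close> are \<open>u\<close>.\<close>

definition tangent_of_components ::
  "('a, 'e::euclidean_space) manifold \<Rightarrow> ('a, 'e) chart \<Rightarrow> 'a \<Rightarrow> 'e \<Rightarrow> ('a, 'e) tvec" where
  "tangent_of_components X c p u = (\<lambda>d. if d \<in> charts_at X p
     then frechet_derivative (snd d \<circ> chart_inv c) (at (snd c p)) u else 0)"

definition zero_tvec :: "('a, 'e::euclidean_space) tvec" where
  "zero_tvec = (\<lambda>c. 0)"

definition scale_tvec :: "real \<Rightarrow> ('a, 'e::euclidean_space) tvec \<Rightarrow> ('a, 'e) tvec" where
  "scale_tvec r v = (\<lambda>c. r *\<^sub>R v c)"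

text \<open>The differential \<open>T\<^sub>pX \<rightarrow> T\<^bsub>f p\<^esub>Y\<close>, independent of the chart chosen at \<open>p\<close>.\<close>

definition differential :: "('a, 'e::euclidean_space) manifold \<Rightarrow>
    ('b, 'f::euclidean_space) manifold \<Rightarrow> ('a \<Rightarrow> 'b) \<Rightarrow> 'a \<Rightarrow> ('a, 'e) tvec \<Rightarrow> ('b, 'f) tvec" where
  "differential X Y f p v = (\<lambda>d. if d \<in> charts_at Y (f p)
     then (let c = chart_at X p in
       frechet_derivative (snd d \<circ> f \<circ> chart_inv c) (at (snd c p)) (v c))
     else 0)"

definition velocity :: "('a, 'e::euclidean_space) manifold \<Rightarrow> (real \<Rightarrow> 'a) \<Rightarrow> real \<Rightarrow> ('a, 'e) tvec" where
  "velocity X \<gamma> t = (\<lambda>c. if c \<in> charts_at X (\<gamma> t) then vector_derivative (snd c \<circ> \<gamma>) (at t) else 0)"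

definition tangent_chart :: "('a, 'e::euclidean_space) manifold \<Rightarrow> ('a, 'e) chart \<Rightarrow>
    ('a \<times> ('a, 'e) tvec, 'e \<times> 'e) chart" where
  "tangent_chart X c = ({(p, v). p \<in> fst c \<and> v \<in> tangent_space X p}, \<lambda>(p, v). (snd c p, v c))"

definition tangent_bundle :: "('a, 'e::euclidean_space) manifold \<Rightarrow>
    ('a \<times> ('a, 'e) tvec, 'e \<times> 'e) manifold" where
  "tangent_bundle X = \<lparr>
     mtop = topology (\<lambda>W. W \<subseteq> {(p, v). p \<in> pts X \<and> v \<in> tangent_space X p} \<and>
       (\<forall>c\<in>charts X. open (snd (tangent_chart X c) ` (W \<inter> fst (tangent_chart X c))))),
     charts = tangent_chart X ` charts X\<rparr>"

text \<open>A vector field of \<open>M\<close> along a subset that carries a manifold structure \<open>X\<close>.\<close>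

definition smooth_field_along :: "('a, 'e::euclidean_space) manifold \<Rightarrow>
    ('a, 'f::euclidean_space) manifold \<Rightarrow> ('a \<Rightarrow> ('a, 'f) tvec) \<Rightarrow> bool" where
  "smooth_field_along X M Y \<longleftrightarrow> smooth_map X (tangent_bundle M) (\<lambda>p. (p, Y p))"

definition immersed_submfd :: "('a, 'e::euclidean_space) manifold \<Rightarrow>
    ('a, 'f::euclidean_space) manifold \<Rightarrow> bool" where
  "immersed_submfd X M \<longleftrightarrow> smooth_manifold X \<and> pts X \<subseteq> pts M \<and> smooth_map X M (\<lambda>p. p) \<and>
     (\<forall>p\<in>pts X. inj_on (differential X M (\<lambda>p. p) p) (tangent_space X p))"

definition embedded_submfd :: "('a, 'e::euclidean_space) manifold \<Rightarrow>
    ('a, 'f::euclidean_space) manifold \<Rightarrow> bool" where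
  "embedded_submfd X M \<longleftrightarrow> immersed_submfd X M \<and> mtop X = subtopology (mtop M) (pts X)"


section \<open>Lorentzian metrics and the Levi-Civita connection\<close>

text \<open>\<open>g p\<close> is only meaningful on the tangent space at \<open>p\<close>.\<close>

type_synonym ('a, 'e) metric = "'a \<Rightarrow> ('a, 'e) tvec \<Rightarrow> ('a, 'e) tvec \<Rightarrow> real"

definition metric_components :: "('a, 'e::euclidean_space) manifold \<Rightarrow> ('a, 'e) metric \<Rightarrow>
    ('a, 'e) chart \<Rightarrow> 'a \<Rightarrow> 'e \<Rightarrow> 'e \<Rightarrow> real" where
  "metric_components M g c p u v =
     g p (tangent_of_components M c p u) (tangent_of_components M c p v)"

text \<open>The signature is expressed by an orthonormal frame indexed by the standard basis, with
  exactly one timelike member.\<close>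

definition lorentzian_metric :: "('a, 'e::euclidean_space) manifold \<Rightarrow> ('a, 'e) metric \<Rightarrow> bool" where
  "lorentzian_metric M g \<longleftrightarrow> (\<forall>c\<in>charts M.
     (\<forall>p\<in>fst c. let G = metric_components M g c p in
        bilinear G \<and> (\<forall>u v. G u v = G v u) \<and>
        (\<exists>(E :: 'e \<Rightarrow> 'e) (b\<^sub>0 :: 'e). b\<^sub>0 \<in> Basis \<and> (\<forall>i\<in>Basis. \<forall>j\<in>Basis.
           G (E i) (E j) = (if i \<noteq> j then 0 else if i = b\<^sub>0 then - 1 else 1)))) \<and>
     (\<forall>u v. smooth_on (\<lambda>x. metric_components M g c (chart_inv c x) u v) (snd c ` fst c)))"

text \<open>The timelike field \<open>T\<close> represents the time orientation.\<close>

definition spacetime :: "('a, 'e::euclidean_space) manifold \<Rightarrow> ('a, 'e) metric \<Rightarrow>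
    ('a \<Rightarrow> ('a, 'e) tvec) \<Rightarrow> bool" where
  "spacetime M g T \<longleftrightarrow> smooth_manifold M \<and> connected_space (mtop M) \<and> lorentzian_metric M g \<and>
     smooth_field_along M M T \<and> (\<forall>p\<in>pts M. g p (T p) (T p) < 0)"

text \<open>An affine connection is given by its coefficients \<open>\<Gamma> c p u v\<close>: the components at \<open>p\<close>, in the
  chart \<open>c\<close>, of the covariant derivative in direction \<open>u\<close> of the field with constant components \<open>v\<close>.
  The second derivative of the chart transition in the transformation law makes the covariant
  derivatives below independent of the chart.\<close>

type_synonym ('a, 'e) connection = "('a, 'e) chart \<Rightarrow> 'a \<Rightarrow> 'e \<Rightarrow> 'e \<Rightarrow> 'e"

definition affine_connection :: "('a, 'e::euclidean_space) manifold \<Rightarrow> ('a, 'e) connection \<Rightarrow> bool" where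
  "affine_connection M \<Gamma> \<longleftrightarrow>
     (\<forall>c\<in>charts M. (\<forall>p\<in>fst c. bilinear (\<Gamma> c p)) \<and>
        (\<forall>u v. smooth_on (\<lambda>x. \<Gamma> c (chart_inv c x) u v) (snd c ` fst c))) \<and>
     (\<forall>c\<in>charts M. \<forall>d\<in>charts M. \<forall>p\<in>fst c \<inter> fst d. \<forall>u v.
        let h = snd d \<circ> chart_inv c; dh = (\<lambda>x. frechet_derivative h (at x)); a = snd c p in
          dh a (\<Gamma> c p u v) =
            \<Gamma> d p (dh a u) (dh a v) + frechet_derivative (\<lambda>x. dh x v) (at a) u)"

text \<open>Torsion-freeness and metric compatibility are evaluated on fields with constant components
  in a chart, whose Lie brackets vanish.\<close>

definition levi_civita :: "('a, 'e::euclidean_space) manifold \<Rightarrow> ('a, 'e) metric \<Rightarrow>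
    ('a, 'e) connection \<Rightarrow> bool" where
  "levi_civita M g \<Gamma> \<longleftrightarrow> affine_connection M \<Gamma> \<and>
     (\<forall>c\<in>charts M. \<forall>p\<in>fst c. \<forall>u v. \<Gamma> c p u v = \<Gamma> c p v u) \<and>
     (\<forall>c\<in>charts M. \<forall>p\<in>fst c. \<forall>u v w.
        frechet_derivative (\<lambda>x. metric_components M g c (chart_inv c x) v w) (at (snd c p)) u =
          metric_components M g c p (\<Gamma> c p u v) w + metric_components M g c p v (\<Gamma> c p u w))"

text \<open>Covariant derivative, in direction \<open>v \<in> T\<^sub>pX\<close>, of a field \<open>Y\<close> of \<open>M\<close> along a submanifold \<open>X\<close>.\<close>

definition covariant_derivative :: "('a, 'e::euclidean_space) manifold \<Rightarrow>
    ('a, 'f::euclidean_space) manifold \<Rightarrow> ('a, 'f) connection \<Rightarrow> ('a \<Rightarrow> ('a, 'f) tvec) \<Rightarrow>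
    'a \<Rightarrow> ('a, 'e) tvec \<Rightarrow> ('a, 'f) tvec" where
  "covariant_derivative X M \<Gamma> Y p v = (\<lambda>d. if d \<in> charts_at M p
     then (let c = chart_at X p in
       frechet_derivative (\<lambda>x. Y (chart_inv c x) d) (at (snd c p)) (v c) +
       \<Gamma> d p (differential X M (\<lambda>q. q) p v d) (Y p d))
     else 0)"

definition geodesic :: "('a, 'e::euclidean_space) manifold \<Rightarrow> ('a, 'e) connection \<Rightarrow>
    real set \<Rightarrow> (real \<Rightarrow> 'a) \<Rightarrow> bool" where
  "geodesic M \<Gamma> J \<gamma> \<longleftrightarrow> open J \<and> is_interval J \<and> smooth_map (open_submfd euclidean_mfd J) M \<gamma> \<and>
     (\<forall>t\<in>J. \<forall>c\<in>charts_at M (\<gamma> t).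
        vector_derivative (\<lambda>s. velocity M \<gamma> s c) (at t) +
        \<Gamma> c (\<gamma> t) (velocity M \<gamma> t c) (velocity M \<gamma> t c) = 0)"

definition geodesic_to :: "('a, 'e::euclidean_space) manifold \<Rightarrow> ('a, 'e) connection \<Rightarrow>
    'a \<times> ('a, 'e) tvec \<Rightarrow> 'a \<Rightarrow> bool" where
  "geodesic_to M \<Gamma> = (\<lambda>(p, v) q. \<exists>J \<gamma>. geodesic M \<Gamma> J \<gamma> \<and> {0..1} \<subseteq> J \<and>
     \<gamma> 0 = p \<and> velocity M \<gamma> 0 = v \<and> \<gamma> 1 = q)"

definition exp_domain :: "('a, 'e::euclidean_space) manifold \<Rightarrow> ('a, 'e) connection \<Rightarrow>
    ('a \<times> ('a, 'e) tvec) set" where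
  "exp_domain M \<Gamma> = {pv. \<exists>q. geodesic_to M \<Gamma> pv q}"

definition exp_map :: "('a, 'e::euclidean_space) manifold \<Rightarrow> ('a, 'e) connection \<Rightarrow>
    'a \<times> ('a, 'e) tvec \<Rightarrow> 'a" where
  "exp_map M \<Gamma> pv = (THE q. geodesic_to M \<Gamma> pv q)"


section \<open>Submanifolds of a Lorentzian manifold and isometries\<close>

definition induced_metric :: "('a, 'f::euclidean_space) manifold \<Rightarrow> ('a, 'f) metric \<Rightarrow>
    ('a, 'e::euclidean_space) manifold \<Rightarrow> ('a, 'e) metric" where
  "induced_metric M g X p u v =
     g p (differential X M (\<lambda>q. q) p u) (differential X M (\<lambda>q. q) p v)"

definition spacelike_submfd :: "('a, 'f::euclidean_space) manifold \<Rightarrow> ('a, 'f) metric \<Rightarrow>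
    ('a, 'e::euclidean_space) manifold \<Rightarrow> bool" where
  "spacelike_submfd M g S \<longleftrightarrow>
     (\<forall>p\<in>pts S. \<forall>v\<in>tangent_space S p. v \<noteq> zero_tvec \<longrightarrow> induced_metric M g S p v v > 0)"

definition isometry :: "('a, 'e::euclidean_space) manifold \<Rightarrow> ('a, 'e) metric \<Rightarrow>
    ('b, 'f::euclidean_space) manifold \<Rightarrow> ('b, 'f) metric \<Rightarrow> ('a \<Rightarrow> 'b) \<Rightarrow> bool" where
  "isometry X g Y h f \<longleftrightarrow> diffeomorphism X Y f \<and>
     (\<forall>p\<in>pts X. \<forall>u\<in>tangent_space X p. \<forall>v\<in>tangent_space X p.
        h (f p) (differential X Y f p u) (differential X Y f p v) = g p u v)"

definition normal_vectors :: "('a, 'f::euclidean_space) manifold \<Rightarrow> ('a, 'f) metric \<Rightarrow>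
    ('a, 'e::euclidean_space) manifold \<Rightarrow> ('a \<times> ('a, 'f) tvec) set" where
  "normal_vectors M g S = {(p, v). p \<in> pts S \<and> v \<in> tangent_space M p \<and>
     (\<forall>w\<in>tangent_space S p. g p v (differential S M (\<lambda>q. q) p w) = 0)}"

text \<open>For \<open>S\<close> of codimension two the total space of the normal bundle has the dimension of \<open>M\<close>.
  It carries the (unique) structure of an embedded submanifold of the tangent bundle of \<open>M\<close>.\<close>

definition normal_bundle :: "('a, 'f::euclidean_space) manifold \<Rightarrow> ('a, 'f) metric \<Rightarrow>
    ('a, 'e::euclidean_space) manifold \<Rightarrow> ('a \<times> ('a, 'f) tvec, 'f) manifold \<Rightarrow> bool" where
  "normal_bundle M g S N \<longleftrightarrow>
     embedded_submfd N (tangent_bundle M) \<and> pts N = normal_vectors M g S"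

definition lightlike_normal_field :: "('a, 'f::euclidean_space) manifold \<Rightarrow> ('a, 'f) metric \<Rightarrow>
    ('a, 'e::euclidean_space) manifold \<Rightarrow> ('a \<Rightarrow> ('a, 'f) tvec) \<Rightarrow> bool" where
  "lightlike_normal_field M g S \<xi> \<longleftrightarrow> smooth_field_along S M \<xi> \<and>
     (\<forall>p\<in>pts S. (p, \<xi> p) \<in> normal_vectors M g S \<and> \<xi> p \<noteq> zero_tvec \<and> g p (\<xi> p) (\<xi> p) = 0)"


section \<open>The normal exponential construction\<close>

definition normal_exp_domain :: "('a, 'f::euclidean_space) manifold \<Rightarrow> ('a, 'f) connection \<Rightarrow>
    ('a, 'e::euclidean_space) manifold \<Rightarrow> ('a \<times> ('a, 'f) tvec, 'f) manifold \<Rightarrow>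
    ('a \<times> ('a, 'f) tvec) set \<Rightarrow> bool" where
  "normal_exp_domain M \<Gamma> S N V \<longleftrightarrow>
     openin (mtop N) V \<and> (\<forall>p\<in>pts S. (p, zero_tvec) \<in> V) \<and>
     (\<forall>p v. \<forall>r\<in>{0..1}. (p, v) \<in> V \<longrightarrow> (p, scale_tvec r v) \<in> V) \<and>
     V \<subseteq> exp_domain M \<Gamma> \<and>
     openin (mtop M) (exp_map M \<Gamma> ` V) \<and> pts S \<subseteq> exp_map M \<Gamma> ` V \<and>
     diffeomorphism (open_submfd N V) (open_submfd M (exp_map M \<Gamma> ` V)) (exp_map M \<Gamma>)"

definition flow_domain :: "('a, 'e) manifold \<Rightarrow> ('a \<Rightarrow> ('a, 'f::euclidean_space) tvec) \<Rightarrow>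
    ('a \<times> ('a, 'f) tvec) set \<Rightarrow> ('a \<times> real) set" where
  "flow_domain S \<xi> V = {(p, t). p \<in> pts S \<and> (p, scale_tvec t (\<xi> p)) \<in> V}"

definition normal_flow :: "('a, 'f::euclidean_space) manifold \<Rightarrow> ('a, 'f) connection \<Rightarrow>
    ('a \<Rightarrow> ('a, 'f) tvec) \<Rightarrow> 'a \<times> real \<Rightarrow> 'a" where
  "normal_flow M \<Gamma> \<xi> = (\<lambda>(p, t). exp_map M \<Gamma> (p, scale_tvec t (\<xi> p)))"

definition flow_mfd :: "('a, 'e) manifold \<Rightarrow> ('a \<times> real) set \<Rightarrow> ('a \<times> real, 'e \<times> real) manifold" where
  "flow_mfd S \<O> = open_submfd (product_line S) \<O>"

text \<open>In the following definitions \<open>\<Phi>\<close> is the normal flow with domain \<open>\<O>\<close>; \<open>\<Phi>\<close> is an embedding,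
  so that \<^const>\<open>image_mfd\<close> gives the submanifold structure of its image.\<close>

definition emanating_hypersurface :: "('a \<times> real \<Rightarrow> 'a) \<Rightarrow> ('a \<times> real) set \<Rightarrow> ('a, 'e) manifold \<Rightarrow>
    ('a, 'e \<times> real) manifold" where
  "emanating_hypersurface \<Phi> \<O> S = image_mfd \<Phi> (flow_mfd S \<O>)"

text \<open>\<open>U = \<Phi>\<^sub>*(\<partial>\<^sub>t)\<close>, as a tangent field of the hypersurface.\<close>

definition generator_field :: "('a \<times> real \<Rightarrow> 'a) \<Rightarrow> ('a \<times> real) set \<Rightarrow>
    ('a, 'e::euclidean_space) manifold \<Rightarrow> 'a \<Rightarrow> ('a, 'e \<times> real) tvec" where
  "generator_field \<Phi> \<O> S x = (let (p, t) = inv_into \<O> \<Phi> x in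
     differential (flow_mfd S \<O>) (emanating_hypersurface \<Phi> \<O> S) \<Phi> (p, t)
       (velocity (flow_mfd S \<O>) (\<lambda>s. (p, s)) t))"

text \<open>The slice \<open>t = const\<close> of \<open>\<O>\<close> is parametrized by an open subset of \<open>S\<close>.\<close>

definition screen_distribution :: "('a \<times> real \<Rightarrow> 'a) \<Rightarrow> ('a \<times> real) set \<Rightarrow>
    ('a, 'e::euclidean_space) manifold \<Rightarrow> 'a \<Rightarrow> ('a, 'e \<times> real) tvec set" where
  "screen_distribution \<Phi> \<O> S x = (let (p, t) = inv_into \<O> \<Phi> x;
       slice = open_submfd S {q. (q, t) \<in> \<O>} in
     (\<lambda>w. differential (flow_mfd S \<O>) (emanating_hypersurface \<Phi> \<O> S) \<Phi> (p, t)
            (differential slice (flow_mfd S \<O>) (\<lambda>q. (q, t)) p w)) ` tangent_space slice p)"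

definition flow_projection :: "('a \<times> real \<Rightarrow> 'a) \<Rightarrow> ('a \<times> real) set \<Rightarrow> 'a \<Rightarrow> 'a" where
  "flow_projection \<Phi> \<O> x = fst (inv_into \<O> \<Phi> x)"

definition common_times :: "('a, 'e) manifold \<Rightarrow> ('a \<times> real) set \<Rightarrow> real set" where
  "common_times S \<O> = (\<Inter>p\<in>pts S. {t. (p, t) \<in> \<O>})"

definition canonical_leaf :: "('a \<times> real \<Rightarrow> 'a) \<Rightarrow> ('a, 'e) manifold \<Rightarrow> real \<Rightarrow> ('a, 'e) manifold" where
  "canonical_leaf \<Phi> S t = image_mfd (\<lambda>p. \<Phi> (p, t)) S"

text \<open>Integral manifolds carry their own, possibly finer, topology; a leaf is a maximal connected
  integral manifold.\<close>

definition connected_integral_mfd :: "('a, 'f::euclidean_space) manifold \<Rightarrow>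
    ('a \<Rightarrow> ('a, 'f) tvec set) \<Rightarrow> ('a, 'e::euclidean_space) manifold \<Rightarrow> bool" where
  "connected_integral_mfd X \<D> L \<longleftrightarrow> immersed_submfd L X \<and> connected_space (mtop L) \<and>
     (\<forall>x\<in>pts L. differential L X (\<lambda>y. y) x ` tangent_space L x = \<D> x)"

definition leaf :: "('a, 'f::euclidean_space) manifold \<Rightarrow> ('a \<Rightarrow> ('a, 'f) tvec set) \<Rightarrow>
    ('a, 'e::euclidean_space) manifold \<Rightarrow> bool" where
  "leaf X \<D> L \<longleftrightarrow> connected_integral_mfd X \<D> L \<and>
     (\<forall>L' :: ('a, 'e) manifold. connected_integral_mfd X \<D> L' \<and> pts L \<subseteq> pts L' \<longrightarrow> pts L' = pts L)"

text \<open>\<open>B\<^sub>U(X, Y) = - g(\<nabla>\<^sub>X U, Y)\<close> for a tangent field \<open>U\<close> of the hypersurface \<open>H\<close>.\<close>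

definition null_second_form :: "('a, 'f::euclidean_space) manifold \<Rightarrow> ('a, 'f) metric \<Rightarrow>
    ('a, 'f) connection \<Rightarrow> ('a, 'e::euclidean_space) manifold \<Rightarrow> ('a \<Rightarrow> ('a, 'e) tvec) \<Rightarrow>
    'a \<Rightarrow> ('a, 'e) tvec \<Rightarrow> ('a, 'e) tvec \<Rightarrow> real" where
  "null_second_form M g \<Gamma> H U x X Y =
     - g x (covariant_derivative H M \<Gamma> (\<lambda>y. differential H M (\<lambda>z. z) y (U y)) x X)
           (differential H M (\<lambda>z. z) x Y)"

definition totally_umbilical_with :: "('a, 'f::euclidean_space) manifold \<Rightarrow> ('a, 'f) metric \<Rightarrow>
    ('a, 'f) connection \<Rightarrow> ('a, 'e::euclidean_space) manifold \<Rightarrow> ('a \<Rightarrow> ('a, 'e) tvec) \<Rightarrow>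
    ('a \<Rightarrow> real) \<Rightarrow> bool" where
  "totally_umbilical_with M g \<Gamma> H U \<mu> \<longleftrightarrow> smooth_map H euclidean_mfd \<mu> \<and>
     (\<forall>x\<in>pts H. \<forall>X\<in>tangent_space H x. \<forall>Y\<in>tangent_space H x.
        null_second_form M g \<Gamma> H U x X Y = \<mu> x * induced_metric M g H x X Y)"

definition totally_geodesic :: "('a, 'f::euclidean_space) manifold \<Rightarrow> ('a, 'f) metric \<Rightarrow>
    ('a, 'f) connection \<Rightarrow> ('a, 'e::euclidean_space) manifold \<Rightarrow> ('a \<Rightarrow> ('a, 'e) tvec) \<Rightarrow> bool" where
  "totally_geodesic M g \<Gamma> H U \<longleftrightarrow>
     (\<forall>x\<in>pts H. \<forall>X\<in>tangent_space H x. \<forall>Y\<in>tangent_space H x. null_second_form M g \<Gamma> H U x X Y = 0)"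

text \<open>The interval integral is the oriented one, so that negative \<open>t\<close> is covered.\<close>

definition conformal_factor :: "('a \<times> real \<Rightarrow> 'a) \<Rightarrow> ('a \<times> real) set \<Rightarrow> ('a \<Rightarrow> real) \<Rightarrow> 'a \<Rightarrow> real" where
  "conformal_factor \<Phi> \<O> \<mu> x = (let (p, t) = inv_into \<O> \<Phi> x in
     exp (- 2 * (LBINT s=0..ereal t. \<mu> (\<Phi> (p, s)))))"

end

theory Submission
  imports Defs
begin

text \<open>At a point \<open>\<Phi>(p, 0)\<close> the integral in the conformal factor is empty, so a constant conformal factor
  is 1. Then \<open>\<mu>\<close> has vanishing integral over every initial segment of a generator, hence
  \<open>\<mu> = 0\<close> and \<open>B\<^sub>U = 0\<close>.

  For \<open>w \<in> T\<^sub>pS\<close> let \<open>X\<^sub>w(t)\<close> be its image under the differential of \<open>q \<mapsto> \<Phi>(q, t)\<close> at \<open>p\<close>. Second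
  derivatives commute and the connection is torsion-free, so \<open>\<nabla>\<^sub>U X\<^sub>w = \<nabla>\<^bsub>X\<^sub>w\<^esub> U\<close>, and by metric
  compatibility \<open>d/dt g(X\<^sub>v, X\<^sub>w) = - B\<^sub>U(X\<^sub>v, X\<^sub>w) - B\<^sub>U(X\<^sub>w, X\<^sub>v) = 0\<close>. At \<open>t = 0\<close> this is the metric of
  \<open>S\<close>, and the tangent vectors of a leaf are exactly the \<open>X\<^sub>w(t)\<close>, with \<open>dF(X\<^sub>w(t)) = w\<close>.

  The canonical leaves are maximal because \<open>t\<close> has vanishing differential on the screen distribution
  and is therefore constant on every connected integral manifold.

  The argument needs \<open>\<Phi>\<close> to be twice differentiable, whereas the normal exponential map is only known to be
  smooth on the normal bundle \<open>N\<close>. That \<open>(p, t) \<mapsto> t \<xi>\<^sub>p\<close> is twice differentiable as a map to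
  \<open>N\<close>, and not only to the tangent bundle, follows from \<open>N\<close> being an embedded submanifold.\<close>

section \<open>Twice differentiable maps\<close>

text \<open>Composites of \<open>smooth_on\<close> maps are never shown to be smooth. The geometric
  identities consume two derivatives only, and at that order closure under composition, and under
  solving an equation G(u) = \<sigma> for u, can be proved by hand. Where the conclusion demands
  genuine smoothness, namely for the canonical leaves and their projection to \<open>S\<close>, the
  manifold structure is transported from \<open>S\<close>, so that all chart expressions are
  transitions of \<open>S\<close>, possibly with a constant time coordinate appended. Embeddedness
  of \<open>N\<close> enters in two ways. Its subspace topology makes (p, t) -> t \<xi>_p continuous
  into \<open>N\<close>, so that the map stays in one chart of \<open>N\<close> near a point. The
  immersion property then allows the coordinates in \<open>N\<close> to be recovered from those in
  the tangent bundle, by a linear left inverse of the derivative of the inclusion.\<close>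

lemma has_derivative_cong_eventually:
  assumes "\<forall>\<^sub>F y in nhds x. f y = g y" and "(f has_derivative f') (at x)"
  shows "(g has_derivative f') (at x)"
proof (rule has_derivative_transform_eventually[OF assms(2)])
  show "\<forall>\<^sub>F y in at x. f y = g y"
    using assms(1) by (auto simp: eventually_at_filter elim: eventually_mono)
qed (use eventually_nhds_x_imp_x[OF assms(1)] in auto)

text \<open>No differentiability is assumed: \<open>frechet_derivative\<close> is a choice among the
  derivatives at \<open>x\<close>. Functions that agree near \<open>x\<close> have the same
  derivatives, so the same choice is made.\<close>

lemma frechet_derivative_cong_eventually:
  assumes "\<forall>\<^sub>F y in nhds x. f y = g y"
  shows "frechet_derivative f (at x) = frechet_derivative g (at x)"
proof -
  have gf: "\<forall>\<^sub>F y in nhds x. g y = f y"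
    using assms by (rule eventually_mono) simp
  have "(f has_derivative f') (at x) \<longleftrightarrow> (g has_derivative f') (at x)" for f'
    using has_derivative_cong_eventually[OF assms] has_derivative_cong_eventually[OF gf] by blast
  then show ?thesis
    unfolding frechet_derivative_def by simp
qed

lemma differentiable_cong_eventually:
  assumes "\<forall>\<^sub>F y in nhds x. f y = g y" and "f differentiable (at x)"
  shows "g differentiable (at x)"
  using assms has_derivative_cong_eventually unfolding differentiable_def by blast

lemma frechet_derivative_eqI: "(f has_derivative f') (at x) \<Longrightarrow> frechet_derivative f (at x) = f'"
  by (simp flip: frechet_derivative_at)

lemma linear_frechet: "f differentiable (at x) \<Longrightarrow> linear (frechet_derivative f (at x))"
  using frechet_derivative_works has_derivative_linear by blast

text \<open>Equality is required on an open set around \<open>A\<close>, and \<open>A\<close> itself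
  may be arbitrary. In \<open>smooth_map\<close> the set is the chart image of a preimage; taking
  the whole chart image for \<open>B\<close> spares a proof that this smaller set is open.\<close>

lemma times_differentiable_on_cong:
  assumes "open B" and "times_differentiable_on k f A" and "A \<subseteq> B" and "\<And>x. x \<in> B \<Longrightarrow> f x = g x"
  shows "times_differentiable_on k g A"
  using assms
proof (induction k arbitrary: f g)
  case 0
  then have "continuous_on A f = continuous_on A g" by (intro continuous_on_cong) auto
  with 0 show ?case by simp
next
  case (Suc k)
  have ev: "\<forall>\<^sub>F y in nhds x. f y = g y" if "x \<in> B" for x
    using Suc.prems that by (auto simp: eventually_nhds)
  show ?case
    unfolding times_differentiable_on.simps
  proof (intro conjI ballI allI)
    show "g differentiable (at x)" if "x \<in> A" for x
      using Suc.prems(2,3) that differentiable_cong_eventually[OF ev] by auto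
    show "times_differentiable_on k (\<lambda>x. frechet_derivative g (at x) v) A" for v
      using Suc.IH[OF Suc.prems(1), of "\<lambda>x. frechet_derivative f (at x) v"] Suc.prems(2,3)
        frechet_derivative_cong_eventually[OF ev] by simp
  qed
qed

lemma smooth_on_cong_superset:
  assumes "smooth_on f A" and "open B" and "A \<subseteq> B" and "\<And>x. x \<in> B \<Longrightarrow> f x = g x"
  shows "smooth_on g A"
  using assms times_differentiable_on_cong[OF assms(2)] unfolding smooth_on_def by metis

lemma smooth_on_cong:
  assumes "smooth_on f A" and "open A" and "\<And>x. x \<in> A \<Longrightarrow> f x = g x"
  shows "smooth_on g A"
  using smooth_on_cong_superset[OF assms(1,2) order_refl assms(3)] .

section \<open>Calculus at order two\<close>

text \<open>The derivative along each fixed direction is again differentiable, without continuity of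
  the second derivatives. Openness of \<open>A\<close> is included so that identities on
  \<open>A\<close> can be differentiated.\<close>

definition twice_differentiable_on ::
  "('e::euclidean_space \<Rightarrow> 'f::euclidean_space) \<Rightarrow> 'e set \<Rightarrow> bool" where
  "twice_differentiable_on f A \<longleftrightarrow> open A \<and>
     (\<forall>x\<in>A. f differentiable (at x) \<and> (\<forall>v. (\<lambda>y. frechet_derivative f (at y) v) differentiable (at x)))"

lemma smooth_on_imp_twice_differentiable_on:
  assumes "smooth_on f A" and "open A"
  shows "twice_differentiable_on f A"
proof -
  have "times_differentiable_on (Suc (Suc 0)) f A"
    using assms(1) unfolding smooth_on_def by blast
  then show ?thesis
    using assms(2) by (simp add: twice_differentiable_on_def)
qed

lemma twice_differentiable_onD:
  assumes "twice_differentiable_on f A" and "x \<in> A"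
  shows "f differentiable (at x)"
    and "(\<lambda>y. frechet_derivative f (at y) v) differentiable (at x)"
    and "(f has_derivative frechet_derivative f (at x)) (at x)"
    and "linear (frechet_derivative f (at x))"
  using assms by (auto simp: twice_differentiable_on_def linear_frechet simp flip: frechet_derivative_works)

lemma twice_differentiable_onI:
  assumes "open A" and f': "\<And>x. x \<in> A \<Longrightarrow> (f has_derivative f' x) (at x)"
    and "\<And>x v. x \<in> A \<Longrightarrow> (\<lambda>y. f' y v) differentiable (at x)"
  shows "twice_differentiable_on f A"
  unfolding twice_differentiable_on_def
proof (intro conjI ballI allI)
  fix x v assume x: "x \<in> A"
  have "\<forall>\<^sub>F y in nhds x. f' y v = frechet_derivative f (at y) v"
    using assms(1) x f' unfolding eventually_nhds by (metis frechet_derivative_at)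
  then show "(\<lambda>y. frechet_derivative f (at y) v) differentiable (at x)"
    by (rule differentiable_cong_eventually) (rule assms(3)[OF x])
qed (use assms in \<open>auto simp: differentiable_def\<close>)

lemma twice_differentiable_on_cong:
  assumes f: "twice_differentiable_on f A" and eq: "\<And>x. x \<in> A \<Longrightarrow> f x = g x"
  shows "twice_differentiable_on g A"
proof (rule twice_differentiable_onI)
  show A: "open A" using f by (simp add: twice_differentiable_on_def)
  fix x assume x: "x \<in> A"
  show "(g has_derivative frechet_derivative f (at x)) (at x)"
    by (rule has_derivative_transform_within_open[OF twice_differentiable_onD(3)[OF f x] A x])
      (rule eq)
  show "(\<lambda>y. frechet_derivative f (at y) v) differentiable (at x)" for v
    using twice_differentiable_onD[OF f x] by blast
qed

lemma twice_differentiable_on_subset: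
  "twice_differentiable_on f A \<Longrightarrow> open B \<Longrightarrow> B \<subseteq> A \<Longrightarrow> twice_differentiable_on f B"
  by (auto simp: twice_differentiable_on_def)

lemma twice_differentiable_on_linear: "linear f \<Longrightarrow> twice_differentiable_on f UNIV"
  by (rule twice_differentiable_onI[where f' = "\<lambda>_. f"])
     (auto intro: linear_imp_has_derivative)

lemma twice_differentiable_on_Pair:
  assumes f: "twice_differentiable_on f A" and g: "twice_differentiable_on g A"
  shows "twice_differentiable_on (\<lambda>x. (f x, g x)) A"
proof (rule twice_differentiable_onI)
  show "open A" using f by (simp add: twice_differentiable_on_def)
  fix x assume x: "x \<in> A"
  show "((\<lambda>x. (f x, g x)) has_derivative
      (\<lambda>v. (frechet_derivative f (at x) v, frechet_derivative g (at x) v))) (at x)"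
    using twice_differentiable_onD(3)[OF f x] twice_differentiable_onD(3)[OF g x]
    by (rule has_derivative_Pair)
  show "(\<lambda>y. (frechet_derivative f (at y) v, frechet_derivative g (at y) v)) differentiable (at x)" for v
    using has_derivative_Pair[of "\<lambda>y. frechet_derivative f (at y) v" _ x UNIV
        "\<lambda>y. frechet_derivative g (at y) v"]
      twice_differentiable_onD(2)[OF f x, of v] twice_differentiable_onD(2)[OF g x, of v]
    unfolding differentiable_def by blast
qed

lemma twice_differentiable_on_scaleR:
  assumes f: "twice_differentiable_on f A" and r: "twice_differentiable_on r A"
  shows "twice_differentiable_on (\<lambda>x. r x *\<^sub>R f x) A"
proof (rule twice_differentiable_onI)
  show "open A" using f by (simp add: twice_differentiable_on_def)
  fix x assume x: "x \<in> A"
  show "((\<lambda>x. r x *\<^sub>R f x) has_derivative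
      (\<lambda>v. r x *\<^sub>R frechet_derivative f (at x) v + frechet_derivative r (at x) v *\<^sub>R f x)) (at x)"
    using twice_differentiable_onD(3)[OF r x] twice_differentiable_onD(3)[OF f x]
    by (rule has_derivative_scaleR)
  show "(\<lambda>y. r y *\<^sub>R frechet_derivative f (at y) v + frechet_derivative r (at y) v *\<^sub>R f y)
      differentiable (at x)" for v
    using twice_differentiable_onD(1,2)[OF f x] twice_differentiable_onD(1,2)[OF r x]
    by (intro differentiable_add differentiable_scaleR) auto
qed

text \<open>The product rule for evaluating a linear map on a vector, both depending on
  \<open>x\<close>. Differentiability of \<open>K\<close> is known only for fixed arguments, so
  \<open>K x (w x)\<close> is expanded in the basis. The rule serves second derivatives of
  composites, tangent maps, covariant derivatives and metric coefficients.\<close>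

lemma has_derivative_linear_family:
  fixes K :: "'x::real_normed_vector \<Rightarrow> 'e::euclidean_space \<Rightarrow> 'f::real_normed_vector"
  assumes lin: "\<forall>\<^sub>F x in nhds x0. linear (K x)"
    and K: "\<And>v. (\<lambda>x. K x v) differentiable (at x0)"
    and w: "(w has_derivative w') (at x0)"
  shows "((\<lambda>x. K x (w x)) has_derivative
    (\<lambda>h. frechet_derivative (\<lambda>x. K x (w x0)) (at x0) h + K x0 (w' h))) (at x0)"
proof -
  define D where "D v = frechet_derivative (\<lambda>x. K x v) (at x0)" for v
  have D: "((\<lambda>x. K x v) has_derivative D v) (at x0)" for v
    using K unfolding D_def by (simp flip: frechet_derivative_works)
  have lin0: "linear (K x0)"
    using lin by (rule eventually_nhds_x_imp_x)
  have expand: "K x v = (\<Sum>b\<in>Basis. (v \<bullet> b) *\<^sub>R K x b)" if "linear (K x)" for x v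
  proof -
    have "K x (\<Sum>b\<in>Basis. (v \<bullet> b) *\<^sub>R b) = (\<Sum>b\<in>Basis. (v \<bullet> b) *\<^sub>R K x b)"
      using that by (simp add: linear_sum linear_scale)
    then show ?thesis by (simp add: euclidean_representation)
  qed
  have main: "((\<lambda>x. K x (y x)) has_derivative
      (\<lambda>h. \<Sum>b\<in>Basis. (y x0 \<bullet> b) *\<^sub>R D b h + (y' h \<bullet> b) *\<^sub>R K x0 b)) (at x0)"
    if y: "(y has_derivative y') (at x0)" for y y'
  proof -
    have 1: "((\<lambda>x. \<Sum>b\<in>Basis. (y x \<bullet> b) *\<^sub>R K x b) has_derivative
      (\<lambda>h. \<Sum>b\<in>Basis. (y x0 \<bullet> b) *\<^sub>R D b h + (y' h \<bullet> b) *\<^sub>R K x0 b)) (at x0)"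
    proof (rule has_derivative_sum)
      fix b :: 'e assume "b \<in> Basis"
      show "((\<lambda>x. (y x \<bullet> b) *\<^sub>R K x b) has_derivative
          (\<lambda>h. (y x0 \<bullet> b) *\<^sub>R D b h + (y' h \<bullet> b) *\<^sub>R K x0 b)) (at x0)"
        using has_derivative_scaleR[OF has_derivative_inner_left[OF y, of b] D[of b]] by simp
    qed
    have 2: "\<forall>\<^sub>F x in at x0. (\<Sum>b\<in>Basis. (y x \<bullet> b) *\<^sub>R K x b) = K x (y x)"
      using lin unfolding eventually_at_filter
      by (rule eventually_mono) (intro impI, rule expand[symmetric])
    show ?thesis
      using has_derivative_transform_eventually[OF 1, where g = "\<lambda>x. K x (y x)"] 2 expand[OF lin0, of "y x0"]
      by simp
  qed
  \<comment> \<open>The rule for the constant map \<open>w x0\<close>, with uniqueness of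
    derivatives, shows that \<open>D\<close> expands linearly in the basis.\<close>
  have "D (w x0) h = (\<Sum>b\<in>Basis. (w x0 \<bullet> b) *\<^sub>R D b h)" for h
    using has_derivative_unique[OF D main[OF has_derivative_const[where c = "w x0"]]] by simp
  then have "(\<lambda>h. \<Sum>b\<in>Basis. (w x0 \<bullet> b) *\<^sub>R D b h + (w' h \<bullet> b) *\<^sub>R K x0 b) =
      (\<lambda>h. D (w x0) h + K x0 (w' h))"
    by (simp add: sum.distrib flip: expand[OF lin0])
  then show ?thesis
    using main[OF w] by (simp add: D_def)
qed

lemma frechet_derivative_comp:
  assumes "f differentiable (at (u x))" and "u differentiable (at x)"
  shows "frechet_derivative (\<lambda>x. f (u x)) (at x) v =
    frechet_derivative f (at (u x)) (frechet_derivative u (at x) v)"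
proof -
  have "((\<lambda>x. f (u x)) has_derivative
      (\<lambda>v. frechet_derivative f (at (u x)) (frechet_derivative u (at x) v))) (at x)"
    using assms has_derivative_compose[of u "frechet_derivative u (at x)" x UNIV f]
    by (simp add: frechet_derivative_works)
  then show ?thesis
    by (simp add: frechet_derivative_eqI)
qed

text \<open>By the chain rule the first derivative is a linear family evaluated at a moving vector,
  so \<open>has_derivative_linear_family\<close> differentiates it once more.\<close>

lemma twice_differentiable_on_compose:
  assumes f: "twice_differentiable_on f B" and u: "twice_differentiable_on u A" and uA: "u ` A \<subseteq> B"
  shows "twice_differentiable_on (\<lambda>x. f (u x)) A"
proof (rule twice_differentiable_onI)
  show A: "open A" using u by (simp add: twice_differentiable_on_def)
  fix x assume x: "x \<in> A"
  then have ux: "u x \<in> B" using uA by auto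
  show "((\<lambda>x. f (u x)) has_derivative
      (\<lambda>v. frechet_derivative f (at (u x)) (frechet_derivative u (at x) v))) (at x)"
    using has_derivative_compose[OF twice_differentiable_onD(3)[OF u x] twice_differentiable_onD(3)[OF f ux]] .
  have lin: "\<forall>\<^sub>F y in nhds x. linear (frechet_derivative f (at (u y)))"
    using A x uA twice_differentiable_onD(4)[OF f] unfolding eventually_nhds
    by (metis image_subset_iff)
  have K: "(\<lambda>y. frechet_derivative f (at (u y)) z) differentiable (at x)" for z
    using differentiable_chain_at[OF twice_differentiable_onD(1)[OF u x] twice_differentiable_onD(2)[OF f ux]]
    by (simp add: o_def)
  show "(\<lambda>y. frechet_derivative f (at (u y)) (frechet_derivative u (at y) v)) differentiable (at x)" for v
    using has_derivative_linear_family[OF lin K, of "\<lambda>y. frechet_derivative u (at y) v"]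
      twice_differentiable_onD(2)[OF u x]
    unfolding differentiable_def by blast
qed

section \<open>Symmetry of second derivatives\<close>

text \<open>The second difference is h^2 times the mixed derivative up to o(h^2). The mean value
  theorem along \<open>u\<close> turns it into h times a difference of first derivatives; these are
  then compared through their differentiability at the single point \<open>x\<close>, so second
  derivatives that merely exist are enough.\<close>

lemma second_difference_bound:
  fixes f :: "'e::euclidean_space \<Rightarrow> real"
  assumes f: "twice_differentiable_on f A" and x: "x \<in> A" and e: "e > 0"
  shows "\<exists>r>0. \<forall>h. 0 < h \<and> h < r \<longrightarrow>
    \<bar>f (x + h *\<^sub>R u + h *\<^sub>R v) - f (x + h *\<^sub>R u) - f (x + h *\<^sub>R v) + f x
      - h * h * frechet_derivative (\<lambda>y. frechet_derivative f (at y) u) (at x) v\<bar> \<le> e * (h * h)"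
proof -
  define D where "D y = frechet_derivative f (at y) u" for y
  define L where "L = frechet_derivative D (at x)"
  \<comment> \<open>All points that occur differ from \<open>x\<close> by at most
    \<open>h * m\<close>. The summand 1 keeps \<open>m\<close> positive when \<open>u\<close> and
    \<open>v\<close> vanish.\<close>
  define m where "m = norm u + norm v + 1"
  have m: "m > 0" by (simp add: m_def add_nonneg_pos)
  have DL: "(D has_derivative L) (at x)"
    using twice_differentiable_onD(2)[OF f x, of u] unfolding L_def D_def
    by (simp flip: frechet_derivative_works)
  have L: "linear L" using DL has_derivative_linear by blast
  \<comment> \<open>Two estimates with this constant, over a distance of at most
    \<open>h * m\<close>, add up to \<open>e * h\<close>.\<close>
  have "e / (2 * m) > 0" using e m by simp
  then obtain d where d: "d > 0"
    and dL: "\<And>y. norm (y - x) < d \<Longrightarrow> norm (D y - D x - L (y - x)) \<le> e / (2 * m) * norm (y - x)"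
    using DL unfolding has_derivative_at_alt by blast
  obtain d' where d': "d' > 0" "ball x d' \<subseteq> A"
    using f x open_contains_ball unfolding twice_differentiable_on_def by blast
  define r where "r = min d d' / m"
  have r: "r > 0" using d d' m by (simp add: r_def)
  show ?thesis
  proof (intro exI conjI allI impI)
    show "r > 0" by fact
    fix h assume h: "0 < h \<and> h < r"
    have small: "norm (a *\<^sub>R u + b *\<^sub>R v) \<le> h * m" if "0 \<le> a" "a \<le> h" "0 \<le> b" "b \<le> h" for a b
    proof -
      have "norm (a *\<^sub>R u + b *\<^sub>R v) \<le> a * norm u + b * norm v"
        using norm_triangle_ineq[of "a *\<^sub>R u" "b *\<^sub>R v"] that by simp
      also have "\<dots> \<le> h * norm u + h * norm v"
        using that by (intro add_mono mult_right_mono) auto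
      also have "\<dots> \<le> h * m" using h by (simp add: m_def algebra_simps)
      finally show ?thesis .
    qed
    have hm: "h * m < d" "h * m < d'"
      using h m unfolding r_def by (auto simp: field_simps)
    have inA: "x + a *\<^sub>R u + b *\<^sub>R v \<in> A" if "0 \<le> a" "a \<le> h" "0 \<le> b" "b \<le> h" for a b
    proof -
      have "x + (a *\<^sub>R u + b *\<^sub>R v) \<in> ball x d'"
        using small[OF that] hm unfolding mem_ball dist_norm by (subst norm_minus_commute) simp
      then show ?thesis using d'(2) by (auto simp: add.assoc)
    qed
    have der: "((\<lambda>t. f (x + t *\<^sub>R u + b *\<^sub>R v)) has_real_derivative D (x + t *\<^sub>R u + b *\<^sub>R v)) (at t)"
      if "0 \<le> t" "t \<le> h" "0 \<le> b" "b \<le> h" for t b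
    proof -
      have 1: "((\<lambda>t. x + t *\<^sub>R u + b *\<^sub>R v) has_derivative (\<lambda>t. t *\<^sub>R u)) (at t)"
        by (auto intro!: derivative_eq_intros)
      note fd = twice_differentiable_onD(3,4)[OF f inA[OF that]]
      have "((\<lambda>t. f (x + t *\<^sub>R u + b *\<^sub>R v)) has_derivative
          (\<lambda>s. frechet_derivative f (at (x + t *\<^sub>R u + b *\<^sub>R v)) (s *\<^sub>R u))) (at t)"
        using has_derivative_compose[OF 1 fd(1)] by simp
      then show ?thesis
        using fd(2) by (simp add: has_field_derivative_def linear_scale D_def mult.commute[of _ "frechet_derivative f _ u"])
    qed
    \<comment> \<open>The term \<open>0 *\<^sub>R v\<close> is kept so that \<open>der\<close> and
      \<open>est\<close> apply literally with \<open>b = 0\<close>.\<close>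
    define q where "q t = f (x + t *\<^sub>R u + h *\<^sub>R v) - f (x + t *\<^sub>R u + 0 *\<^sub>R v)" for t
    have "(q has_real_derivative D (x + t *\<^sub>R u + h *\<^sub>R v) - D (x + t *\<^sub>R u + 0 *\<^sub>R v)) (at t)"
      if "0 \<le> t" "t \<le> h" for t
      unfolding q_def using der[OF that, of h] der[OF that, of 0] h by (intro DERIV_diff) auto
    then obtain t where t: "0 < t" "t < h"
      and qt: "q h - q 0 = (h - 0) * (D (x + t *\<^sub>R u + h *\<^sub>R v) - D (x + t *\<^sub>R u + 0 *\<^sub>R v))"
      using MVT2[of 0 h q "\<lambda>t. D (x + t *\<^sub>R u + h *\<^sub>R v) - D (x + t *\<^sub>R u + 0 *\<^sub>R v)"] h by auto
    have est: "\<bar>D (x + t *\<^sub>R u + b *\<^sub>R v) - D x - L (t *\<^sub>R u + b *\<^sub>R v)\<bar> \<le> e / 2 * h" if "0 \<le> b" "b \<le> h" for b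
    proof -
      have s: "norm (t *\<^sub>R u + b *\<^sub>R v) \<le> h * m" using small[of t b] t that by simp
      have "\<bar>D (x + t *\<^sub>R u + b *\<^sub>R v) - D x - L (t *\<^sub>R u + b *\<^sub>R v)\<bar> \<le> e / (2 * m) * norm (t *\<^sub>R u + b *\<^sub>R v)"
        using dL[of "x + t *\<^sub>R u + b *\<^sub>R v"] s hm by (simp add: add.assoc)
      also have "\<dots> \<le> e / (2 * m) * (h * m)"
        using s e m by (intro mult_left_mono) auto
      finally show ?thesis using m by simp
    qed
    have LL: "L (t *\<^sub>R u + h *\<^sub>R v) = L (t *\<^sub>R u + 0 *\<^sub>R v) + h * L v"
      using L by (simp add: linear_add linear_scale)
    have aux: "\<bar>a - c - (k + l)\<bar> \<le> s \<Longrightarrow> \<bar>b - c - k\<bar> \<le> s \<Longrightarrow> \<bar>a - b - l\<bar> \<le> 2 * s"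
      for a b c k l s :: real by linarith
    have "\<bar>D (x + t *\<^sub>R u + h *\<^sub>R v) - D (x + t *\<^sub>R u + 0 *\<^sub>R v) - h * L v\<bar> \<le> 2 * (e / 2 * h)"
      by (rule aux[OF est[of h, unfolded LL] est[of 0]]) (use h in auto)
    then have "\<bar>D (x + t *\<^sub>R u + h *\<^sub>R v) - D (x + t *\<^sub>R u + 0 *\<^sub>R v) - h * L v\<bar> \<le> e * h"
      by simp
    then have "\<bar>h * (D (x + t *\<^sub>R u + h *\<^sub>R v) - D (x + t *\<^sub>R u + 0 *\<^sub>R v) - h * L v)\<bar> \<le> h * (e * h)"
      using h by (simp add: abs_mult)
    moreover have "f (x + h *\<^sub>R u + h *\<^sub>R v) - f (x + h *\<^sub>R u) - f (x + h *\<^sub>R v) + f x - h * h * L v =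
        h * (D (x + t *\<^sub>R u + h *\<^sub>R v) - D (x + t *\<^sub>R u + 0 *\<^sub>R v) - h * L v)"
      using qt by (simp add: q_def algebra_simps)
    ultimately show "\<bar>f (x + h *\<^sub>R u + h *\<^sub>R v) - f (x + h *\<^sub>R u) - f (x + h *\<^sub>R v) + f x
        - h * h * frechet_derivative (\<lambda>y. frechet_derivative f (at y) u) (at x) v\<bar> \<le> e * (h * h)"
      unfolding L_def D_def by (simp add: algebra_simps)
  qed
qed

text \<open>The second difference is symmetric in \<open>u\<close> and \<open>v\<close>, so it
  approximates both mixed derivatives. With a quarter of their supposed distance as error, the two
  errors add up to only half of that distance.\<close>

lemma second_derivative_symmetric_real:
  fixes f :: "'e::euclidean_space \<Rightarrow> real"
  assumes f: "twice_differentiable_on f A" and x: "x \<in> A"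
  shows "frechet_derivative (\<lambda>y. frechet_derivative f (at y) u) (at x) v =
    frechet_derivative (\<lambda>y. frechet_derivative f (at y) v) (at x) u" (is "?a = ?b")
proof (rule ccontr)
  assume "?a \<noteq> ?b"
  then have e: "\<bar>?a - ?b\<bar> / 4 > 0" (is "?e > 0") by simp
  obtain r where r: "r > 0" "\<And>h. 0 < h \<Longrightarrow> h < r \<Longrightarrow>
    \<bar>f (x + h *\<^sub>R u + h *\<^sub>R v) - f (x + h *\<^sub>R u) - f (x + h *\<^sub>R v) + f x - h * h * ?a\<bar> \<le> ?e * (h * h)"
    using second_difference_bound[OF f x e, of u v] by blast
  obtain s where s: "s > 0" "\<And>h. 0 < h \<Longrightarrow> h < s \<Longrightarrow>
    \<bar>f (x + h *\<^sub>R v + h *\<^sub>R u) - f (x + h *\<^sub>R v) - f (x + h *\<^sub>R u) + f x - h * h * ?b\<bar> \<le> ?e * (h * h)"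
    using second_difference_bound[OF f x e, of v u] by blast
  define h where "h = min r s / 2"
  have h: "0 < h" "h < r" "h < s" using r(1) s(1) by (auto simp: h_def)
  have aux: "\<bar>P - a\<bar> \<le> c \<Longrightarrow> \<bar>Q - b\<bar> \<le> c \<Longrightarrow> P = Q \<Longrightarrow> \<bar>a - b\<bar> \<le> 2 * c" for P Q a b c :: real
    by linarith
  have "\<bar>h * h * ?a - h * h * ?b\<bar> \<le> 2 * (?e * (h * h))"
    by (rule aux[OF r(2)[OF h(1,2)] s(2)[OF h(1,3)]]) (simp add: add_ac)
  moreover have "\<bar>h * h * ?a - h * h * ?b\<bar> = (h * h) * \<bar>?a - ?b\<bar>"
    unfolding right_diff_distrib[symmetric] by (simp add: abs_mult)
  ultimately have "(h * h) * (4 * ?e) \<le> (h * h) * (2 * ?e)"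
    by simp
  then have "4 * ?e \<le> 2 * ?e"
    using h(1) by (simp only: mult_le_cancel_left_pos mult_pos_pos)
  then show False using e by linarith
qed

lemma second_derivative_symmetric:
  assumes f: "twice_differentiable_on f A" and x: "x \<in> A"
  shows "frechet_derivative (\<lambda>y. frechet_derivative f (at y) u) (at x) v =
    frechet_derivative (\<lambda>y. frechet_derivative f (at y) v) (at x) u"
proof (rule euclidean_eqI)
  fix b :: 'b assume "b \<in> Basis"
  have lin: "linear (\<lambda>z::'b. z \<bullet> b)" by (simp add: bounded_linear.linear bounded_linear_inner_left)
  have fb: "twice_differentiable_on (\<lambda>y. f y \<bullet> b) A"
    using twice_differentiable_on_compose[OF twice_differentiable_on_linear[OF lin] f] by simp
  have d1: "frechet_derivative (\<lambda>y. f y \<bullet> b) (at y) w = frechet_derivative f (at y) w \<bullet> b" if "y \<in> A" for y w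
    using has_derivative_inner_left[OF twice_differentiable_onD(3)[OF f that], of b]
    by (simp add: frechet_derivative_eqI)
  have d2: "frechet_derivative (\<lambda>y. frechet_derivative (\<lambda>y. f y \<bullet> b) (at y) w) (at x) z =
      frechet_derivative (\<lambda>y. frechet_derivative f (at y) w) (at x) z \<bullet> b" for w z
  proof -
    have "\<forall>\<^sub>F y in nhds x. frechet_derivative (\<lambda>y. f y \<bullet> b) (at y) w = frechet_derivative f (at y) w \<bullet> b"
      using d1 x f unfolding eventually_nhds twice_differentiable_on_def by blast
    from frechet_derivative_cong_eventually[OF this]
    have "frechet_derivative (\<lambda>y. frechet_derivative (\<lambda>y. f y \<bullet> b) (at y) w) (at x) z =
      frechet_derivative (\<lambda>y. frechet_derivative f (at y) w \<bullet> b) (at x) z" by simp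
    also have "\<dots> = frechet_derivative (\<lambda>y. frechet_derivative f (at y) w) (at x) z \<bullet> b"
    proof -
      have "((\<lambda>y. frechet_derivative f (at y) w) has_derivative
          frechet_derivative (\<lambda>y. frechet_derivative f (at y) w) (at x)) (at x)"
        using twice_differentiable_onD(2)[OF f x] by (simp flip: frechet_derivative_works)
      from frechet_derivative_eqI[OF has_derivative_inner_left[OF this, of b]]
      show ?thesis by simp
    qed
    finally show ?thesis .
  qed
  show "frechet_derivative (\<lambda>y. frechet_derivative f (at y) u) (at x) v \<bullet> b =
    frechet_derivative (\<lambda>y. frechet_derivative f (at y) v) (at x) u \<bullet> b"
    using second_derivative_symmetric_real[OF fb x, of u v] by (simp add: d2)
qed

section \<open>Local injectivity, inverse relations and immersions\<close>

text \<open>Continuity of the derivative in operator norm, the form that local injectivity requires.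
  It follows from continuity on the finitely many basis vectors.\<close>

lemma twice_differentiable_imp_onorm_continuous:
  assumes f: "twice_differentiable_on f A" and x: "x \<in> A"
  shows "((\<lambda>y. onorm (\<lambda>v. frechet_derivative f (at y) v - frechet_derivative f (at x) v)) \<longlongrightarrow> 0) (nhds x)"
proof (rule Lim_null_comparison)
  have A: "open A" using f by (simp add: twice_differentiable_on_def)
  let ?B = "\<lambda>y. \<Sum>b\<in>Basis. norm (frechet_derivative f (at y) b - frechet_derivative f (at x) b)"
  have "norm (onorm (\<lambda>v. frechet_derivative f (at y) v - frechet_derivative f (at x) v)) \<le> ?B y"
    if y: "y \<in> A" for y
  proof -
    have "linear (\<lambda>v. frechet_derivative f (at y) v - frechet_derivative f (at x) v)"
      using twice_differentiable_onD(4)[OF f] x y by (intro linear_compose_sub) auto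
    then have bl: "bounded_linear (\<lambda>v. frechet_derivative f (at y) v - frechet_derivative f (at x) v)"
      by (simp add: linear_conv_bounded_linear)
    show ?thesis
      using onorm_componentwise[OF bl] onorm_pos_le[OF bl] by simp
  qed
  then show "\<forall>\<^sub>F y in nhds x.
      norm (onorm (\<lambda>v. frechet_derivative f (at y) v - frechet_derivative f (at x) v)) \<le> ?B y"
    using A x unfolding eventually_nhds by blast
  have "isCont (\<lambda>y. frechet_derivative f (at y) b) x" for b
    using twice_differentiable_onD(2)[OF f x] by (simp add: differentiable_imp_continuous_within)
  then have "((\<lambda>y. frechet_derivative f (at y) b) \<longlongrightarrow> frechet_derivative f (at x) b) (nhds x)" for b
    by (rule tendsto_at_iff_tendsto_nhds[THEN iffD1, OF isContD])
  then have "(?B \<longlongrightarrow> (\<Sum>b\<in>(Basis::'a set). norm (frechet_derivative f (at x) b - frechet_derivative f (at x) b))) (nhds x)"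
    by (intro tendsto_intros)
  then show "(?B \<longlongrightarrow> 0) (nhds x)" by simp
qed

lemma twice_differentiable_locally_injective:
  fixes G :: "'e::euclidean_space \<Rightarrow> 'f::euclidean_space"
  assumes G: "twice_differentiable_on G A" and x: "x \<in> A" and inj: "inj (frechet_derivative G (at x))"
  obtains B where "open B" "x \<in> B" "B \<subseteq> A" "inj_on G B"
    "\<And>z. z \<in> B \<Longrightarrow> inj (frechet_derivative G (at z))"
proof -
  have A: "open A" using G by (simp add: twice_differentiable_on_def)
  let ?N = "\<lambda>y. onorm (\<lambda>v. frechet_derivative G (at y) v - frechet_derivative G (at x) v)"
  have lim: "(?N \<longlongrightarrow> 0) (nhds x)"
    by (rule twice_differentiable_imp_onorm_continuous[OF G x])
  obtain g' where g': "linear g'" "g' \<circ> frechet_derivative G (at x) = id"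
    using linear_injective_left_inverse[OF twice_differentiable_onD(4)[OF G x] inj] by blast
  have blg: "bounded_linear g'" using g'(1) by (simp add: linear_conv_bounded_linear)
  have small: "\<exists>d>0. \<forall>y. dist x y < d \<longrightarrow> ?N y < e" if "e > 0" for e
    using order_tendstoD(2)[OF lim that] unfolding eventually_nhds_metric
    by (simp add: dist_commute)
  obtain r where r: "r > 0" "ball x r \<subseteq> A" "inj_on G (ball x r)"
  proof (rule has_derivative_locally_injective[where f = G and f' = "\<lambda>y. frechet_derivative G (at y)",
        OF x A blg g'(2)])
    show "(G has_derivative frechet_derivative G (at y)) (at y)" if "y \<in> A" for y
      using twice_differentiable_onD(3)[OF G that] .
  qed (use small in auto)
  obtain K where K: "K > 0" "\<And>v. norm (g' v) \<le> norm v * K"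
    using bounded_linear.pos_bounded[OF blg] by blast
  \<comment> \<open>A left inverse bounded by \<open>K\<close> still detects the kernel after a
    perturbation of norm below \<open>1 / K\<close>, so derivatives near \<open>x\<close> remain
    injective.\<close>
  obtain d where d: "d > 0" "\<And>y. dist x y < d \<Longrightarrow> ?N y < 1 / K"
    using small[of "1 / K"] K by auto
  show ?thesis
  proof
    show "open (ball x r \<inter> ball x d)" "x \<in> ball x r \<inter> ball x d" "ball x r \<inter> ball x d \<subseteq> A"
      "inj_on G (ball x r \<inter> ball x d)"
      using r d by (auto intro: inj_on_subset)
    fix z assume z: "z \<in> ball x r \<inter> ball x d"
    then have zA: "z \<in> A" using r by auto
    have lin: "linear (frechet_derivative G (at z))" "linear (frechet_derivative G (at x))"
      using twice_differentiable_onD(4)[OF G] zA x by auto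
    have "v = 0" if v: "frechet_derivative G (at z) v = 0" for v
    proof (rule ccontr)
      assume "v \<noteq> 0"
      have bl: "bounded_linear (\<lambda>v. frechet_derivative G (at z) v - frechet_derivative G (at x) v)"
        using lin by (simp add: linear_conv_bounded_linear bounded_linear_sub)
      have "norm v = norm (g' (frechet_derivative G (at x) v))"
        using g'(2) by (simp add: fun_eq_iff)
      also have "\<dots> \<le> norm (frechet_derivative G (at x) v) * K" by (rule K)
      also have "norm (frechet_derivative G (at x) v) =
          norm (frechet_derivative G (at z) v - frechet_derivative G (at x) v)"
        using v by simp
      also have "\<dots> \<le> ?N z * norm v" by (rule onorm[OF bl])
      also have "?N z * norm v < 1 / K * norm v"
        using d(2)[of z] z \<open>v \<noteq> 0\<close> by (intro mult_strict_right_mono) auto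
      finally show False using K by simp
    qed
    then show "inj (frechet_derivative G (at z))"
      using lin(1) linear_injective_0 by blast
  qed
qed

text \<open>Near \<open>x\<close>, \<open>u\<close> is forced to be the inverse of \<open>G\<close>
  on \<open>B\<close> after \<open>\<sigma>\<close>. Both sides of \<open>G\<close> have the same
  dimension, so its injective derivatives are invertible. The regularity of \<open>u\<close> comes
  out of the equation; its values only have to stay in \<open>B\<close>.\<close>

lemma differentiable_of_inverse_relation:
  fixes G :: "'e::euclidean_space \<Rightarrow> 'e" and u :: "'x::real_normed_vector \<Rightarrow> 'e"
  assumes B: "open B" and injG: "inj_on G B"
    and G: "\<And>z. z \<in> B \<Longrightarrow> G differentiable (at z)"
    and G': "\<And>z. z \<in> B \<Longrightarrow> inj (frechet_derivative G (at z))"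
    and u: "\<forall>\<^sub>F y in nhds x. u y \<in> B \<and> G (u y) = \<sigma> y"
    and \<sigma>: "\<sigma> differentiable (at x)"
  shows "u differentiable (at x)"
proof -
  define g where "g = inv_into B G"
  have gG: "g (G z) = z" if "z \<in> B" for z using that injG by (simp add: g_def)
  have ux: "u x \<in> B" "G (u x) = \<sigma> x" using eventually_nhds_x_imp_x[OF u] by auto
  obtain g' where g': "frechet_derivative G (at (u x)) \<circ> g' = id"
    using G'[OF ux(1)] linear_frechet[OF G[OF ux(1)]] linear_injective_imp_surjective
      linear_surjective_right_inverse by metis
  have "continuous_on B G"
    using G B by (simp add: continuous_on_eq_continuous_at differentiable_imp_continuous_within)
  from has_derivative_inverse_strong[OF B ux(1) this gG _ g']
  have "(g has_derivative g') (at (\<sigma> x))"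
    using G[OF ux(1)] ux(2) by (simp add: frechet_derivative_works)
  then have "(\<lambda>y. g (\<sigma> y)) differentiable (at x)"
    using \<sigma> differentiable_chain_at[of \<sigma> x g] by (auto simp: o_def differentiable_def)
  moreover have "\<forall>\<^sub>F y in nhds x. g (\<sigma> y) = u y"
    using u by (rule eventually_mono) (metis gG)
  ultimately show ?thesis
    by (rule differentiable_cong_eventually[rotated])
qed

text \<open>The derivatives of \<open>u\<close> solve an equation of the same kind, for the tangent map of \<open>G\<close>.\<close>

lemma twice_differentiable_of_inverse_relation:
  fixes G :: "'e::euclidean_space \<Rightarrow> 'e" and u :: "'x::euclidean_space \<Rightarrow> 'e"
  assumes G: "twice_differentiable_on G B" and injG: "inj_on G B"
    and G': "\<And>z. z \<in> B \<Longrightarrow> inj (frechet_derivative G (at z))"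
    and \<sigma>: "twice_differentiable_on \<sigma> A"
    and u: "\<And>y. y \<in> A \<Longrightarrow> u y \<in> B" and Gu: "\<And>y. y \<in> A \<Longrightarrow> G (u y) = \<sigma> y"
  shows "twice_differentiable_on u A"
proof -
  have A: "open A" and B: "open B" using \<sigma> G by (auto simp: twice_differentiable_on_def)
  have ev: "\<forall>\<^sub>F y in nhds x. y \<in> A" if "x \<in> A" for x
    using A that by (rule eventually_nhds_in_open)
  have du: "u differentiable (at x)" if "x \<in> A" for x
    by (rule differentiable_of_inverse_relation[OF B injG twice_differentiable_onD(1)[OF G] G' _
          twice_differentiable_onD(1)[OF \<sigma> that]])
      (use ev[OF that] u Gu in \<open>auto elim: eventually_mono\<close>)
  have w: "frechet_derivative G (at (u y)) (frechet_derivative u (at y) v) = frechet_derivative \<sigma> (at y) v"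
    if "y \<in> A" for y v
  proof -
    have "\<forall>\<^sub>F z in nhds y. G (u z) = \<sigma> z" using ev[OF that] Gu by (auto elim: eventually_mono)
    from frechet_derivative_cong_eventually[OF this] show ?thesis
      using frechet_derivative_comp[OF twice_differentiable_onD(1)[OF G u[OF that]] du[OF that], of v] by simp
  qed
  define TG where "TG = (\<lambda>(z, k). (G z, frechet_derivative G (at z) k))"
  have TG: "(TG has_derivative (\<lambda>(h, l). (frechet_derivative G (at z) h,
      frechet_derivative (\<lambda>z. frechet_derivative G (at z) k) (at z) h + frechet_derivative G (at z) l))) (at (z, k))"
    if z: "z \<in> B" for z k
  proof -
    have fst': "(fst has_derivative fst) (at (z, k))"
      by (simp add: bounded_linear_imp_has_derivative bounded_linear_fst)
    have snd': "(snd has_derivative snd) (at (z, k))"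
      by (simp add: bounded_linear_imp_has_derivative bounded_linear_snd)
    have 1: "((\<lambda>p. G (fst p)) has_derivative (\<lambda>h. frechet_derivative G (at z) (fst h))) (at (z, k))"
      using has_derivative_compose[OF fst', of G] twice_differentiable_onD(3)[OF G z] by simp
    have lin: "\<forall>\<^sub>F p in nhds (z, k). linear (frechet_derivative G (at (fst p)))"
      using eventually_nhds_in_open[of "B \<times> UNIV" "(z, k)"] B z twice_differentiable_onD(4)[OF G]
      by (auto simp: open_Times elim!: eventually_mono)
    have c: "((\<lambda>p. frechet_derivative G (at (fst p)) l) has_derivative
        (\<lambda>h. frechet_derivative (\<lambda>z. frechet_derivative G (at z) l) (at z) (fst h))) (at (z, k))" for l
      using has_derivative_compose[OF fst', of "\<lambda>z. frechet_derivative G (at z) l"]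
        twice_differentiable_onD(2)[OF G z] by (simp add: frechet_derivative_works)
    have 2: "((\<lambda>p. frechet_derivative G (at (fst p)) (snd p)) has_derivative
        (\<lambda>h. frechet_derivative (\<lambda>z. frechet_derivative G (at z) k) (at z) (fst h)
          + frechet_derivative G (at z) (snd h))) (at (z, k))"
    proof -
      have d: "(\<lambda>p. frechet_derivative G (at (fst p)) l) differentiable (at (z, k))" for l
        using c unfolding differentiable_def by blast
      show ?thesis
        using has_derivative_linear_family[OF lin d snd'] unfolding snd_conv fst_conv
          c[THEN frechet_derivative_eqI, of k] .
    qed
    show ?thesis
      using has_derivative_Pair[OF 1 2] by (simp add: TG_def case_prod_beta')
  qed
  have Tdiff: "TG differentiable (at p)" if "p \<in> B \<times> UNIV" for p
    using that TG[of "fst p" "snd p"] by (auto simp: differentiable_def)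
  have Tinj: "inj_on TG (B \<times> UNIV)"
  proof (rule inj_onI, clarify)
    fix z k y l assume *: "z \<in> B" "y \<in> B" "TG (z, k) = TG (y, l)"
    then have "z = y" using injG by (simp add: TG_def inj_on_eq_iff)
    with * show "z = y \<and> k = l" using G'[of y] by (simp add: TG_def inj_eq)
  qed
  \<comment> \<open>The derivative of \<open>TG\<close> is block triangular with the derivative of
    \<open>G\<close> in both diagonal blocks.\<close>
  have Tinj': "inj (frechet_derivative TG (at p))" if p: "p \<in> B \<times> UNIV" for p
  proof -
    obtain z k where zk: "p = (z, k)" "z \<in> B" using p by auto
    note lin = twice_differentiable_onD(4)[OF G zk(2)]
    have lin2: "linear (frechet_derivative (\<lambda>z. frechet_derivative G (at z) k) (at z))"
      using twice_differentiable_onD(2)[OF G zk(2)] by (rule linear_frechet)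
    have inj0: "frechet_derivative G (at z) h = 0 \<Longrightarrow> h = 0" for h
      using G'[OF zk(2)] lin by (simp add: linear_injective_0)
    have "linear (frechet_derivative TG (at p))" using Tdiff[OF p] by (rule linear_frechet)
    moreover have "q = 0" if q: "frechet_derivative TG (at p) q = 0" for q
    proof -
      have *: "frechet_derivative G (at z) (fst q) = 0"
        "frechet_derivative (\<lambda>z. frechet_derivative G (at z) k) (at z) (fst q)
          + frechet_derivative G (at z) (snd q) = 0"
        using q frechet_derivative_eqI[OF TG[OF zk(2), of k]]
        by (simp_all add: zk(1) case_prod_beta' zero_prod_def)
      then have "fst q = 0" by (simp add: inj0)
      with *(2) have "frechet_derivative G (at z) (snd q) = 0" by (simp add: linear_0[OF lin2])
      then have "snd q = 0" by (rule inj0)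
      with \<open>fst q = 0\<close> show ?thesis by (simp add: prod_eq_iff)
    qed
    ultimately show ?thesis by (simp add: linear_injective_0)
  qed
  have "(\<lambda>y. frechet_derivative u (at y) v) differentiable (at x)" if x: "x \<in> A" for x v
  proof -
    have "(\<lambda>y. (u y, frechet_derivative u (at y) v)) differentiable (at x)"
    proof (rule differentiable_of_inverse_relation[OF _ Tinj Tdiff Tinj'])
      show "open (B \<times> (UNIV::'e set))" using B by (simp add: open_Times)
      show "\<forall>\<^sub>F y in nhds x. (u y, frechet_derivative u (at y) v) \<in> B \<times> UNIV \<and>
          TG (u y, frechet_derivative u (at y) v) = (\<sigma> y, frechet_derivative \<sigma> (at y) v)"
        using ev[OF x] by (rule eventually_mono) (simp add: TG_def u Gu w)
      show "(\<lambda>y. (\<sigma> y, frechet_derivative \<sigma> (at y) v)) differentiable (at x)"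
        using has_derivative_Pair twice_differentiable_onD(1,2)[OF \<sigma> x] unfolding differentiable_def by blast
    qed
    then show ?thesis
      unfolding differentiable_def using has_derivative_snd by fastforce
  qed
  then show ?thesis
    using A du by (simp add: twice_differentiable_on_def)
qed

text \<open>Composing \<open>j\<close> with a linear left inverse \<open>L\<close> of its derivative
  gives a map between spaces of equal dimension that is locally injective with injective
  derivatives, and \<open>u\<close> solves an inverse relation for it. One neighbourhood
  \<open>B\<close> serves all \<open>u\<close>.\<close>

lemma immersion_reflects_twice_differentiable:
  fixes j :: "'e::euclidean_space \<Rightarrow> 'f::euclidean_space"
  assumes j: "twice_differentiable_on j A" and x: "x \<in> A" and inj: "inj (frechet_derivative j (at x))"
  obtains B where "open B" "x \<in> B" "B \<subseteq> A"
    "\<And>(u :: 'x::euclidean_space \<Rightarrow> 'e) C. twice_differentiable_on (\<lambda>y. j (u y)) C \<Longrightarrow> u ` C \<subseteq> B \<Longrightarrow>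
       twice_differentiable_on u C"
proof -
  obtain L where L: "linear L" "L \<circ> frechet_derivative j (at x) = id"
    using linear_injective_left_inverse[OF twice_differentiable_onD(4)[OF j x] inj] by blast
  have Lt: "twice_differentiable_on L UNIV" using L(1) by (rule twice_differentiable_on_linear)
  have G: "twice_differentiable_on (\<lambda>z. L (j z)) A"
    using twice_differentiable_on_compose[OF Lt j] by simp
  have "((\<lambda>z. L (j z)) has_derivative (\<lambda>h. L (frechet_derivative j (at x) h))) (at x)"
    using has_derivative_compose[OF twice_differentiable_onD(3)[OF j x] linear_imp_has_derivative[OF L(1)]] .
  then have "frechet_derivative (\<lambda>z. L (j z)) (at x) = id"
    using frechet_derivative_eqI L(2) unfolding o_def by metis
  then have "inj (frechet_derivative (\<lambda>z. L (j z)) (at x))" by simp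
  then obtain B where B: "open B" "x \<in> B" "B \<subseteq> A" "inj_on (\<lambda>z. L (j z)) B"
    "\<And>z. z \<in> B \<Longrightarrow> inj (frechet_derivative (\<lambda>z. L (j z)) (at z))"
    using twice_differentiable_locally_injective[OF G x] by blast
  show ?thesis
  proof (rule that[OF B(1-3)])
    fix u :: "'x \<Rightarrow> 'e" and C
    assume u: "twice_differentiable_on (\<lambda>y. j (u y)) C" "u ` C \<subseteq> B"
    show "twice_differentiable_on u C"
    proof (rule twice_differentiable_of_inverse_relation[OF _ B(4,5)])
      show "twice_differentiable_on (\<lambda>z. L (j z)) B" using twice_differentiable_on_subset[OF G] B by blast
      show "twice_differentiable_on (\<lambda>y. L (j (u y))) C"
        using twice_differentiable_on_compose[OF Lt u(1)] by simp
    qed (use u in auto)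
  qed
qed

section \<open>Differentials in charts\<close>

text \<open>The part of the axioms of a smooth manifold that the calculus of differentials needs. It involves
  no topology on the points, and it is therefore easy to verify for tangent bundles and for the
  hypersurface.\<close>

definition differentiable_atlas :: "('a, 'e::euclidean_space) manifold \<Rightarrow> bool" where
  "differentiable_atlas X \<longleftrightarrow>
     (\<forall>c\<in>charts X. inj_on (snd c) (fst c) \<and> open (snd c ` fst c)) \<and>
     (\<Union>c\<in>charts X. fst c) = pts X \<and>
     (\<forall>c\<in>charts X. \<forall>d\<in>charts X. open (snd c ` (fst c \<inter> fst d)) \<and>
        (\<forall>p\<in>fst c \<inter> fst d. (snd d \<circ> chart_inv c) differentiable (at (snd c p))))"

lemma chart_image_open:
  assumes X: "smooth_manifold X" and c: "c \<in> charts X" and W: "openin (mtop X) W"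
  shows "open (snd c ` (fst c \<inter> W))"
proof -
  have h: "homeomorphic_map (subtopology (mtop X) (fst c)) (top_of_set (snd c ` fst c)) (snd c)"
    and o: "open (snd c ` fst c)"
    using X c unfolding smooth_manifold_def by blast+
  have "openin (subtopology (mtop X) (fst c)) (fst c \<inter> W)"
    using W by (simp add: openin_subtopology_Int2)
  then have "openin (top_of_set (snd c ` fst c)) (snd c ` (fst c \<inter> W))"
    using h homeomorphic_imp_open_map open_map_def by blast
  then show ?thesis using o openin_open_eq by blast
qed

lemma smooth_manifold_charts:
  assumes "smooth_manifold X" and "c \<in> charts X"
  shows "openin (mtop X) (fst c)" and "inj_on (snd c) (fst c)" and "open (snd c ` fst c)"
    and "fst c \<subseteq> pts X"
proof -
  show o: "openin (mtop X) (fst c)" and "open (snd c ` fst c)"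
    using assms unfolding smooth_manifold_def by blast+
  have "homeomorphic_map (subtopology (mtop X) (fst c)) (top_of_set (snd c ` fst c)) (snd c)"
    using assms unfolding smooth_manifold_def by blast
  moreover show sub: "fst c \<subseteq> pts X" using o by (rule openin_subset)
  ultimately show "inj_on (snd c) (fst c)"
    using homeomorphic_imp_injective_map by (fastforce simp: Int_absorb1)
qed

lemma smooth_manifold_imp_differentiable_atlas:
  assumes X: "smooth_manifold X"
  shows "differentiable_atlas X"
  unfolding differentiable_atlas_def
proof (intro conjI ballI)
  show "(\<Union>c\<in>charts X. fst c) = pts X" using X unfolding smooth_manifold_def by blast
next
  fix c d p assume c: "c \<in> charts X" and d: "d \<in> charts X" and p: "p \<in> fst c \<inter> fst d"
  have "smooth_on (snd d \<circ> chart_inv c) (snd c ` (fst c \<inter> fst d))"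
    using X c d unfolding smooth_manifold_def by blast
  moreover have "open (snd c ` (fst c \<inter> fst d))"
    using chart_image_open[OF X c] smooth_manifold_charts[OF X d] by blast
  ultimately have "twice_differentiable_on (snd d \<circ> chart_inv c) (snd c ` (fst c \<inter> fst d))"
    by (rule smooth_on_imp_twice_differentiable_on)
  then show "(snd d \<circ> chart_inv c) differentiable (at (snd c p))"
    using p by (intro twice_differentiable_onD(1)) auto
qed (use smooth_manifold_charts[OF X] chart_image_open[OF X] in auto)

context
  fixes X :: "('a, 'e::euclidean_space) manifold"
  assumes X: "differentiable_atlas X"
begin

lemma charts_at_nonempty: "p \<in> pts X \<Longrightarrow> \<exists>c. c \<in> charts_at X p"
  using X unfolding differentiable_atlas_def charts_at_def by blast

lemma chart_at_in_charts_at: "p \<in> pts X \<Longrightarrow> chart_at X p \<in> charts_at X p"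
  unfolding chart_at_def using charts_at_nonempty by (rule someI_ex)

lemma charts_at_pts: "c \<in> charts_at X p \<Longrightarrow> p \<in> pts X"
  using X unfolding differentiable_atlas_def charts_at_def by auto

lemma chart_inv_chart: "c \<in> charts X \<Longrightarrow> p \<in> fst c \<Longrightarrow> chart_inv c (snd c p) = p"
  using X unfolding differentiable_atlas_def by simp

lemma eventually_in_chart_overlap:
  assumes "c \<in> charts_at X p" and "d \<in> charts_at X p"
  shows "\<forall>\<^sub>F x in nhds (snd c p). chart_inv c x \<in> fst c \<and> chart_inv c x \<in> fst d \<and> snd c (chart_inv c x) = x"
proof -
  have "open (snd c ` (fst c \<inter> fst d))" and "snd c p \<in> snd c ` (fst c \<inter> fst d)"
    using X assms unfolding differentiable_atlas_def charts_at_def by auto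
  then have "\<forall>\<^sub>F x in nhds (snd c p). x \<in> snd c ` (fst c \<inter> fst d)"
    by (rule eventually_nhds_in_open)
  then show ?thesis
    by (rule eventually_mono) (use assms chart_inv_chart in \<open>auto simp: charts_at_def\<close>)
qed

lemma eventually_in_chart:
  assumes "c \<in> charts_at X p"
  shows "\<forall>\<^sub>F x in nhds (snd c p). chart_inv c x \<in> pts X"
  using eventually_in_chart_overlap[OF assms assms]
proof (rule eventually_mono)
  fix x assume "chart_inv c x \<in> fst c \<and> chart_inv c x \<in> fst c \<and> snd c (chart_inv c x) = x"
  then show "chart_inv c x \<in> pts X"
    using assms charts_at_pts[of c] by (simp add: charts_at_def)
qed

end

text \<open>The neighbourhood condition makes the chart expression of \<open>f\<close> meaningful near \<open>p\<close>, so that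
  such derivatives compose; it replaces continuity of \<open>f\<close>.\<close>

definition has_chart_derivative :: "('a, 'e::euclidean_space) manifold \<Rightarrow>
    ('b, 'f::euclidean_space) manifold \<Rightarrow> ('a \<Rightarrow> 'b) \<Rightarrow> 'a \<Rightarrow> ('a, 'e) chart \<Rightarrow> ('b, 'f) chart \<Rightarrow>
    ('e \<Rightarrow> 'f) \<Rightarrow> bool" where
  "has_chart_derivative X Y f p c d f' \<longleftrightarrow> c \<in> charts_at X p \<and> d \<in> charts_at Y (f p) \<and>
     (\<forall>\<^sub>F x in nhds (snd c p). f (chart_inv c x) \<in> fst d) \<and>
     ((\<lambda>x. snd d (f (chart_inv c x))) has_derivative f') (at (snd c p))"

abbreviation transition_derivative :: "('a, 'e::euclidean_space) chart \<Rightarrow> ('a, 'e) chart \<Rightarrow> 'a \<Rightarrow> 'e \<Rightarrow> 'e" where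
  "transition_derivative c d p \<equiv> frechet_derivative (snd d \<circ> chart_inv c) (at (snd c p))"

definition mfd_differentiable :: "('a, 'e::euclidean_space) manifold \<Rightarrow>
    ('b, 'f::euclidean_space) manifold \<Rightarrow> ('a \<Rightarrow> 'b) \<Rightarrow> 'a \<Rightarrow> bool" where
  "mfd_differentiable X Y f p \<longleftrightarrow> (\<exists>c d f'. has_chart_derivative X Y f p c d f')"

lemma mfd_differentiableI: "has_chart_derivative X Y f p c d f' \<Longrightarrow> mfd_differentiable X Y f p"
  unfolding mfd_differentiable_def by blast

lemma has_chart_derivative_unique:
  "has_chart_derivative X Y f p c d f1 \<Longrightarrow> has_chart_derivative X Y f p c d f2 \<Longrightarrow> f1 = f2"
  unfolding has_chart_derivative_def using has_derivative_unique by blast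

lemma has_chart_derivative_linear: "has_chart_derivative X Y f p c d f' \<Longrightarrow> linear f'"
  unfolding has_chart_derivative_def using has_derivative_linear by blast

lemma has_chart_derivative_transition:
  assumes X: "differentiable_atlas X" and c: "c \<in> charts_at X p" and d: "d \<in> charts_at X p"
  shows "has_chart_derivative X X (\<lambda>q. q) p c d (transition_derivative c d p)"
proof -
  have "(snd d \<circ> chart_inv c) differentiable (at (snd c p))"
    using X c d unfolding differentiable_atlas_def charts_at_def by blast
  then have "((\<lambda>x. snd d (chart_inv c x)) has_derivative transition_derivative c d p) (at (snd c p))"
    by (simp add: frechet_derivative_works o_def)
  then show ?thesis
    unfolding has_chart_derivative_def using c d eventually_in_chart_overlap[OF X c d]
    by (auto elim: eventually_mono)
qed

text \<open>The neighbourhood condition of \<open>f\<close> allows the middle chart \<open>d\<close>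
  to be cancelled near \<open>p\<close>. That of \<open>g\<close> is pulled back along the chart
  expression of \<open>f\<close>, which is continuous because it is differentiable.\<close>

lemma has_chart_derivative_compose:
  assumes X: "differentiable_atlas X" and Y: "differentiable_atlas Y"
    and f: "has_chart_derivative X Y f p c d f'" and g: "has_chart_derivative Y Z g (f p) d e g'"
  shows "has_chart_derivative X Z (\<lambda>q. g (f q)) p c e (\<lambda>v. g' (f' v))"
proof -
  define u where "u x = snd d (f (chart_inv c x))" for x
  have c: "c \<in> charts_at X p" and d: "d \<in> charts_at Y (f p)" and e: "e \<in> charts_at Z (g (f p))"
    and fd: "\<forall>\<^sub>F x in nhds (snd c p). f (chart_inv c x) \<in> fst d"
    and u: "(u has_derivative f') (at (snd c p))"
    and ge: "\<forall>\<^sub>F y in nhds (snd d (f p)). g (chart_inv d y) \<in> fst e"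
    and g': "((\<lambda>y. snd e (g (chart_inv d y))) has_derivative g') (at (snd d (f p)))"
    using f g unfolding has_chart_derivative_def u_def by auto
  have u0: "u (snd c p) = snd d (f p)"
    using c chart_inv_chart[OF X] by (simp add: u_def charts_at_def)
  have dinv: "\<forall>\<^sub>F x in nhds (snd c p). chart_inv d (u x) = f (chart_inv c x)"
    using fd by (rule eventually_mono) (use d chart_inv_chart[OF Y] in \<open>simp add: u_def charts_at_def\<close>)
  have "isCont u (snd c p)" using u has_derivative_continuous by blast
  then have "(u \<longlongrightarrow> snd d (f p)) (nhds (snd c p))"
    unfolding u0[symmetric] by (intro tendsto_at_iff_tendsto_nhds[THEN iffD1, OF isContD])
  then have "\<forall>\<^sub>F x in nhds (snd c p). g (chart_inv d (u x)) \<in> fst e"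
    using ge eventually_compose_filterlim by fastforce
  then have 1: "\<forall>\<^sub>F x in nhds (snd c p). g (f (chart_inv c x)) \<in> fst e"
    using dinv by eventually_elim simp
  have "((\<lambda>x. snd e (g (chart_inv d (u x)))) has_derivative (\<lambda>v. g' (f' v))) (at (snd c p))"
    using has_derivative_compose[OF u, of "\<lambda>y. snd e (g (chart_inv d y))" g'] g' u0 by simp
  then have "((\<lambda>x. snd e (g (f (chart_inv c x)))) has_derivative (\<lambda>v. g' (f' v))) (at (snd c p))"
    by (rule has_derivative_cong_eventually[rotated]) (use dinv in \<open>auto elim: eventually_mono\<close>)
  then show ?thesis
    using 1 c e unfolding has_chart_derivative_def by simp
qed

lemma has_chart_derivative_change_charts:
  assumes X: "differentiable_atlas X" and Y: "differentiable_atlas Y"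
    and f: "has_chart_derivative X Y f p c d f'" and c': "c' \<in> charts_at X p" and d': "d' \<in> charts_at Y (f p)"
  shows "has_chart_derivative X Y f p c' d'
    (\<lambda>v. transition_derivative d d' (f p) (f' (transition_derivative c' c p v)))"
proof -
  have c: "c \<in> charts_at X p" and d: "d \<in> charts_at Y (f p)"
    using f by (auto simp: has_chart_derivative_def)
  show ?thesis
    using has_chart_derivative_compose[OF X Y
        has_chart_derivative_compose[OF X X has_chart_derivative_transition[OF X c' c] f]
        has_chart_derivative_transition[OF Y d d']] .
qed

lemma mfd_differentiableD:
  assumes "differentiable_atlas X" and "differentiable_atlas Y" and "mfd_differentiable X Y f p"
    and "c \<in> charts_at X p" and "d \<in> charts_at Y (f p)"
  obtains f' where "has_chart_derivative X Y f p c d f'"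
proof -
  obtain c' d' f' where "has_chart_derivative X Y f p c' d' f'"
    using assms(3) unfolding mfd_differentiable_def by blast
  from has_chart_derivative_change_charts[OF assms(1,2) this assms(4,5)] show ?thesis
    by (rule that)
qed

lemma mfd_differentiable_pts:
  assumes "differentiable_atlas X" and "differentiable_atlas Y" and "mfd_differentiable X Y f p"
  shows "p \<in> pts X" and "f p \<in> pts Y"
proof -
  obtain c d f' where "has_chart_derivative X Y f p c d f'"
    using assms(3) unfolding mfd_differentiable_def by blast
  then show "p \<in> pts X" and "f p \<in> pts Y"
    using charts_at_pts[OF assms(1)] charts_at_pts[OF assms(2)]
    unfolding has_chart_derivative_def by blast+
qed

lemma has_chart_derivative_cong:
  assumes X: "differentiable_atlas X" and f: "has_chart_derivative X Y f p c d f'"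
    and eq: "\<And>q. q \<in> pts X \<Longrightarrow> f q = g q"
  shows "has_chart_derivative X Y g p c d f'"
proof -
  have c: "c \<in> charts_at X p" using f by (simp add: has_chart_derivative_def)
  have ev: "\<forall>\<^sub>F x in nhds (snd c p). f (chart_inv c x) = g (chart_inv c x)"
    using eventually_in_chart[OF X c] by (rule eventually_mono) (rule eq)
  have "((\<lambda>x. snd d (g (chart_inv c x))) has_derivative f') (at (snd c p))"
    by (rule has_derivative_cong_eventually[of "\<lambda>x. snd d (f (chart_inv c x))"])
      (use ev f in \<open>auto simp: has_chart_derivative_def elim: eventually_mono\<close>)
  moreover have "\<forall>\<^sub>F x in nhds (snd c p). f (chart_inv c x) \<in> fst d"
    using f by (simp add: has_chart_derivative_def)
  then have "\<forall>\<^sub>F x in nhds (snd c p). g (chart_inv c x) \<in> fst d"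
    using ev by eventually_elim simp
  ultimately show ?thesis
    using f eq[OF charts_at_pts[OF X c]] by (simp add: has_chart_derivative_def)
qed

section \<open>Transition derivatives, tangent spaces and differentials\<close>

lemma transition_derivative_linear:
  "differentiable_atlas X \<Longrightarrow> c \<in> charts_at X p \<Longrightarrow> d \<in> charts_at X p \<Longrightarrow> linear (transition_derivative c d p)"
  by (rule has_chart_derivative_linear) (rule has_chart_derivative_transition)

lemma transition_derivative_self:
  assumes X: "differentiable_atlas X" and c: "c \<in> charts_at X p"
  shows "transition_derivative c c p = (\<lambda>v. v)"
proof -
  have "((\<lambda>x. snd c (chart_inv c x)) has_derivative (\<lambda>v. v)) (at (snd c p))"
    by (rule has_derivative_cong_eventually[of "\<lambda>x. x"])
      (use eventually_in_chart_overlap[OF X c c] in \<open>auto elim: eventually_mono\<close>)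
  then show ?thesis
    using frechet_derivative_eqI unfolding o_def by blast
qed

text \<open>The cocycle rule: both sides are chart derivatives of the identity, and these are
  unique.\<close>

lemma transition_derivative_compose:
  assumes X: "differentiable_atlas X" and c: "c \<in> charts_at X p" and d: "d \<in> charts_at X p"
    and e: "e \<in> charts_at X p"
  shows "transition_derivative d e p (transition_derivative c d p v) = transition_derivative c e p v"
  using has_chart_derivative_unique[OF has_chart_derivative_compose[OF X X
        has_chart_derivative_transition[OF X c d] has_chart_derivative_transition[OF X d e]]
      has_chart_derivative_transition[OF X c e]]
  by (rule fun_cong)

lemma tangent_space_transition:
  "v \<in> tangent_space X p \<Longrightarrow> c \<in> charts_at X p \<Longrightarrow> d \<in> charts_at X p \<Longrightarrow> v d = transition_derivative c d p (v c)"
  unfolding tangent_space_def by blast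

lemma tangent_space_outside: "v \<in> tangent_space X p \<Longrightarrow> c \<notin> charts_at X p \<Longrightarrow> v c = 0"
  unfolding tangent_space_def by blast

lemma tangent_of_components_in_tangent_space:
  assumes X: "differentiable_atlas X" and c: "c \<in> charts_at X p"
  shows "tangent_of_components X c p u \<in> tangent_space X p"
  using transition_derivative_compose[OF X c]
  by (simp add: tangent_space_def tangent_of_components_def)

lemma tangent_of_components_self:
  assumes "differentiable_atlas X" and "c \<in> charts_at X p"
  shows "tangent_of_components X c p u c = u"
  using transition_derivative_self[OF assms] assms by (simp add: tangent_of_components_def)

lemma tangent_of_components_eq:
  assumes "v \<in> tangent_space X p" and "c \<in> charts_at X p"
  shows "tangent_of_components X c p (v c) = v"
proof
  fix d
  show "tangent_of_components X c p (v c) d = v d"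
  proof (cases "d \<in> charts_at X p")
    case True
    then show ?thesis
      using tangent_space_transition[OF assms True] by (simp add: tangent_of_components_def)
  qed (use tangent_space_outside[OF assms(1)] in \<open>simp add: tangent_of_components_def\<close>)
qed

lemma tangent_space_eqI:
  assumes "v \<in> tangent_space X p" and "w \<in> tangent_space X p" and "c \<in> charts_at X p" and "v c = w c"
  shows "v = w"
  by (rule trans[OF tangent_of_components_eq[OF assms(1,3), symmetric]],
      unfold assms(4), rule tangent_of_components_eq[OF assms(2,3)])

lemma scale_tvec_in_tangent_space:
  assumes X: "differentiable_atlas X" and v: "v \<in> tangent_space X p"
  shows "scale_tvec r v \<in> tangent_space X p"
  unfolding tangent_space_def
proof (intro CollectI conjI ballI allI impI)
  fix c d assume "c \<in> charts_at X p" "d \<in> charts_at X p"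
  then show "scale_tvec r v d = transition_derivative c d p (scale_tvec r v c)"
    using linear_scale[OF transition_derivative_linear[OF X], of c p d r "v c"]
      tangent_space_transition[OF v, of c d] by (simp add: scale_tvec_def)
qed (use tangent_space_outside[OF v] in \<open>simp add: scale_tvec_def\<close>)

text \<open>\<open>differential\<close> refers to the arbitrarily chosen
  \<open>chart_at X p\<close>. Any other chart computes it as well, because the components of
  \<open>v\<close> transform by the transition derivatives.\<close>

lemma differential_eq:
  assumes X: "differentiable_atlas X" and Y: "differentiable_atlas Y"
    and f: "has_chart_derivative X Y f p c d f'" and v: "v \<in> tangent_space X p"
  shows "differential X Y f p v = tangent_of_components Y d (f p) (f' (v c))"
proof
  fix e
  have c: "c \<in> charts_at X p" and d: "d \<in> charts_at Y (f p)"
    using f by (auto simp: has_chart_derivative_def)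
  define c0 where "c0 = chart_at X p"
  have c0: "c0 \<in> charts_at X p"
    using chart_at_in_charts_at[OF X charts_at_pts[OF X c]] by (simp add: c0_def)
  show "differential X Y f p v e = tangent_of_components Y d (f p) (f' (v c)) e"
  proof (cases "e \<in> charts_at Y (f p)")
    case True
    have "((snd e \<circ> f \<circ> chart_inv c0) has_derivative
        (\<lambda>v. transition_derivative d e (f p) (f' (transition_derivative c0 c p v)))) (at (snd c0 p))"
      using has_chart_derivative_change_charts[OF X Y f c0 True]
      by (simp add: has_chart_derivative_def o_def)
    then show ?thesis
      using True tangent_space_transition[OF v c0 c]
      by (simp add: differential_def Let_def c0_def tangent_of_components_def frechet_derivative_eqI)
  qed (simp add: differential_def tangent_of_components_def)
qed

lemma differential_component:
  assumes X: "differentiable_atlas X" and Y: "differentiable_atlas Y"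
    and f: "has_chart_derivative X Y f p c d f'" and v: "v \<in> tangent_space X p"
  shows "differential X Y f p v d = f' (v c)"
  using differential_eq[OF assms] tangent_of_components_self[OF Y] f
  by (simp add: has_chart_derivative_def)

lemma differential_in_tangent_space:
  assumes X: "differentiable_atlas X" and Y: "differentiable_atlas Y"
    and f: "mfd_differentiable X Y f p" and v: "v \<in> tangent_space X p"
  shows "differential X Y f p v \<in> tangent_space Y (f p)"
proof -
  obtain c d f' where *: "has_chart_derivative X Y f p c d f'"
    using f unfolding mfd_differentiable_def by blast
  then have "d \<in> charts_at Y (f p)" by (simp add: has_chart_derivative_def)
  then show ?thesis
    using differential_eq[OF X Y * v] tangent_of_components_in_tangent_space[OF Y] by simp
qed

lemma differential_compose:
  assumes X: "differentiable_atlas X" and Y: "differentiable_atlas Y" and Z: "differentiable_atlas Z"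
    and f: "mfd_differentiable X Y f p" and g: "mfd_differentiable Y Z g (f p)" and v: "v \<in> tangent_space X p"
  shows "differential Y Z g (f p) (differential X Y f p v) = differential X Z (\<lambda>q. g (f q)) p v"
proof -
  obtain d e g' where g': "has_chart_derivative Y Z g (f p) d e g'"
    using g unfolding mfd_differentiable_def by blast
  then have d: "d \<in> charts_at Y (f p)" by (simp add: has_chart_derivative_def)
  obtain c where c: "c \<in> charts_at X p"
    using f unfolding mfd_differentiable_def has_chart_derivative_def by blast
  from f c d obtain f' where f': "has_chart_derivative X Y f p c d f'"
    by (rule mfd_differentiableD[OF X Y])
  show ?thesis
    using differential_eq[OF Y Z g' differential_in_tangent_space[OF X Y f v]]
      differential_eq[OF X Z has_chart_derivative_compose[OF X Y f' g'] v]
      differential_component[OF X Y f' v] by simp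
qed

lemma differential_cong:
  assumes X: "differentiable_atlas X" and Y: "differentiable_atlas Y"
    and f: "mfd_differentiable X Y f p" and v: "v \<in> tangent_space X p"
    and eq: "\<And>q. q \<in> pts X \<Longrightarrow> f q = g q"
  shows "differential X Y f p v = differential X Y g p v"
proof -
  obtain c d f' where *: "has_chart_derivative X Y f p c d f'"
    using f unfolding mfd_differentiable_def by blast
  have "p \<in> pts X" using mfd_differentiable_pts[OF X Y f] by simp
  then show ?thesis
    using differential_eq[OF X Y * v] differential_eq[OF X Y has_chart_derivative_cong[OF X * eq] v] eq
    by simp
qed

text \<open>The target enters through one open chart domain, because the tangent bundle and the
  hypersurface serve as targets, and for these only a differentiable atlas is established.
  Continuity of \<open>f\<close> makes the set in the smoothness condition open, which turns that
  condition into twice differentiability.\<close>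

lemma smooth_map_has_chart_derivative:
  assumes X: "smooth_manifold X" and d: "d \<in> charts_at Y (f p)" and od: "openin (mtop Y) (fst d)"
    and f: "smooth_map X Y f" and c: "c \<in> charts_at X p"
  shows "has_chart_derivative X Y f p c d (frechet_derivative (\<lambda>x. snd d (f (chart_inv c x))) (at (snd c p)))"
    and "twice_differentiable_on (\<lambda>x. snd d (f (chart_inv c x))) (snd c ` (fst c \<inter> f -` fst d))"
proof -
  have cc: "c \<in> charts X" "p \<in> fst c" and dd: "d \<in> charts Y" "f p \<in> fst d"
    using c d by (auto simp: charts_at_def)
  have "openin (mtop X) {x \<in> pts X. f x \<in> fst d}"
    using f od openin_continuous_map_preimage unfolding smooth_map_def by blast
  then have "open (snd c ` (fst c \<inter> {x \<in> pts X. f x \<in> fst d}))"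
    by (rule chart_image_open[OF X cc(1)])
  moreover have "fst c \<inter> {x \<in> pts X. f x \<in> fst d} = fst c \<inter> f -` fst d"
    using smooth_manifold_charts(4)[OF X cc(1)] by auto
  ultimately have o: "open (snd c ` (fst c \<inter> f -` fst d))" by simp
  have "smooth_on (snd d \<circ> f \<circ> chart_inv c) (snd c ` (fst c \<inter> f -` fst d))"
    using f cc dd unfolding smooth_map_def by blast
  then show t: "twice_differentiable_on (\<lambda>x. snd d (f (chart_inv c x))) (snd c ` (fst c \<inter> f -` fst d))"
    using smooth_on_imp_twice_differentiable_on[OF _ o] by (simp add: o_def)
  have mem: "snd c p \<in> snd c ` (fst c \<inter> f -` fst d)" using cc dd by auto
  have "\<forall>\<^sub>F x in nhds (snd c p). x \<in> snd c ` (fst c \<inter> f -` fst d)"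
    using o mem by (rule eventually_nhds_in_open)
  then have "\<forall>\<^sub>F x in nhds (snd c p). f (chart_inv c x) \<in> fst d"
    by (rule eventually_mono) (use smooth_manifold_charts(2)[OF X cc(1)] in auto)
  then show "has_chart_derivative X Y f p c d (frechet_derivative (\<lambda>x. snd d (f (chart_inv c x))) (at (snd c p)))"
    using c d twice_differentiable_onD(3)[OF t mem] by (simp add: has_chart_derivative_def)
qed

lemma smooth_map_mfd_differentiable:
  assumes X: "smooth_manifold X" and Y: "differentiable_atlas Y"
    and oY: "\<And>d. d \<in> charts Y \<Longrightarrow> openin (mtop Y) (fst d)"
    and f: "smooth_map X Y f" and p: "p \<in> pts X"
  shows "mfd_differentiable X Y f p"
proof -
  have "f p \<in> pts Y" using f p unfolding smooth_map_def continuous_map_def by blast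
  then obtain d where d: "d \<in> charts_at Y (f p)" using charts_at_nonempty[OF Y] by blast
  obtain c where c: "c \<in> charts_at X p"
    using charts_at_nonempty[OF smooth_manifold_imp_differentiable_atlas[OF X] p] by blast
  have "d \<in> charts Y" using d by (simp add: charts_at_def)
  from mfd_differentiableI[OF smooth_map_has_chart_derivative(1)[OF X d oY[OF this] f c]]
  show ?thesis .
qed

section \<open>The tangent bundle and the normal flow\<close>

abbreviation tangent_vectors :: "('a, 'e::euclidean_space) manifold \<Rightarrow> ('a \<times> ('a, 'e) tvec) set" where
  "tangent_vectors X \<equiv> {(p, v). p \<in> pts X \<and> v \<in> tangent_space X p}"

lemma tangent_chart_inj:
  assumes X: "differentiable_atlas X" and c: "c \<in> charts X"
  shows "inj_on (snd (tangent_chart X c)) (fst (tangent_chart X c))"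
proof (rule inj_onI)
  fix z w assume z: "z \<in> fst (tangent_chart X c)" and w: "w \<in> fst (tangent_chart X c)"
    and eq: "snd (tangent_chart X c) z = snd (tangent_chart X c) w"
  obtain p v q u where zw: "z = (p, v)" "w = (q, u)" by (cases z, cases w)
  have "p = q"
    using z w eq c X by (auto simp: zw tangent_chart_def differentiable_atlas_def dest: inj_onD)
  moreover have "v = u"
    using tangent_space_eqI[of v X p u c] z w eq c \<open>p = q\<close>
    by (simp add: zw tangent_chart_def charts_at_def)
  ultimately show "z = w" by (simp add: zw)
qed

lemma tangent_chart_inv:
  assumes X: "differentiable_atlas X" and c: "c \<in> charts X" and p: "p \<in> fst c"
  shows "chart_inv (tangent_chart X c) (snd c p, u) = (p, tangent_of_components X c p u)"
    and "(p, tangent_of_components X c p u) \<in> fst (tangent_chart X c)"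
    and "snd (tangent_chart X c) (p, tangent_of_components X c p u) = (snd c p, u)"
proof -
  have cp: "c \<in> charts_at X p" using c p by (simp add: charts_at_def)
  show 1: "(p, tangent_of_components X c p u) \<in> fst (tangent_chart X c)"
    using p tangent_of_components_in_tangent_space[OF X cp] by (simp add: tangent_chart_def)
  show 2: "snd (tangent_chart X c) (p, tangent_of_components X c p u) = (snd c p, u)"
    using tangent_of_components_self[OF X cp] by (simp add: tangent_chart_def)
  show "chart_inv (tangent_chart X c) (snd c p, u) = (p, tangent_of_components X c p u)"
    using inv_into_f_eq[OF tangent_chart_inj[OF X c] 1 2] .
qed

lemma tangent_chart_image:
  assumes X: "differentiable_atlas X" and c: "c \<in> charts X"
  shows "snd (tangent_chart X c) ` (fst (tangent_chart X c) \<inter> {(p, v). p \<in> A}) = snd c ` (fst c \<inter> A) \<times> UNIV"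
proof (intro equalityI subsetI)
  fix z assume "z \<in> snd c ` (fst c \<inter> A) \<times> (UNIV :: 'b set)"
  then obtain p u where p: "p \<in> fst c" "p \<in> A" and z: "z = (snd c p, u)" by auto
  show "z \<in> snd (tangent_chart X c) ` (fst (tangent_chart X c) \<inter> {(p, v). p \<in> A})"
    using tangent_chart_inv(2,3)[OF X c p(1), of u] p(2) z by (intro image_eqI) auto
qed (auto simp: tangent_chart_def)

lemma tangent_chart_domain_Int:
  "fst (tangent_chart X c) \<inter> fst (tangent_chart X d) = fst (tangent_chart X c) \<inter> {(p, v). p \<in> fst d}"
  by (auto simp: tangent_chart_def)

text \<open>The definition passes a predicate to \<open>topology\<close>, which has the intended
  open sets only once \<open>istopology\<close> is verified. Closure under intersections rests on
  the injectivity of the tangent charts.\<close>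

lemma openin_tangent_bundle:
  assumes X: "differentiable_atlas X"
  shows "openin (mtop (tangent_bundle X)) W \<longleftrightarrow> W \<subseteq> tangent_vectors X \<and>
    (\<forall>c\<in>charts X. open (snd (tangent_chart X c) ` (W \<inter> fst (tangent_chart X c))))"
proof -
  let ?O = "\<lambda>W. W \<subseteq> tangent_vectors X \<and>
    (\<forall>c\<in>charts X. open (snd (tangent_chart X c) ` (W \<inter> fst (tangent_chart X c))))"
  have "istopology ?O"
    unfolding istopology_def
  proof (intro conjI allI impI)
    fix A B assume A: "?O A" and B: "?O B"
    have "open (snd (tangent_chart X c) ` (A \<inter> B \<inter> fst (tangent_chart X c)))" if c: "c \<in> charts X" for c
    proof -
      have "snd (tangent_chart X c) ` (A \<inter> B \<inter> fst (tangent_chart X c)) =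
          snd (tangent_chart X c) ` (A \<inter> fst (tangent_chart X c)) \<inter>
          snd (tangent_chart X c) ` (B \<inter> fst (tangent_chart X c))"
        using inj_on_image_Int[OF tangent_chart_inj[OF X c], of "A \<inter> fst (tangent_chart X c)"
            "B \<inter> fst (tangent_chart X c)"] by (simp add: Int_ac)
      then show ?thesis using A B c by (simp add: open_Int)
    qed
    then show "A \<inter> B \<subseteq> tangent_vectors X"
      and "\<forall>c\<in>charts X. open (snd (tangent_chart X c) ` (A \<inter> B \<inter> fst (tangent_chart X c)))"
      using A by blast+
  next
    fix K assume K: "\<forall>A\<in>K. ?O A"
    show "\<Union>K \<subseteq> tangent_vectors X" using K by blast
    have "snd (tangent_chart X c) ` (\<Union>K \<inter> fst (tangent_chart X c)) =
        (\<Union>A\<in>K. snd (tangent_chart X c) ` (A \<inter> fst (tangent_chart X c)))" for c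
      by blast
    then show "\<forall>c\<in>charts X. open (snd (tangent_chart X c) ` (\<Union>K \<inter> fst (tangent_chart X c)))"
      using K by auto
  qed
  then show ?thesis
    by (simp add: tangent_bundle_def topology_inverse')
qed

lemma openin_tangent_chart:
  assumes X: "differentiable_atlas X" and d: "d \<in> charts X"
  shows "openin (mtop (tangent_bundle X)) (fst (tangent_chart X d))"
proof -
  have "open (snd (tangent_chart X c) ` (fst (tangent_chart X d) \<inter> fst (tangent_chart X c)))"
    if c: "c \<in> charts X" for c
  proof -
    have "open (snd c ` (fst c \<inter> fst d))" using X c d unfolding differentiable_atlas_def by blast
    then show ?thesis
      by (subst Int_commute, subst tangent_chart_domain_Int, subst tangent_chart_image[OF X c])
        (simp add: open_Times)
  qed
  moreover have "fst (tangent_chart X d) \<subseteq> tangent_vectors X"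
    using X d by (auto simp: tangent_chart_def differentiable_atlas_def)
  ultimately show ?thesis
    by (simp add: openin_tangent_bundle[OF X])
qed

lemma pts_tangent_bundle:
  assumes X: "differentiable_atlas X"
  shows "pts (tangent_bundle X) = tangent_vectors X"
proof
  show "pts (tangent_bundle X) \<subseteq> tangent_vectors X"
    using openin_tangent_bundle[OF X] openin_topspace by blast
  show "tangent_vectors X \<subseteq> pts (tangent_bundle X)"
  proof clarify
    fix p v assume pv: "p \<in> pts X" "v \<in> tangent_space X p"
    obtain c where "c \<in> charts X" "p \<in> fst c"
      using charts_at_nonempty[OF X pv(1)] by (auto simp: charts_at_def)
    then show "(p, v) \<in> pts (tangent_bundle X)"
      using openin_subset[OF openin_tangent_chart[OF X]] pv(2) by (fastforce simp: tangent_chart_def)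
  qed
qed

text \<open>A transition of the tangent bundle sends (y, v) to (h y, dh(y) v) for a transition
  \<open>h\<close> of \<open>X\<close>. It is differentiable because \<open>h\<close> is twice
  differentiable and the second entry is a linear family.\<close>

lemma tangent_bundle_differentiable_atlas:
  assumes M: "smooth_manifold X"
  shows "differentiable_atlas (tangent_bundle X)"
proof -
  note X = smooth_manifold_imp_differentiable_atlas[OF M]
  have ch: "charts (tangent_bundle X) = tangent_chart X ` charts X" by (simp add: tangent_bundle_def)
  have img: "open (snd (tangent_chart X c) ` fst (tangent_chart X c))" if c: "c \<in> charts X" for c
    using tangent_chart_image[OF X c, of UNIV] smooth_manifold_charts(3)[OF M c]
    by (simp add: open_Times)
  have ov: "open (snd (tangent_chart X c) ` (fst (tangent_chart X c) \<inter> fst (tangent_chart X d)))"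
    if c: "c \<in> charts X" and d: "d \<in> charts X" for c d
  proof -
    have "open (snd c ` (fst c \<inter> fst d))" using X c d unfolding differentiable_atlas_def by blast
    then show ?thesis
      unfolding tangent_chart_domain_Int tangent_chart_image[OF X c] by (simp add: open_Times)
  qed
  have cover: "(\<Union>c\<in>charts X. fst (tangent_chart X c)) = tangent_vectors X"
    using X by (auto simp: tangent_chart_def differentiable_atlas_def)
  have tr: "(snd (tangent_chart X d) \<circ> chart_inv (tangent_chart X c)) differentiable
      (at (snd (tangent_chart X c) z))"
    if c: "c \<in> charts X" and d: "d \<in> charts X"
      and z: "z \<in> fst (tangent_chart X c) \<inter> fst (tangent_chart X d)" for c d z
  proof -
    define h where "h = snd d \<circ> chart_inv c"
    define A where "A = snd c ` (fst c \<inter> fst d)"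
    obtain p v where zp: "z = (p, v)" "p \<in> fst c" "p \<in> fst d" using z by (auto simp: tangent_chart_def)
    have A: "open A" using X c d unfolding differentiable_atlas_def A_def by blast
    have "smooth_on h A" using M c d unfolding smooth_manifold_def h_def A_def by blast
    then have h: "twice_differentiable_on h A" using A by (rule smooth_on_imp_twice_differentiable_on)
    have x: "snd c p \<in> A" using zp by (auto simp: A_def)
    have eq: "(snd (tangent_chart X d) \<circ> chart_inv (tangent_chart X c)) y = (h (fst y), frechet_derivative h (at (fst y)) (snd y))"
      if y: "y \<in> A \<times> UNIV" for y
    proof -
      obtain q u where q: "y = (snd c q, u)" "q \<in> fst c" "q \<in> fst d" using y by (auto simp: A_def)
      then have "d \<in> charts_at X q" using d by (simp add: charts_at_def)
      then show ?thesis
        using tangent_chart_inv(1)[OF X c q(2), of u] chart_inv_chart[OF X c q(2)]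
        by (simp add: q(1) h_def tangent_chart_def tangent_of_components_def)
    qed
    have "\<forall>\<^sub>F y in nhds (snd c p, v c). y \<in> A \<times> UNIV"
      using A x by (intro eventually_nhds_in_open) (auto simp: open_Times)
    then have ev: "\<forall>\<^sub>F y in nhds (snd c p, v c). (h (fst y), frechet_derivative h (at (fst y)) (snd y)) =
        (snd (tangent_chart X d) \<circ> chart_inv (tangent_chart X c)) y"
      by (rule eventually_mono) (simp add: eq del: o_apply)
    have fst': "(fst has_derivative fst) (at (snd c p, v c))"
      by (simp add: bounded_linear_imp_has_derivative bounded_linear_fst)
    have snd': "(snd has_derivative snd) (at (snd c p, v c))"
      by (simp add: bounded_linear_imp_has_derivative bounded_linear_snd)
    have 1: "((\<lambda>y. h (fst y)) has_derivative (\<lambda>k. frechet_derivative h (at (snd c p)) (fst k))) (at (snd c p, v c))"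
      using has_derivative_compose[OF fst', of h] twice_differentiable_onD(3)[OF h x] by simp
    have lin: "\<forall>\<^sub>F y in nhds (snd c p, v c). linear (frechet_derivative h (at (fst y)))"
      using \<open>\<forall>\<^sub>F y in nhds (snd c p, v c). y \<in> A \<times> UNIV\<close> 
      by (rule eventually_mono) (use twice_differentiable_onD(4)[OF h] in auto)
    have dd: "(\<lambda>y. frechet_derivative h (at (fst y)) l) differentiable (at (snd c p, v c))" for l
    proof -
      have "((\<lambda>y. frechet_derivative h (at y) l) has_derivative
          frechet_derivative (\<lambda>y. frechet_derivative h (at y) l) (at (snd c p))) (at (snd c p))"
        using twice_differentiable_onD(2)[OF h x] frechet_derivative_works by blast
      then show ?thesis
        using has_derivative_compose[OF fst', of "\<lambda>y. frechet_derivative h (at y) l"]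
        unfolding differentiable_def fst_conv by blast
    qed
    have "(\<lambda>y. (h (fst y), frechet_derivative h (at (fst y)) (snd y))) differentiable (at (snd c p, v c))"
      using has_derivative_Pair[OF 1 has_derivative_linear_family[OF lin dd snd']]
      unfolding differentiable_def by blast
    note this' = differentiable_cong_eventually[OF ev this]
    have "snd (tangent_chart X c) z = (snd c p, v c)" by (simp add: zp tangent_chart_def)
    then show ?thesis using this' by (simp only:)
  qed
  show ?thesis
    unfolding differentiable_atlas_def ch pts_tangent_bundle[OF X]
    using tangent_chart_inj[OF X] img ov cover tr by (simp add: ball_simps)
qed

text \<open>Injectivity is given on abstract tangent vectors; comparing components turns it into
  injectivity of the coordinate derivative, the premise of
  \<open>immersion_reflects_twice_differentiable\<close>.\<close>

lemma immersed_submfd_derivative_inj: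
  assumes X: "immersed_submfd X M" and M: "differentiable_atlas M"
    and h: "has_chart_derivative X M (\<lambda>q. q) p c d h'"
  shows "inj h'"
proof -
  have Xa: "differentiable_atlas X"
    using X smooth_manifold_imp_differentiable_atlas unfolding immersed_submfd_def by blast
  have c: "c \<in> charts_at X p" using h by (simp add: has_chart_derivative_def)
  have p: "p \<in> pts X" using charts_at_pts[OF Xa c] .
  have lin: "linear h'" using h by (rule has_chart_derivative_linear)
  have "a = 0" if a: "h' a = 0" for a
  proof -
    have toc: "tangent_of_components X c p u \<in> tangent_space X p" for u
      by (rule tangent_of_components_in_tangent_space[OF Xa c])
    have "differential X M (\<lambda>q. q) p (tangent_of_components X c p a) =
        differential X M (\<lambda>q. q) p (tangent_of_components X c p 0)"
      using differential_eq[OF Xa M h toc] tangent_of_components_self[OF Xa c] a linear_0[OF lin] by simp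
    then have "tangent_of_components X c p a = tangent_of_components X c p 0"
      using X p toc unfolding immersed_submfd_def inj_on_def by blast
    then show ?thesis
      using tangent_of_components_self[OF Xa c] by metis
  qed
  then show ?thesis using lin by (simp add: linear_injective_0)
qed

lemma chart_preimage_open:
  assumes X: "smooth_manifold X" and c: "c \<in> charts X" and B: "open B"
  shows "openin (mtop X) (fst c \<inter> snd c -` B)"
proof -
  have "continuous_map (subtopology (mtop X) (fst c)) (top_of_set (snd c ` fst c)) (snd c)"
    using X c homeomorphic_imp_continuous_map unfolding smooth_manifold_def by blast
  then have cont: "continuous_map (subtopology (mtop X) (fst c)) euclidean (snd c)"
    using continuous_map_in_subtopology by blast
  have "openin euclidean B" using B by simp
  with cont have "openin (subtopology (mtop X) (fst c)) {x \<in> topspace (subtopology (mtop X) (fst c)). snd c x \<in> B}"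
    by (rule openin_continuous_map_preimage)
  moreover have "{x \<in> topspace (subtopology (mtop X) (fst c)). snd c x \<in> B} = fst c \<inter> snd c -` B"
    using smooth_manifold_charts(4)[OF X c] by auto
  ultimately show ?thesis
    using openin_trans_full smooth_manifold_charts(1)[OF X c] by metis
qed

lemma metric_eq_components:
  assumes "v \<in> tangent_space M p" and "w \<in> tangent_space M p" and "c \<in> charts_at M p"
  shows "g p v w = metric_components M g c p (v c) (w c)"
  using tangent_of_components_eq[OF assms(1,3)] tangent_of_components_eq[OF assms(2,3)]
  by (simp add: metric_components_def)

section \<open>The data of the normal exponential construction\<close>

text \<open>Umbilicity and the condition on the conformal factor stay premises of individual lemmas,
  which keeps visible where they enter.\<close>

locale normal_exponential =
  fixes M :: "('a, 'e::euclidean_space) manifold"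
    and g :: "('a, 'e) metric"
    and T :: "'a \<Rightarrow> ('a, 'e) tvec"
    and \<Gamma> :: "('a, 'e) connection"
    and S :: "('a, 's::euclidean_space) manifold"
    and \<xi> :: "'a \<Rightarrow> ('a, 'e) tvec"
    and N :: "('a \<times> ('a, 'e) tvec, 'e) manifold"
    and V :: "('a \<times> ('a, 'e) tvec) set"
  assumes spacetime: "spacetime M g T"
    and levi_civita: "levi_civita M g \<Gamma>"
    and embedded: "embedded_submfd S M" and connected: "connected_space (mtop S)"
    and lightlike: "lightlike_normal_field M g S \<xi>"
    and normal_bundle: "normal_bundle M g S N" and domain: "normal_exp_domain M \<Gamma> S N V"
begin

abbreviation \<O> :: "('a \<times> real) set" where "\<O> \<equiv> flow_domain S \<xi> V"

abbreviation \<Phi> :: "'a \<times> real \<Rightarrow> 'a" where "\<Phi> \<equiv> normal_flow M \<Gamma> \<xi>"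

lemma M_manifold: "smooth_manifold M"
  using spacetime by (simp add: spacetime_def)

lemma S_manifold: "smooth_manifold S"
  using embedded by (simp add: embedded_submfd_def immersed_submfd_def)

lemma N_manifold: "smooth_manifold N"
  using normal_bundle by (simp add: normal_bundle_def embedded_submfd_def immersed_submfd_def)

lemmas M_atlas = smooth_manifold_imp_differentiable_atlas[OF M_manifold]
  and S_atlas = smooth_manifold_imp_differentiable_atlas[OF S_manifold]
  and N_atlas = smooth_manifold_imp_differentiable_atlas[OF N_manifold]
  and TM_atlas = tangent_bundle_differentiable_atlas[OF M_manifold]

lemma S_subset: "pts S \<subseteq> pts M"
  using embedded by (simp add: embedded_submfd_def immersed_submfd_def)

lemma xi_tangent: "p \<in> pts S \<Longrightarrow> \<xi> p \<in> tangent_space M p"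
  using lightlike by (simp add: lightlike_normal_field_def normal_vectors_def)

lemma inclusion_differentiable:
  assumes p: "p \<in> pts S"
  shows "mfd_differentiable S M (\<lambda>q. q) p"
proof (rule smooth_map_mfd_differentiable[OF S_manifold M_atlas])
  show "smooth_map S M (\<lambda>q. q)" using embedded by (simp add: embedded_submfd_def immersed_submfd_def)
qed (use p smooth_manifold_charts(1)[OF M_manifold] in auto)

lemma bilinear_metric: "c \<in> charts_at M p \<Longrightarrow> bilinear (metric_components M g c p)"
  using spacetime unfolding spacetime_def lorentzian_metric_def charts_at_def Let_def by blast

text \<open>This keeps the rays t \<xi>_p inside the total space of \<open>N\<close>, so that sets
  open in \<open>N\<close> can be tested on them.\<close>

lemma scale_normal:
  assumes p: "p \<in> pts S"
  shows "(p, scale_tvec t (\<xi> p)) \<in> normal_vectors M g S"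
proof -
  obtain c where c: "c \<in> charts_at M p" using charts_at_nonempty[OF M_atlas] p S_subset by blast
  have sc: "scale_tvec t (\<xi> p) \<in> tangent_space M p"
    using scale_tvec_in_tangent_space[OF M_atlas xi_tangent[OF p]] .
  have "g p (scale_tvec t (\<xi> p)) (differential S M (\<lambda>q. q) p w) = 0" if w: "w \<in> tangent_space S p" for w
  proof -
    have dw: "differential S M (\<lambda>q. q) p w \<in> tangent_space M p"
      using differential_in_tangent_space[OF S_atlas M_atlas inclusion_differentiable[OF p] w] .
    have "g p (\<xi> p) (differential S M (\<lambda>q. q) p w) = 0"
      using lightlike p w by (simp add: lightlike_normal_field_def normal_vectors_def)
    then show ?thesis
      using metric_eq_components[OF sc dw c, of g] metric_eq_components[OF xi_tangent[OF p] dw c, of g]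
        bilinear_lmul[OF bilinear_metric[OF c]] by (simp add: scale_tvec_def)
  qed
  then show ?thesis using p sc by (simp add: normal_vectors_def)
qed

lemma mem_O_iff: "(p, t) \<in> \<O> \<longleftrightarrow> p \<in> pts S \<and> (p, scale_tvec t (\<xi> p)) \<in> V"
  by (simp add: flow_domain_def)

lemma pts_N: "pts N = normal_vectors M g S"
  using normal_bundle by (simp add: normal_bundle_def)

lemma openin_V: "openin (mtop N) V"
  using domain by (simp add: normal_exp_domain_def)

lemma V_subset: "V \<subseteq> pts N"
  using openin_V by (rule openin_subset)

lemma inj_on_exp: "inj_on (exp_map M \<Gamma>) V"
  using domain V_subset
  by (simp add: normal_exp_domain_def diffeomorphism_def bij_betw_def open_submfd_def Int_absorb1)

text \<open>Injectivity of the exponential map on \<open>V\<close> reduces this to the rays, and a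
  ray determines its parameter because \<open>\<xi> p\<close> has a nonzero component in some
  chart.\<close>

lemma inj_on_flow: "inj_on \<Phi> \<O>"
proof (rule inj_onI, clarify)
  fix p t q s assume a: "(p, t) \<in> \<O>" "(q, s) \<in> \<O>" "\<Phi> (p, t) = \<Phi> (q, s)"
  then have eq: "p = q" "scale_tvec t (\<xi> p) = scale_tvec s (\<xi> p)"
    using inj_on_exp by (auto simp: mem_O_iff normal_flow_def dest: inj_onD)
  have "\<xi> p \<noteq> zero_tvec" using lightlike a(1) by (simp add: lightlike_normal_field_def mem_O_iff)
  then obtain c where "\<xi> p c \<noteq> 0" by (auto simp: zero_tvec_def fun_eq_iff)
  moreover have "t *\<^sub>R \<xi> p c = s *\<^sub>R \<xi> p c"
    using fun_cong[OF eq(2), of c] by (simp only: scale_tvec_def)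
  ultimately show "p = q \<and> t = s" using eq(1) by simp
qed

text \<open>Star-shapedness of the fibres of \<open>V\<close>. With \<open>t\<close>, the domain
  contains the whole segment from 0 to \<open>t\<close>, along which the integral and the metric are
  followed later.\<close>

lemma mem_O_scale:
  assumes t: "(p, t) \<in> \<O>" and r: "0 \<le> r" "r \<le> 1"
  shows "(p, r * t) \<in> \<O>"
proof -
  have "(p, scale_tvec r (scale_tvec t (\<xi> p))) \<in> V"
    using t r domain unfolding mem_O_iff normal_exp_domain_def by (meson atLeastAtMost_iff)
  then show ?thesis using t by (simp add: mem_O_iff scale_tvec_def)
qed

lemma zero_mem_O: "p \<in> pts S \<Longrightarrow> (p, 0) \<in> \<O>"
  using domain by (simp add: mem_O_iff normal_exp_domain_def scale_tvec_def zero_tvec_def)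

lemma flow_in_M: "z \<in> \<O> \<Longrightarrow> \<Phi> z \<in> pts M"
  using domain openin_subset unfolding normal_exp_domain_def
  by (force simp: mem_O_iff normal_flow_def split: prod.splits)

section \<open>Twice differentiability of the normal flow\<close>

text \<open>The two charts belong to different manifolds; the overlap is open because
  \<open>S\<close> carries the subspace topology of \<open>M\<close>.\<close>

lemma overlap_open:
  assumes c: "c \<in> charts S" and d: "d \<in> charts M"
  shows "open (snd c ` (fst c \<inter> fst d))"
proof -
  have "openin (mtop S) (fst d \<inter> pts S)"
  proof -
    have "subtopology (mtop M) (pts S) = mtop S" using embedded unfolding embedded_submfd_def by simp
    with openin_subtopology_Int[OF smooth_manifold_charts(1)[OF M_manifold d], of "pts S"]
    show ?thesis by (simp only:)
  qed
  from chart_image_open[OF S_manifold c this] show ?thesis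
    using smooth_manifold_charts(4)[OF S_manifold c] by (simp add: Int_absorb2 Int_left_commute Int_commute inf.absorb_iff2 inf_assoc)
qed

text \<open>The coordinate expression of (p, s) -> s \<xi>_p as a map from S x R to the tangent
  bundle of \<open>M\<close>.\<close>

definition scaled_chart :: "('a, 's) chart \<Rightarrow> ('a, 'e) chart \<Rightarrow> 's \<times> real \<Rightarrow> 'e \<times> 'e" where
  "scaled_chart c d = (\<lambda>(y, s). (snd d (chart_inv c y), s *\<^sub>R \<xi> (chart_inv c y) d))"

lemma scaled_chart_eq:
  "scaled_chart c d (y, s) = snd (tangent_chart M d) (chart_inv c y, scale_tvec s (\<xi> (chart_inv c y)))"
  by (simp add: scaled_chart_def tangent_chart_def scale_tvec_def)

lemma scaled_chart_twice_differentiable: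
  assumes c: "c \<in> charts_at S p" and d: "d \<in> charts_at M p"
  shows "twice_differentiable_on (scaled_chart c d) (snd c ` (fst c \<inter> fst d) \<times> UNIV)"
proof -
  have cc: "c \<in> charts S" "p \<in> fst c" and dd: "d \<in> charts M" "p \<in> fst d"
    using c d by (auto simp: charts_at_def)
  let ?A = "snd c ` (fst c \<inter> fst d)"
  have A: "open ?A" using overlap_open[OF cc(1) dd(1)] .
  have cS: "q \<in> pts S" if "q \<in> fst c" for q using that smooth_manifold_charts(4)[OF S_manifold cc(1)] by auto
  have "tangent_chart M d \<in> charts_at (tangent_bundle M) (p, \<xi> p)"
    using dd xi_tangent[OF cS[OF cc(2)]] by (auto simp: charts_at_def tangent_bundle_def tangent_chart_def)
  moreover have "smooth_map S (tangent_bundle M) (\<lambda>p. (p, \<xi> p))"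
    using lightlike by (simp add: lightlike_normal_field_def smooth_field_along_def)
  ultimately have "twice_differentiable_on (\<lambda>x. snd (tangent_chart M d) (chart_inv c x, \<xi> (chart_inv c x)))
      (snd c ` (fst c \<inter> (\<lambda>p. (p, \<xi> p)) -` fst (tangent_chart M d)))"
    by (rule smooth_map_has_chart_derivative(2)[OF S_manifold _ openin_tangent_chart[OF M_atlas dd(1)] _ c])
  moreover have "fst c \<inter> (\<lambda>p. (p, \<xi> p)) -` fst (tangent_chart M d) = fst c \<inter> fst d"
    using cS xi_tangent by (auto simp: tangent_chart_def)
  ultimately have a: "twice_differentiable_on (\<lambda>x. (snd d (chart_inv c x), \<xi> (chart_inv c x) d)) ?A"
    by (simp add: tangent_chart_def)
  have f: "twice_differentiable_on (fst :: 's \<times> real \<Rightarrow> 's) (?A \<times> UNIV)"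
    and s: "twice_differentiable_on (snd :: 's \<times> real \<Rightarrow> real) (?A \<times> UNIV)"
    using A by (auto intro!: twice_differentiable_on_subset[OF twice_differentiable_on_linear] open_Times
      simp: linear_fst linear_snd)
  have af: "twice_differentiable_on (\<lambda>z. (snd d (chart_inv c (fst z)), \<xi> (chart_inv c (fst z)) d)) (?A \<times> (UNIV::real set))"
    using twice_differentiable_on_compose[OF a f] by auto
  have 1: "twice_differentiable_on (\<lambda>z. snd d (chart_inv c (fst z))) (?A \<times> (UNIV::real set))"
    using twice_differentiable_on_compose[OF twice_differentiable_on_linear[OF linear_fst] af] by simp
  have 2: "twice_differentiable_on (\<lambda>z. \<xi> (chart_inv c (fst z)) d) (?A \<times> (UNIV::real set))"
    using twice_differentiable_on_compose[OF twice_differentiable_on_linear[OF linear_snd] af] by simp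
  show ?thesis
    using twice_differentiable_on_Pair[OF 1 twice_differentiable_on_scaleR[OF 2 s]]
    by (simp add: scaled_chart_def case_prod_beta')
qed

text \<open>Continuity of (p, s) -> s \<xi>_p into \<open>N\<close>, in coordinates. By embeddedness
  a set open in \<open>N\<close> is the trace of one open in the tangent bundle, and there the
  continuous expression \<open>scaled_chart\<close> applies.\<close>

lemma scaled_field_continuous:
  assumes W: "openin (mtop N) W" and p: "(p, scale_tvec t (\<xi> p)) \<in> W" and c: "c \<in> charts_at S p"
  obtains B where "open B" "(snd c p, t) \<in> B"
    "\<And>y s. (y, s) \<in> B \<Longrightarrow> y \<in> snd c ` fst c \<and> (chart_inv c y, scale_tvec s (\<xi> (chart_inv c y))) \<in> W"
proof -
  have cc: "c \<in> charts S" "p \<in> fst c" using c by (auto simp: charts_at_def)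
  have cS: "q \<in> pts S" if "q \<in> fst c" for q using that smooth_manifold_charts(4)[OF S_manifold cc(1)] by auto
  obtain d where d: "d \<in> charts_at M p" using charts_at_nonempty[OF M_atlas] cS cc S_subset by blast
  then have dd: "d \<in> charts M" "p \<in> fst d" by (auto simp: charts_at_def)
  have "mtop N = subtopology (mtop (tangent_bundle M)) (pts N)"
    using normal_bundle unfolding normal_bundle_def embedded_submfd_def by blast
  then obtain W' where W': "openin (mtop (tangent_bundle M)) W'" "W = W' \<inter> pts N"
    using W by (metis openin_subtopology)
  let ?A = "snd c ` (fst c \<inter> fst d)" and ?tc = "tangent_chart M d"
  have A: "open ?A" using overlap_open[OF cc(1) dd(1)] .
  let ?I = "snd ?tc ` (W' \<inter> fst ?tc)"
  have I: "open ?I" using W'(1) dd(1) openin_tangent_bundle[OF M_atlas] by blast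
  have cont: "continuous_on (?A \<times> UNIV) (scaled_chart c d)"
    using twice_differentiable_onD(1)[OF scaled_chart_twice_differentiable[OF c d]]
    by (meson continuous_at_imp_continuous_on differentiable_imp_continuous_within)
  define B where "B = (?A \<times> UNIV) \<inter> scaled_chart c d -` ?I"
  have "open B"
    unfolding B_def using A I by (intro continuous_open_preimage[OF cont]) (auto simp: open_Times)
  moreover have inv: "chart_inv c (snd c q) = q" if "q \<in> fst c" for q
    using chart_inv_chart[OF S_atlas cc(1) that] .
  have dom: "(q, scale_tvec s (\<xi> q)) \<in> fst ?tc" if "q \<in> fst c" "q \<in> fst d" for q s
    using that scale_tvec_in_tangent_space[OF M_atlas xi_tangent[OF cS]] by (auto simp: tangent_chart_def)
  have "(snd c p, t) \<in> B"
    using p cc dd W' dom by (auto simp: B_def scaled_chart_eq inv)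
  moreover have "y \<in> snd c ` fst c \<and> (chart_inv c y, scale_tvec s (\<xi> (chart_inv c y))) \<in> W" if ys: "(y, s) \<in> B" for y s
  proof -
    obtain q where q: "q \<in> fst c" "q \<in> fst d" "y = snd c q" using ys by (auto simp: B_def)
    obtain w where w: "w \<in> W'" "w \<in> fst ?tc" "snd ?tc (q, scale_tvec s (\<xi> q)) = snd ?tc w"
      using ys q inv by (auto simp: B_def scaled_chart_eq)
    then have "(q, scale_tvec s (\<xi> q)) = w"
      using inj_onD[OF tangent_chart_inj[OF M_atlas dd(1)] w(3) dom[OF q(1,2)] w(2)] by simp
    then show ?thesis
      using q w(1) W'(2) scale_normal[OF cS[OF q(1)], of s] by (simp add: inv pts_N)
  qed
  ultimately show ?thesis using that by blast
qed

text \<open>The coordinate expression of the flow factors as \<open>G\<close> after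
  \<open>u\<close>: \<open>u\<close> reads the rays in a chart of \<open>N\<close>, and
  \<open>G\<close> is the exponential map in that chart. Smoothness of \<xi> is known in the tangent
  bundle, so \<open>u\<close> is recovered from the relation that \<open>j\<close> after
  \<open>u\<close> is \<open>scaled_chart\<close>, with \<open>j\<close> the inclusion of
  \<open>N\<close>.\<close>

lemma flow_twice_differentiable:
  assumes pt: "(p, t) \<in> \<O>" and c: "c \<in> charts_at S p" and d: "d \<in> charts_at M (\<Phi> (p, t))"
  obtains B where "(snd c p, t) \<in> B"
    "\<And>y s. (y, s) \<in> B \<Longrightarrow> y \<in> snd c ` fst c \<and> (chart_inv c y, s) \<in> \<O> \<and> \<Phi> (chart_inv c y, s) \<in> fst d"
    "twice_differentiable_on (\<lambda>(y, s). snd d (\<Phi> (chart_inv c y, s))) B"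
proof -
  have cc: "c \<in> charts S" "p \<in> fst c" and dd: "d \<in> charts M" "\<Phi> (p, t) \<in> fst d"
    using c d by (auto simp: charts_at_def)
  have cS: "q \<in> pts S" if "q \<in> fst c" for q using that smooth_manifold_charts(4)[OF S_manifold cc(1)] by auto
  have p: "p \<in> pts S" using pt by (simp add: mem_O_iff)
  define \<zeta> where "\<zeta> = (\<lambda>(q, s). (q, scale_tvec s (\<xi> q)))"
  have \<zeta>V: "\<zeta> (p, t) \<in> V" using pt by (simp add: \<zeta>_def mem_O_iff)
  then have \<zeta>N: "\<zeta> (p, t) \<in> pts N" using V_subset by auto
  obtain n where n: "n \<in> charts_at N (\<zeta> (p, t))" using charts_at_nonempty[OF N_atlas \<zeta>N] by blast
  then have nn: "n \<in> charts N" "\<zeta> (p, t) \<in> fst n" by (auto simp: charts_at_def)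
  obtain e where e: "e \<in> charts_at M p" using charts_at_nonempty[OF M_atlas] p S_subset by blast
  then have ee: "e \<in> charts M" "p \<in> fst e" by (auto simp: charts_at_def)
  let ?te = "tangent_chart M e"
  have te: "?te \<in> charts_at (tangent_bundle M) (\<zeta> (p, t))"
    using ee scale_tvec_in_tangent_space[OF M_atlas xi_tangent[OF p]]
    by (auto simp: charts_at_def tangent_bundle_def tangent_chart_def \<zeta>_def)
  have imm: "immersed_submfd N (tangent_bundle M)"
    using normal_bundle by (simp add: normal_bundle_def embedded_submfd_def)
  then have id: "smooth_map N (tangent_bundle M) (\<lambda>q. q)" by (simp add: immersed_submfd_def)
  define j where "j = (\<lambda>x. snd ?te (chart_inv n x))"
  note j = smooth_map_has_chart_derivative[OF N_manifold te openin_tangent_chart[OF M_atlas ee(1)] id n, folded j_def]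
  have j2: "twice_differentiable_on j (snd n ` (fst n \<inter> fst ?te))" using j(2) by (simp add: vimage_def)
  have nmem: "snd n (\<zeta> (p, t)) \<in> snd n ` (fst n \<inter> fst ?te)"
    using nn(2) te by (auto simp: charts_at_def)
  have jinj: "inj (frechet_derivative j (at (snd n (\<zeta> (p, t)))))"
    using immersed_submfd_derivative_inj[OF imm TM_atlas j(1)] .
  obtain R where R: "open R" "snd n (\<zeta> (p, t)) \<in> R" "R \<subseteq> snd n ` (fst n \<inter> fst ?te)"
    and Rt: "\<And>(u :: 's \<times> real \<Rightarrow> 'e) C. twice_differentiable_on (\<lambda>y. j (u y)) C \<Longrightarrow> u ` C \<subseteq> R \<Longrightarrow>
       twice_differentiable_on u C"
    using immersion_reflects_twice_differentiable[OF j2 nmem jinj, where 'x = "'s \<times> real"] by metis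
  let ?E = "exp_map M \<Gamma>"
  let ?W = "?E ` V"
  have E: "smooth_map (open_submfd N V) (open_submfd M ?W) ?E"
    using domain by (simp add: normal_exp_domain_def diffeomorphism_def)
  have topV: "topspace (subtopology (mtop N) V) = V" using V_subset by (simp add: Int_absorb1)
  have oV: "openin (mtop N) {q \<in> V. ?E q \<in> fst d}"
  proof -
    have "continuous_map (subtopology (mtop N) V) (subtopology (mtop M) ?W) ?E"
      using E by (simp add: smooth_map_def open_submfd_def)
    then have "continuous_map (subtopology (mtop N) V) (mtop M) ?E"
      using continuous_map_in_subtopology by blast
    from openin_continuous_map_preimage[OF this smooth_manifold_charts(1)[OF M_manifold dd(1)]]
    have "openin (subtopology (mtop N) V) {q \<in> V. ?E q \<in> fst d}" unfolding topV .
    then show ?thesis using openin_trans_full[OF _ openin_V] by blast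
  qed
  \<comment> \<open>Inside \<open>W\<close> a vector lies in the chart \<open>n\<close>, its
    coordinates lie in the set \<open>R\<close> where \<open>j\<close> reflects differentiability,
    and the exponential map sends it into the chart \<open>d\<close>.\<close>
  define W where "W = {q \<in> V. ?E q \<in> fst d} \<inter> (fst n \<inter> snd n -` R)"
  have W: "openin (mtop N) W"
    unfolding W_def by (intro openin_Int oV chart_preimage_open[OF N_manifold nn(1) R(1)])
  have ptW: "(p, scale_tvec t (\<xi> p)) \<in> W"
    using \<zeta>V nn(2) R(2) dd(2) by (simp add: W_def \<zeta>_def normal_flow_def)
  obtain B0 where B0: "open B0" "(snd c p, t) \<in> B0"
    "\<And>y s. (y, s) \<in> B0 \<Longrightarrow> y \<in> snd c ` fst c \<and> (chart_inv c y, scale_tvec s (\<xi> (chart_inv c y))) \<in> W"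
    using scaled_field_continuous[OF W ptW c] by blast
  define B where "B = B0 \<inter> (snd c ` (fst c \<inter> fst e) \<times> UNIV)"
  have B: "open B" using B0(1) overlap_open[OF cc(1) ee(1)] by (auto simp: B_def open_Times)
  define u where "u = (\<lambda>(y, s). snd n (\<zeta> (chart_inv c y, s)))"
  have ninv: "chart_inv n (snd n q) = q" if "q \<in> fst n" for q
    using chart_inv_chart[OF N_atlas nn(1) that] .
  have BW: "\<zeta> (chart_inv c y, s) \<in> W" "y \<in> snd c ` fst c" if "(y, s) \<in> B" for y s
    using that B0(3) by (auto simp: B_def \<zeta>_def)
  have "twice_differentiable_on (scaled_chart c e) B"
    using twice_differentiable_on_subset[OF scaled_chart_twice_differentiable[OF c e] B] by (auto simp: B_def)
  then have "twice_differentiable_on (\<lambda>z. j (u z)) B"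
  proof (rule twice_differentiable_on_cong)
    fix z assume z: "z \<in> B"
    obtain y s where ys: "z = (y, s)" by (cases z)
    have "\<zeta> (chart_inv c y, s) \<in> fst n" using BW(1) z by (auto simp: ys W_def)
    then show "scaled_chart c e z = j (u z)"
      unfolding ys by (simp add: j_def u_def ninv scaled_chart_eq) (simp add: \<zeta>_def)
  qed
  moreover have "u ` B \<subseteq> R" using BW(1) by (auto simp: u_def W_def)
  ultimately have u2: "twice_differentiable_on u B" by (rule Rt)
  define G where "G = (\<lambda>x. snd d (?E (chart_inv n x)))"
  define Q where "Q = snd n ` (fst n \<inter> {q \<in> V. ?E q \<in> fst d})"
  have Q: "open Q" unfolding Q_def by (rule chart_image_open[OF N_manifold nn(1) oV])
  have nV: "(fst n \<inter> V, snd n) \<in> charts (open_submfd N V)"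
    and dW: "(fst d \<inter> ?W, snd d) \<in> charts (open_submfd M ?W)"
    using nn dd by (auto simp: open_submfd_def)
  \<comment> \<open>The charts of the open submanifold are inverted on the smaller domain
    \<open>fst n \<inter> V\<close>; by injectivity this agrees with
    \<open>chart_inv n\<close>.\<close>
  have "smooth_on (snd d \<circ> ?E \<circ> inv_into (fst n \<inter> V) (snd n)) (snd n ` (fst n \<inter> V \<inter> ?E -` (fst d \<inter> ?W)))"
    using E nV dW unfolding smooth_map_def by fastforce
  moreover have "fst n \<inter> V \<inter> ?E -` (fst d \<inter> ?W) = fst n \<inter> {q \<in> V. ?E q \<in> fst d}" by auto
  ultimately have "smooth_on (snd d \<circ> ?E \<circ> inv_into (fst n \<inter> V) (snd n)) Q" by (simp add: Q_def)
  then have "smooth_on G Q"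
  proof (rule smooth_on_cong[OF _ Q])
    fix x assume "x \<in> Q"
    then obtain q where q: "q \<in> fst n" "q \<in> V" "x = snd n q" by (auto simp: Q_def)
    have "inv_into (fst n \<inter> V) (snd n) x = q"
      using q smooth_manifold_charts(2)[OF N_manifold nn(1)] by (intro inv_into_f_eq) (auto intro: inj_on_subset)
    then show "(snd d \<circ> ?E \<circ> inv_into (fst n \<inter> V) (snd n)) x = G x"
      using q by (simp add: G_def ninv)
  qed
  then have G: "twice_differentiable_on G Q" using Q by (rule smooth_on_imp_twice_differentiable_on)
  have "u ` B \<subseteq> Q" using BW(1) by (auto simp: u_def W_def Q_def)
  then have "twice_differentiable_on (\<lambda>z. G (u z)) B"
    by (rule twice_differentiable_on_compose[OF G u2])
  then have fin: "twice_differentiable_on (\<lambda>(y, s). snd d (\<Phi> (chart_inv c y, s))) B"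
  proof (rule twice_differentiable_on_cong)
    fix z assume z: "z \<in> B"
    obtain y s where ys: "z = (y, s)" by (cases z)
    have "\<zeta> (chart_inv c y, s) \<in> fst n" using BW(1) z by (auto simp: ys W_def)
    then show "G (u z) = (case z of (y, s) \<Rightarrow> snd d (\<Phi> (chart_inv c y, s)))"
      unfolding ys by (simp add: G_def u_def ninv) (simp add: \<zeta>_def normal_flow_def)
  qed
  have cinv: "chart_inv c y \<in> pts S" if "y \<in> snd c ` fst c" for y
    using that chart_inv_chart[OF S_atlas cc(1)] cS by auto
  show ?thesis
  proof (rule that[OF _ _ fin])
    show "(snd c p, t) \<in> B" using B0(2) cc ee by (auto simp: B_def)
    fix y s assume "(y, s) \<in> B"
    then show "y \<in> snd c ` fst c \<and> (chart_inv c y, s) \<in> \<O> \<and> \<Phi> (chart_inv c y, s) \<in> fst d"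
      using BW[of y s] cinv by (simp add: mem_O_iff W_def \<zeta>_def normal_flow_def)
  qed
qed

end

section \<open>Geodesics with vanishing initial velocity\<close>

text \<open>The exponential map is a definite description, so even \<open>\<Phi>(p, 0) = p\<close> requires that a geodesic
  with vanishing initial velocity is constant. In a chart, its velocity satisfies
  \<open>v' = - \<Gamma>(v, v)\<close>, hence \<open>\<bar>v'\<bar> \<le> K \<bar>v\<bar>\<^sup>2\<close>.\<close>

lemma times_differentiable_on_const: "times_differentiable_on k (\<lambda>x. a) A"
  by (induction k arbitrary: a) (simp_all add: frechet_derivative_const)

lemma smooth_on_const: "smooth_on (\<lambda>x. a) A"
  by (simp add: smooth_on_def times_differentiable_on_const)

text \<open>The constant is explicit because the bound is applied to connection coefficients at a
  moving point: as a finite sum it depends continuously on the point, which gives a uniform bound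
  nearby.\<close>

lemma bilinear_bound:
  fixes b :: "'a::euclidean_space \<Rightarrow> 'a \<Rightarrow> 'b::real_normed_vector"
  assumes b: "bilinear b"
  shows "norm (b u u) \<le> (\<Sum>i\<in>Basis. \<Sum>j\<in>Basis. norm (b i j)) * norm u * norm u"
proof -
  have "b u u = (\<Sum>i\<in>Basis. \<Sum>j\<in>Basis. (u \<bullet> i) *\<^sub>R (u \<bullet> j) *\<^sub>R b i j)"
  proof -
    have "b u u = b (\<Sum>i\<in>Basis. (u \<bullet> i) *\<^sub>R i) (\<Sum>j\<in>Basis. (u \<bullet> j) *\<^sub>R j)"
      by (simp add: euclidean_representation)
    also have "\<dots> = (\<Sum>(i, j)\<in>Basis \<times> Basis. b ((u \<bullet> i) *\<^sub>R i) ((u \<bullet> j) *\<^sub>R j))"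
      by (rule bilinear_sum[OF b])
    also have "\<dots> = (\<Sum>i\<in>Basis. \<Sum>j\<in>Basis. (u \<bullet> i) *\<^sub>R (u \<bullet> j) *\<^sub>R b i j)"
      by (simp add: sum.cartesian_product bilinear_lmul[OF b] bilinear_rmul[OF b] mult.commute)
    finally show ?thesis .
  qed
  also have "norm \<dots> \<le> (\<Sum>i\<in>Basis. \<Sum>j\<in>Basis. norm u * (norm u * norm (b i j)))"
  proof (intro sum_norm_le)
    fix i j :: 'a assume "i \<in> Basis" "j \<in> Basis"
    then have "\<bar>u \<bullet> i\<bar> * (\<bar>u \<bullet> j\<bar> * norm (b i j)) \<le> norm u * (norm u * norm (b i j))"
      by (intro mult_mono Basis_le_norm) auto
    then show "norm ((u \<bullet> i) *\<^sub>R (u \<bullet> j) *\<^sub>R b i j) \<le> norm u * (norm u * norm (b i j))"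
      by (simp add: abs_mult)
  qed
  also have "\<dots> = (\<Sum>i\<in>Basis. \<Sum>j\<in>Basis. norm (b i j)) * norm u * norm u"
    by (simp add: sum_distrib_left sum_distrib_right mult_ac)
  finally show ?thesis .
qed

text \<open>On a small closed interval let m <= 1 be the maximum of |v|. Then |w| <= K m^2 <= K m,
  and the mean value inequality from \<open>t0\<close> gives m <= r K m <= m / 2, hence m =
  0.\<close>

lemma quadratic_ode_zero:
  fixes v :: "real \<Rightarrow> 'e::euclidean_space"
  assumes K: "K \<ge> 0" and A: "open A" "t0 \<in> A"
    and v: "\<And>t. t \<in> A \<Longrightarrow> (v has_vector_derivative w t) (at t)"
    and w: "\<And>t. t \<in> A \<Longrightarrow> norm (w t) \<le> K * norm (v t) * norm (v t)"
    and v0: "v t0 = 0"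
  shows "\<exists>r>0. \<forall>t\<in>cball t0 r. t \<in> A \<and> v t = 0"
proof -
  have "isCont v t0" using v[OF A(2)] has_vector_derivative_continuous by blast
  then obtain d where d: "d > 0" "\<And>t. dist t t0 < d \<Longrightarrow> norm (v t) < 1"
    unfolding continuous_at_eps_delta dist_norm v0 by (metis diff_0_right zero_less_one)
  obtain e where e: "e > 0" "cball t0 e \<subseteq> A" using A open_contains_cball by blast
  \<comment> \<open>Half of \<open>d\<close> keeps the closed ball inside the region where |v| < 1.
    Writing \<open>K + 1\<close> avoids a zero denominator for \<open>K = 0\<close>.\<close>
  define r where "r = min (d / 2) (min e (1 / (2 * (K + 1))))"
  have r: "r > 0" "r < d" "r \<le> e" using K d e by (auto simp: r_def)
  have "r * (K + 1) \<le> 1 / (2 * (K + 1)) * (K + 1)"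
    using K by (intro mult_right_mono) (auto simp: r_def)
  also have "\<dots> = 1 / 2" using K by (simp add: add_nonneg_eq_0_iff)
  finally have rK: "r * K \<le> 1 / 2" using r(1) unfolding distrib_left by simp
  let ?I = "cball t0 r"
  have IA: "?I \<subseteq> A" using e r by auto
  have "continuous_on ?I (\<lambda>t. norm (v t))"
    using IA v has_vector_derivative_continuous by (blast intro: continuous_at_imp_continuous_on continuous_on_norm)
  then obtain t1 where t1: "t1 \<in> ?I" "\<And>t. t \<in> ?I \<Longrightarrow> norm (v t) \<le> norm (v t1)"
    using continuous_attains_sup[of ?I "\<lambda>t. norm (v t)"] r by auto
  define m where "m = norm (v t1)"
  have m1: "m \<le> 1" using d(2)[of t1] t1(1) r by (simp add: m_def dist_commute less_imp_le)
  have bound: "norm (w t) \<le> K * m" if "t \<in> ?I" for t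
  proof -
    have "norm (w t) \<le> K * norm (v t) * norm (v t)" using w IA that by blast
    also have "\<dots> \<le> K * m * 1"
      using t1(2)[OF that] m1 K by (intro mult_mono) (auto simp: m_def)
    finally show ?thesis by simp
  qed
  have "norm (v t1 - v t0) \<le> (K * m) * norm (t1 - t0)"
  proof (rule differentiable_bound[where S = ?I and f' = "\<lambda>t h. h *\<^sub>R w t"])
    show "(v has_derivative (\<lambda>h. h *\<^sub>R w t)) (at t within ?I)" if "t \<in> ?I" for t
      using v IA that has_derivative_at_withinI unfolding has_vector_derivative_def by blast
    show "onorm (\<lambda>h. h *\<^sub>R w t) \<le> K * m" if "t \<in> ?I" for t
      using onorm_scaleR_left_lemma[of "\<lambda>h::real. h"] bound[OF that]
      by (simp add: onorm_scaleR_left[OF bounded_linear_ident] onorm_id)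
  qed (use t1 r in auto)
  also have "\<dots> \<le> (K * m) * r"
    using t1(1) K by (intro mult_left_mono) (auto simp: m_def dist_norm norm_minus_commute)
  also have "\<dots> = (r * K) * m" by simp
  also have "\<dots> \<le> 1 / 2 * m" using rK by (intro mult_right_mono) (auto simp: m_def)
  finally have "m = 0" unfolding m_def[symmetric] v0 using norm_ge_zero[of "v t1"] by (simp add: m_def)
  then show ?thesis
    using t1(2) IA r(1) by (intro exI[of _ r]) (auto simp: m_def)
qed

context
  fixes M :: "('a, 'e::euclidean_space) manifold" and \<Gamma> :: "('a, 'e) connection"
  assumes M: "smooth_manifold M" and \<Gamma>: "affine_connection M \<Gamma>"
begin

text \<open>The geodesic equation is formulated with the total function
  \<open>vector_derivative\<close>, which does not assert differentiability. Smoothness of the curve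
  supplies it, so that the equation becomes a genuine first-order system for position and
  velocity.\<close>

lemma geodesic_in_chart:
  assumes \<gamma>: "geodesic M \<Gamma> J \<gamma>" and c: "c \<in> charts M"
  defines "A \<equiv> {t \<in> J. \<gamma> t \<in> fst c}"
  shows "open A"
    and "\<And>t. t \<in> A \<Longrightarrow> ((\<lambda>s. snd c (\<gamma> s)) has_vector_derivative velocity M \<gamma> t c) (at t)"
    and "\<And>t. t \<in> A \<Longrightarrow> ((\<lambda>s. velocity M \<gamma> s c) has_vector_derivative
      - \<Gamma> c (\<gamma> t) (velocity M \<gamma> t c) (velocity M \<gamma> t c)) (at t)"
proof -
  have J: "open J" and sm: "smooth_map (open_submfd euclidean_mfd J) M \<gamma>"
    and ode: "\<And>t c. t \<in> J \<Longrightarrow> c \<in> charts_at M (\<gamma> t) \<Longrightarrow> vector_derivative (\<lambda>s. velocity M \<gamma> s c) (at t) +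
        \<Gamma> c (\<gamma> t) (velocity M \<gamma> t c) (velocity M \<gamma> t c) = 0"
    using \<gamma> unfolding geodesic_def by blast+
  have "continuous_map (top_of_set J) (mtop M) \<gamma>"
    using sm by (simp add: smooth_map_def open_submfd_def euclidean_mfd_def)
  from openin_continuous_map_preimage[OF this smooth_manifold_charts(1)[OF M c]]
  show A: "open A"
    using J openin_open_eq by (auto simp: A_def)
  have "(UNIV \<inter> J, id) \<in> charts (open_submfd euclidean_mfd J)"
    by (auto simp: open_submfd_def euclidean_mfd_def)
  with sm c have "smooth_on (snd c \<circ> \<gamma> \<circ> inv_into (UNIV \<inter> J) id) (id ` (UNIV \<inter> J \<inter> \<gamma> -` fst c))"
    unfolding smooth_map_def by fastforce
  moreover have "id ` (UNIV \<inter> J \<inter> \<gamma> -` fst c) = A" by (auto simp: A_def)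
  ultimately have "smooth_on (snd c \<circ> \<gamma> \<circ> inv_into J id) A" by simp
  then have "smooth_on (\<lambda>t. snd c (\<gamma> t)) A"
  proof (rule smooth_on_cong[OF _ A])
    fix t assume "t \<in> A"
    then have "inv_into J id t = t" using inv_into_f_f[of id J t] by (simp add: A_def)
    then show "(snd c \<circ> \<gamma> \<circ> inv_into J id) t = snd c (\<gamma> t)" by simp
  qed
  then have t2: "twice_differentiable_on (\<lambda>t. snd c (\<gamma> t)) A" using A by (rule smooth_on_imp_twice_differentiable_on)
  have vel: "velocity M \<gamma> t c = frechet_derivative (\<lambda>t. snd c (\<gamma> t)) (at t) 1" if "t \<in> A" for t
    using that c by (simp add: velocity_def charts_at_def A_def o_def vector_derivative_works[symmetric]
      frechet_derivative_eq_vector_derivative[OF twice_differentiable_onD(1)[OF t2 that]])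
  show "((\<lambda>s. snd c (\<gamma> s)) has_vector_derivative velocity M \<gamma> t c) (at t)" if t: "t \<in> A" for t
    using twice_differentiable_onD(1)[OF t2 t] t c
    by (simp add: velocity_def charts_at_def A_def o_def vector_derivative_works)
  show "((\<lambda>s. velocity M \<gamma> s c) has_vector_derivative
      - \<Gamma> c (\<gamma> t) (velocity M \<gamma> t c) (velocity M \<gamma> t c)) (at t)" if t: "t \<in> A" for t
  proof -
    have "\<forall>\<^sub>F s in nhds t. s \<in> A" using A t by (rule eventually_nhds_in_open)
    then have "\<forall>\<^sub>F s in nhds t. frechet_derivative (\<lambda>t. snd c (\<gamma> t)) (at s) 1 = velocity M \<gamma> s c"
      by (rule eventually_mono) (simp add: vel)
    then have "(\<lambda>s. velocity M \<gamma> s c) differentiable (at t)"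
      by (rule differentiable_cong_eventually) (rule twice_differentiable_onD(2)[OF t2 t])
    then have "((\<lambda>s. velocity M \<gamma> s c) has_vector_derivative vector_derivative (\<lambda>s. velocity M \<gamma> s c) (at t)) (at t)"
      by (simp add: vector_derivative_works)
    moreover have "vector_derivative (\<lambda>s. velocity M \<gamma> s c) (at t) =
        - \<Gamma> c (\<gamma> t) (velocity M \<gamma> t c) (velocity M \<gamma> t c)"
      using ode[of t c] t c by (simp add: charts_at_def A_def eq_neg_iff_add_eq_0)
    ultimately show ?thesis by simp
  qed
qed

lemma connection_bilinear: "c \<in> charts M \<Longrightarrow> p \<in> fst c \<Longrightarrow> bilinear (\<Gamma> c p)"
  using \<Gamma> unfolding affine_connection_def by blast

lemma geodesic_constant_locally:
  assumes \<gamma>: "geodesic M \<Gamma> J \<gamma>" and c: "c \<in> charts M" and t0: "t0 \<in> J" "\<gamma> t0 \<in> fst c"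
    and v0: "velocity M \<gamma> t0 c = 0"
  shows "\<exists>r>0. \<forall>t\<in>ball t0 r. t \<in> J \<and> \<gamma> t = \<gamma> t0 \<and> velocity M \<gamma> t c = 0"
proof -
  define A where "A = {t \<in> J. \<gamma> t \<in> fst c}"
  note geo = geodesic_in_chart[OF \<gamma> c, folded A_def]
  have t0A: "t0 \<in> A" using t0 by (simp add: A_def)
  have inv: "chart_inv c (snd c q) = q" if "q \<in> fst c" for q
    using chart_inv_chart[OF smooth_manifold_imp_differentiable_atlas[OF M] c that] .
  \<comment> \<open>The explicit constant of \<open>bilinear_bound\<close> along the curve; its
    continuity gives the uniform constant \<open>k t0 + 1\<close> near \<open>t0\<close>.\<close>
  define k where "k t = (\<Sum>i\<in>Basis. \<Sum>j\<in>Basis. norm (\<Gamma> c (chart_inv c (snd c (\<gamma> t))) i j))" for t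
  have "isCont k t0"
  proof -
    have "isCont (\<lambda>x. \<Gamma> c (chart_inv c x) i j) (snd c (\<gamma> t0))" for i j
    proof -
      have "smooth_on (\<lambda>x. \<Gamma> c (chart_inv c x) i j) (snd c ` fst c)"
        using \<Gamma> c unfolding affine_connection_def by blast
      then have "twice_differentiable_on (\<lambda>x. \<Gamma> c (chart_inv c x) i j) (snd c ` fst c)"
        using smooth_manifold_charts(3)[OF M c] by (rule smooth_on_imp_twice_differentiable_on)
      then show ?thesis
        using twice_differentiable_onD(1) t0 by (blast intro: differentiable_imp_continuous_within)
    qed
    moreover have "isCont (\<lambda>t. snd c (\<gamma> t)) t0"
      using geo(2)[OF t0A] has_vector_derivative_continuous by blast
    ultimately have "isCont (\<lambda>t. \<Gamma> c (chart_inv c (snd c (\<gamma> t))) i j) t0" for i j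
      by (rule isCont_o2[rotated])
    then show ?thesis unfolding k_def by (intro continuous_intros)
  qed
  then obtain d where d: "d > 0" "\<And>t. dist t t0 < d \<Longrightarrow> dist (k t) (k t0) < 1"
    unfolding continuous_at_eps_delta using zero_less_one by blast
  have k0: "k t0 \<ge> 0" unfolding k_def by (intro sum_nonneg) auto
  have "\<exists>r>0. \<forall>t\<in>cball t0 r. t \<in> A \<inter> ball t0 d \<and> velocity M \<gamma> t c = 0"
  proof (rule quadratic_ode_zero[where K = "k t0 + 1"])
    fix t assume t: "t \<in> A \<inter> ball t0 d"
    show "((\<lambda>s. velocity M \<gamma> s c) has_vector_derivative
        - \<Gamma> c (\<gamma> t) (velocity M \<gamma> t c) (velocity M \<gamma> t c)) (at t)" using geo(3) t by blast
    have "\<gamma> t \<in> fst c" using t by (simp add: A_def)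
    then have "norm (- \<Gamma> c (\<gamma> t) (velocity M \<gamma> t c) (velocity M \<gamma> t c)) \<le> k t * norm (velocity M \<gamma> t c) * norm (velocity M \<gamma> t c)"
      using bilinear_bound[OF connection_bilinear[OF c]] by (simp add: k_def inv)
    also have "\<dots> \<le> (k t0 + 1) * norm (velocity M \<gamma> t c) * norm (velocity M \<gamma> t c)"
      using d(2)[of t] t by (intro mult_right_mono) (auto simp: dist_real_def dist_commute abs_less_iff)
    finally show "norm (- \<Gamma> c (\<gamma> t) (velocity M \<gamma> t c) (velocity M \<gamma> t c))
      \<le> (k t0 + 1) * norm (velocity M \<gamma> t c) * norm (velocity M \<gamma> t c)" .
  qed (use geo(1) d t0A v0 k0 in auto)
  then obtain r where r: "r > 0" "\<And>t. t \<in> cball t0 r \<Longrightarrow> t \<in> A \<and> velocity M \<gamma> t c = 0" by auto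
  have "\<exists>a. \<forall>t\<in>cball t0 r. snd c (\<gamma> t) = a"
  proof (rule has_derivative_zero_constant)
    fix t assume "t \<in> cball t0 r"
    then have "((\<lambda>s. snd c (\<gamma> s)) has_vector_derivative 0) (at t)" using geo(2) r(2) by force
    then show "((\<lambda>s. snd c (\<gamma> s)) has_derivative (\<lambda>h. 0)) (at t within cball t0 r)"
      using has_derivative_at_withinI by (auto simp: has_vector_derivative_def)
  qed simp
  then have const: "snd c (\<gamma> t) = snd c (\<gamma> t0)" if "t \<in> cball t0 r" for t
    using that r(1) by (metis centre_in_cball less_imp_le)
  have "\<gamma> t = \<gamma> t0" if t: "t \<in> cball t0 r" for t
  proof -
    have "\<gamma> t \<in> fst c" using r(2)[OF t] by (simp add: A_def)
    then show ?thesis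
      using const[OF t] t0(2) smooth_manifold_charts(2)[OF M c] by (simp add: inj_on_eq_iff)
  qed
  moreover have "t \<in> J" "velocity M \<gamma> t c = 0" if "t \<in> cball t0 r" for t
    using r(2)[OF that] by (simp_all add: A_def)
  ultimately have "\<forall>t\<in>ball t0 r. t \<in> J \<and> \<gamma> t = \<gamma> t0 \<and> velocity M \<gamma> t c = 0"
    by (simp add: less_imp_le)
  then show ?thesis using r(1) by blast
qed

text \<open>The times at which the curve sits at \<open>\<gamma> s\<close> with zero velocity form
  an open set by the local result. The complement is open too: either the curve is away from that
  point, which is closed in a Hausdorff space, or it passes through it with nonzero velocity.
  Connectedness of \<open>J\<close> concludes.\<close>

lemma geodesic_constant:
  assumes \<gamma>: "geodesic M \<Gamma> J \<gamma>" and J: "s \<in> J" "t \<in> J" and v: "velocity M \<gamma> s = zero_tvec"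
  shows "\<gamma> t = \<gamma> s"
proof -
  have oJ: "open J" and iJ: "is_interval J" and cont: "continuous_map (top_of_set J) (mtop M) \<gamma>"
    using \<gamma> by (auto simp: geodesic_def smooth_map_def open_submfd_def euclidean_mfd_def)
  have pM: "\<gamma> s \<in> pts M" using cont J(1) by (auto simp: continuous_map_def)
  obtain c where "c \<in> charts_at M (\<gamma> s)"
    using charts_at_nonempty[OF smooth_manifold_imp_differentiable_atlas[OF M] pM] by blast
  then have c: "c \<in> charts M" "\<gamma> s \<in> fst c" by (auto simp: charts_at_def)
  define Z where "Z = {t \<in> J. \<gamma> t = \<gamma> s \<and> velocity M \<gamma> t c = 0}"
  define Y where "Y = J - Z"
  have "open Z"
    unfolding open_contains_ball
  proof
    fix u assume u: "u \<in> Z"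
    then show "\<exists>r>0. ball u r \<subseteq> Z"
      using geodesic_constant_locally[OF \<gamma> c(1), of u] c(2) by (auto simp: Z_def subset_iff)
  qed
  moreover have "open Y"
    unfolding open_subopen[of Y]
  proof
    fix u assume u: "u \<in> Y"
    show "\<exists>B. open B \<and> u \<in> B \<and> B \<subseteq> Y"
    proof (cases "\<gamma> u = \<gamma> s")
      case False
      have "closedin (mtop M) {\<gamma> s}"
      proof -
        have "Hausdorff_space (mtop M)" using M unfolding smooth_manifold_def by blast
        then show ?thesis using pM by (simp add: closedin_Hausdorff_singleton)
      qed
      then have "openin (mtop M) (pts M - {\<gamma> s})" by blast
      from openin_continuous_map_preimage[OF cont this]
      have "open {t \<in> J. \<gamma> t \<in> pts M - {\<gamma> s}}" using oJ openin_open_eq by auto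
      moreover have "u \<in> {t \<in> J. \<gamma> t \<in> pts M - {\<gamma> s}}"
        using u False cont by (auto simp: Y_def continuous_map_def)
      moreover have "{t \<in> J. \<gamma> t \<in> pts M - {\<gamma> s}} \<subseteq> Y" by (auto simp: Y_def Z_def)
      ultimately show ?thesis by blast
    next
      case True
      define A where "A = {t \<in> J. \<gamma> t \<in> fst c}"
      note geo = geodesic_in_chart[OF \<gamma> c(1), folded A_def]
      have uA: "u \<in> A" using u True c by (auto simp: A_def Y_def)
      have vu: "velocity M \<gamma> u c \<noteq> 0" using u True by (auto simp: Y_def Z_def)
      have "continuous_on A (\<lambda>t. velocity M \<gamma> t c)"
        using geo(3) has_vector_derivative_continuous by (blast intro: continuous_at_imp_continuous_on)
      then have "open (A \<inter> (\<lambda>t. velocity M \<gamma> t c) -` (- {0}))"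
        using geo(1) by (rule continuous_open_preimage) auto
      moreover have "A \<inter> (\<lambda>t. velocity M \<gamma> t c) -` (- {0}) \<subseteq> Y" by (auto simp: A_def Y_def Z_def)
      ultimately show ?thesis using uA vu by blast
    qed
  qed
  moreover have "s \<in> Z" using J v by (simp add: Z_def zero_tvec_def)
  moreover have "connected J" using iJ by (rule is_interval_connected)
  ultimately have "Y = {}"
    unfolding connected_def Y_def by (auto simp: Z_def)
  then show ?thesis using J by (auto simp: Y_def Z_def)
qed

lemma geodesic_const:
  assumes p: "p \<in> pts M"
  shows "geodesic M \<Gamma> UNIV (\<lambda>_. p)" and "velocity M (\<lambda>_. p) t = zero_tvec"
proof -
  show vel: "velocity M (\<lambda>_. p) t = zero_tvec" for t
    by (auto simp: velocity_def zero_tvec_def o_def)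
  have "smooth_map (open_submfd euclidean_mfd (UNIV::real set)) M (\<lambda>_. p)"
    using p by (auto simp: smooth_map_def open_submfd_def euclidean_mfd_def o_def smooth_on_const)
  then show "geodesic M \<Gamma> UNIV (\<lambda>_. p)"
    using bilinear_lzero[OF connection_bilinear]
    by (auto simp: geodesic_def vel is_interval_univ zero_tvec_def charts_at_def)
qed

lemma exp_map_zero:
  assumes p: "p \<in> pts M"
  shows "exp_map M \<Gamma> (p, zero_tvec) = p"
  unfolding exp_map_def
proof (rule the_equality)
  show "geodesic_to M \<Gamma> (p, zero_tvec) p"
    unfolding geodesic_to_def using geodesic_const[OF p] by auto
  fix q assume "geodesic_to M \<Gamma> (p, zero_tvec) q"
  then obtain J \<gamma> where "geodesic M \<Gamma> J \<gamma>" "{0..1} \<subseteq> J" "\<gamma> 0 = p" "velocity M \<gamma> 0 = zero_tvec" "\<gamma> 1 = q"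
    unfolding geodesic_to_def by auto
  moreover from this(2) have "0 \<in> J" "1 \<in> J" by auto
  ultimately show "q = p" using geodesic_constant[of J \<gamma> 0 1] by simp
qed

end

lemma (in normal_exponential) flow_zero:
  assumes "p \<in> pts S"
  shows "\<Phi> (p, 0) = p"
proof -
  have "affine_connection M \<Gamma>" using levi_civita by (simp add: levi_civita_def)
  then have "exp_map M \<Gamma> (p, zero_tvec) = p"
    using exp_map_zero[OF M_manifold] assms S_subset by blast
  moreover have "scale_tvec 0 (\<xi> p) = zero_tvec" by (simp add: scale_tvec_def zero_tvec_def)
  ultimately show ?thesis by (simp add: normal_flow_def)
qed

section \<open>Transported manifold structures\<close>

definition image_chart :: "('a \<Rightarrow> 'b) \<Rightarrow> ('a, 'e) manifold \<Rightarrow> ('a, 'e) chart \<Rightarrow> ('b, 'e) chart" where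
  "image_chart f X c = (f ` fst c, snd c \<circ> inv_into (pts X) f)"

context
  fixes X :: "('a, 'e::euclidean_space) manifold" and f :: "'a \<Rightarrow> 'b"
  assumes X: "differentiable_atlas X" and f: "inj_on f (pts X)"
begin

lemma charts_image_mfd: "charts (image_mfd f X) = image_chart f X ` charts X"
  by (simp add: image_mfd_def image_chart_def)

lemma pts_image_mfd: "pts (image_mfd f X) = f ` pts X"
  using f by (auto simp: image_mfd_def topspace_pullback_topology)

lemma chart_subset_pts: "c \<in> charts X \<Longrightarrow> fst c \<subseteq> pts X"
  using X unfolding differentiable_atlas_def by blast

lemma image_chart_apply: "q \<in> pts X \<Longrightarrow> snd (image_chart f X c) (f q) = snd c q"
  using f by (simp add: image_chart_def)

lemma mem_image_chart: "c \<in> charts X \<Longrightarrow> q \<in> pts X \<Longrightarrow> f q \<in> fst (image_chart f X c) \<longleftrightarrow> q \<in> fst c"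
  using inj_on_image_mem_iff[OF f] chart_subset_pts[of c] by (simp add: image_chart_def)

lemma image_chart_inj: "c \<in> charts X \<Longrightarrow> inj_on (snd (image_chart f X c)) (fst (image_chart f X c))"
proof (rule inj_onI)
  fix x y assume c: "c \<in> charts X" and "x \<in> fst (image_chart f X c)" "y \<in> fst (image_chart f X c)"
    and eq: "snd (image_chart f X c) x = snd (image_chart f X c) y"
  then obtain p q where pq: "x = f p" "y = f q" "p \<in> fst c" "q \<in> fst c" by (auto simp: image_chart_def)
  then have "p \<in> pts X" "q \<in> pts X" using chart_subset_pts[OF c] by auto
  with eq have "snd c p = snd c q" by (simp add: pq image_chart_apply)
  moreover have "inj_on (snd c) (fst c)" using X c unfolding differentiable_atlas_def by blast
  ultimately show "x = y" using pq by (simp add: inj_on_eq_iff)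
qed

lemma image_chart_inv:
  assumes c: "c \<in> charts X" and y: "y \<in> snd c ` fst c"
  shows "chart_inv (image_chart f X c) y = f (chart_inv c y)"
proof (rule inv_into_f_eq[OF image_chart_inj[OF c]])
  have "chart_inv c y \<in> fst c" and "snd c (chart_inv c y) = y"
    using y by (auto simp: inv_into_into f_inv_into_f)
  moreover from this chart_subset_pts[OF c] have "chart_inv c y \<in> pts X" by blast
  ultimately show "f (chart_inv c y) \<in> fst (image_chart f X c)"
    and "snd (image_chart f X c) (f (chart_inv c y)) = y"
    using image_chart_apply by (auto simp: image_chart_def)
qed

lemma image_chart_image:
  assumes c: "c \<in> charts X"
  shows "snd (image_chart f X c) ` (fst (image_chart f X c) \<inter> A) = snd c ` (fst c \<inter> f -` A)"
proof -
  have "fst (image_chart f X c) \<inter> A = f ` (fst c \<inter> f -` A)" by (auto simp: image_chart_def)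
  moreover have "snd (image_chart f X c) (f q) = snd c q" if "q \<in> fst c \<inter> f -` A" for q
    using that chart_subset_pts[OF c] by (intro image_chart_apply) auto
  ultimately show ?thesis by (simp add: image_image)
qed

lemma charts_at_image_mfd:
  "p \<in> pts X \<Longrightarrow> charts_at (image_mfd f X) (f p) = image_chart f X ` charts_at X p"
  using mem_image_chart by (auto simp: charts_at_def charts_image_mfd)

text \<open>In the transported charts \<open>f\<close> is the identity of coordinates.\<close>

lemma has_chart_derivative_to_image_mfd:
  assumes c: "c \<in> charts_at X p"
  shows "has_chart_derivative X (image_mfd f X) f p c (image_chart f X c) (\<lambda>v. v)"
proof -
  have cc: "c \<in> charts X" "p \<in> fst c" using c by (auto simp: charts_at_def)
  have p: "p \<in> pts X" using charts_at_pts[OF X c] .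
  note ev = eventually_in_chart_overlap[OF X c c]
  have "((\<lambda>x. snd (image_chart f X c) (f (chart_inv c x))) has_derivative (\<lambda>v. v)) (at (snd c p))"
  proof (rule has_derivative_cong_eventually[of "\<lambda>x. x"])
    show "\<forall>\<^sub>F x in nhds (snd c p). x = snd (image_chart f X c) (f (chart_inv c x))"
      using ev
    proof (rule eventually_mono)
      fix x assume x: "chart_inv c x \<in> fst c \<and> chart_inv c x \<in> fst c \<and> snd c (chart_inv c x) = x"
      then have "chart_inv c x \<in> pts X" using chart_subset_pts[OF cc(1)] by blast
      with x show "x = snd (image_chart f X c) (f (chart_inv c x))" by (simp add: image_chart_apply)
    qed
  qed simp
  moreover have "\<forall>\<^sub>F x in nhds (snd c p). f (chart_inv c x) \<in> fst (image_chart f X c)"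
    using ev by (rule eventually_mono) (auto simp: image_chart_def)
  ultimately show ?thesis
    using c by (simp add: has_chart_derivative_def charts_at_image_mfd[OF p])
qed

text \<open>The expression of \<open>h\<close> in a transported chart is that of \<open>h\<close>
  after \<open>f\<close> in the original chart, so the same \<open>D\<close> is the
  derivative.\<close>

lemma has_chart_derivative_from_image_mfd:
  assumes h: "has_chart_derivative X Y h' p c d D" and hf: "\<And>q. q \<in> pts X \<Longrightarrow> h (f q) = h' q"
  shows "has_chart_derivative (image_mfd f X) Y h (f p) (image_chart f X c) d D"
proof -
  have c: "c \<in> charts_at X p" using h by (simp add: has_chart_derivative_def)
  have cc: "c \<in> charts X" "p \<in> fst c" using c by (auto simp: charts_at_def)
  have p: "p \<in> pts X" using charts_at_pts[OF X c] .
  note ev = eventually_in_chart_overlap[OF X c c]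
  have eq: "\<forall>\<^sub>F x in nhds (snd c p). h (chart_inv (image_chart f X c) x) = h' (chart_inv c x)"
    using ev
  proof (rule eventually_mono)
    fix x assume x: "chart_inv c x \<in> fst c \<and> chart_inv c x \<in> fst c \<and> snd c (chart_inv c x) = x"
    then have "x \<in> snd c ` fst c" by (metis image_eqI)
    then show "h (chart_inv (image_chart f X c) x) = h' (chart_inv c x)"
      using image_chart_inv[OF cc(1)] hf x chart_subset_pts[OF cc(1)] by auto
  qed
  have "((\<lambda>x. snd d (h (chart_inv (image_chart f X c) x))) has_derivative D) (at (snd c p))"
    by (rule has_derivative_cong_eventually[of "\<lambda>x. snd d (h' (chart_inv c x))"])
      (use eq h in \<open>auto simp: has_chart_derivative_def elim: eventually_mono\<close>)
  moreover have "\<forall>\<^sub>F x in nhds (snd c p). h' (chart_inv c x) \<in> fst d"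
    using h by (simp add: has_chart_derivative_def)
  then have "\<forall>\<^sub>F x in nhds (snd c p). h (chart_inv (image_chart f X c) x) \<in> fst d"
    using eq by eventually_elim simp
  ultimately show ?thesis
    using h c p by (simp add: has_chart_derivative_def charts_at_image_mfd hf image_chart_apply)
qed

lemma differentiable_atlas_image_mfd: "differentiable_atlas (image_mfd f X)"
  unfolding differentiable_atlas_def charts_image_mfd pts_image_mfd
proof (intro conjI ballI)
  fix c assume "c \<in> image_chart f X ` charts X"
  then obtain c0 where c: "c = image_chart f X c0" "c0 \<in> charts X" by blast
  show "inj_on (snd c) (fst c)" using c image_chart_inj by blast
  show "open (snd c ` fst c)"
    using X c image_chart_image[OF c(2), of UNIV] by (simp add: differentiable_atlas_def)
next
  show "(\<Union>c\<in>image_chart f X ` charts X. fst c) = f ` pts X"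
  proof -
    have "(\<Union>c\<in>charts X. fst c) = pts X" using X by (simp add: differentiable_atlas_def)
    then have "(\<Union>c\<in>charts X. f ` fst c) = f ` pts X" by blast
    then show ?thesis by (simp add: image_chart_def)
  qed
next
  fix c d p assume cd: "c \<in> image_chart f X ` charts X" "d \<in> image_chart f X ` charts X"
  then obtain c0 d0 where c: "c = image_chart f X c0" "c0 \<in> charts X"
    and d: "d = image_chart f X d0" "d0 \<in> charts X" by blast
  have "fst c0 \<inter> f -` fst (image_chart f X d0) = fst c0 \<inter> fst d0"
    using mem_image_chart[OF d(2)] chart_subset_pts[OF c(2)] by auto
  then show "open (snd c ` (fst c \<inter> fst d))"
    using X c d image_chart_image[OF c(2), of "fst d"] by (simp add: differentiable_atlas_def)
  assume p: "p \<in> fst c \<inter> fst d"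
  then obtain q where q: "p = f q" "q \<in> fst c0" using c by (auto simp: image_chart_def)
  have qX: "q \<in> pts X" using q chart_subset_pts[OF c(2)] by blast
  have c0: "c0 \<in> charts_at X q" using c q by (simp add: charts_at_def)
  have d0: "d0 \<in> charts_at X q" using d p q qX mem_image_chart by (simp add: charts_at_def)
  have "has_chart_derivative X (image_mfd f X) f q c0 d (\<lambda>v. transition_derivative c0 d0 q v)"
    using has_chart_derivative_compose[OF X X has_chart_derivative_transition[OF X c0 d0]
        has_chart_derivative_to_image_mfd[OF d0]] by (simp add: d)
  from has_chart_derivative_from_image_mfd[OF this, of "\<lambda>x. x"]
  show "(snd d \<circ> chart_inv c) differentiable (at (snd c p))"
    by (auto simp: has_chart_derivative_def o_def c(1) q(1) differentiable_def)
qed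

lemma homeomorphic_maps_image_mfd:
  "homeomorphic_maps (mtop X) (mtop (image_mfd f X)) f (inv_into (pts X) f)"
proof -
  have "continuous_map (mtop X) (mtop X) (inv_into (pts X) f \<circ> f)"
    by (rule continuous_map_eq[OF continuous_map_id]) (use f in simp)
  then have 1: "continuous_map (mtop X) (mtop (image_mfd f X)) f"
    unfolding image_mfd_def manifold.simps by (rule continuous_map_pullback') auto
  have "continuous_map (mtop (image_mfd f X)) (mtop X) (id \<circ> inv_into (pts X) f)"
    unfolding image_mfd_def manifold.simps by (rule continuous_map_pullback) (rule continuous_map_id)
  with 1 show ?thesis
    using f pts_image_mfd by (auto simp: homeomorphic_maps_def)
qed

lemma openin_image_chart:
  assumes "openin (mtop X) (fst c)"
  shows "openin (mtop (image_mfd f X)) (fst (image_chart f X c))"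
proof -
  have "homeomorphic_map (mtop X) (mtop (image_mfd f X)) f"
    using homeomorphic_maps_image_mfd homeomorphic_maps_map by blast
  then show ?thesis
    using assms homeomorphic_imp_open_map unfolding open_map_def image_chart_def by fastforce
qed

end

text \<open>Transport leaves chart expressions unchanged on chart images, so smoothness passes over
  without composing smooth maps. The same holds for maps into the transported manifold.\<close>

lemma smooth_map_from_image_mfd:
  assumes X: "differentiable_atlas X" and f: "inj_on f (pts X)" and h': "smooth_map X Y h'"
    and hf: "\<And>q. q \<in> pts X \<Longrightarrow> h (f q) = h' q"
  shows "smooth_map (image_mfd f X) Y h"
  unfolding smooth_map_def
proof (intro conjI ballI)
  have "continuous_map (mtop (image_mfd f X)) (mtop Y) (h' \<circ> inv_into (pts X) f)"
    using homeomorphic_maps_image_mfd[OF X f] h' unfolding homeomorphic_maps_def smooth_map_def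
    by (blast intro: continuous_map_compose)
  then show "continuous_map (mtop (image_mfd f X)) (mtop Y) h"
    by (rule continuous_map_eq) (use f hf pts_image_mfd[OF X f] in auto)
  fix c d assume "c \<in> charts (image_mfd f X)" and d: "d \<in> charts Y"
  then obtain c0 where c: "c = image_chart f X c0" "c0 \<in> charts X"
    using charts_image_mfd[OF X f] by blast
  note sub = chart_subset_pts[OF X f c(2)]
  have "smooth_on (snd d \<circ> h' \<circ> chart_inv c0) (snd c0 ` (fst c0 \<inter> h' -` fst d))"
    using h' c d unfolding smooth_map_def by blast
  moreover have "snd c0 ` (fst c0 \<inter> h' -` fst d) = snd c ` (fst c \<inter> h -` fst d)"
  proof -
    have "fst c0 \<inter> h' -` fst d = fst c0 \<inter> f -` (h -` fst d)" using hf sub by auto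
    then show ?thesis using image_chart_image[OF X f c(2)] c(1) by simp
  qed
  ultimately have "smooth_on (snd d \<circ> h' \<circ> chart_inv c0) (snd c ` (fst c \<inter> h -` fst d))" by simp
  then show "smooth_on (snd d \<circ> h \<circ> chart_inv c) (snd c ` (fst c \<inter> h -` fst d))"
  proof (rule smooth_on_cong_superset[where B = "snd c0 ` fst c0"])
    show "open (snd c0 ` fst c0)" using X c(2) by (simp add: differentiable_atlas_def)
    show "snd c ` (fst c \<inter> h -` fst d) \<subseteq> snd c0 ` fst c0"
      using image_chart_image[OF X f c(2)] c(1) by auto
    fix x assume x: "x \<in> snd c0 ` fst c0"
    then have "chart_inv c0 x \<in> pts X" using sub by (auto simp: inv_into_into)
    then show "(snd d \<circ> h' \<circ> chart_inv c0) x = (snd d \<circ> h \<circ> chart_inv c) x"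
      using image_chart_inv[OF X f c(2) x] hf by (simp add: c(1))
  qed
qed

lemma smooth_map_to_image_mfd:
  assumes X: "differentiable_atlas X" and f: "inj_on f (pts X)" and Y: "differentiable_atlas Y"
    and h: "smooth_map Y X h"
  shows "smooth_map Y (image_mfd f X) (\<lambda>q. f (h q))"
  unfolding smooth_map_def
proof (intro conjI ballI)
  show "continuous_map (mtop Y) (mtop (image_mfd f X)) (\<lambda>q. f (h q))"
    using homeomorphic_maps_image_mfd[OF X f] h continuous_map_compose[of "mtop Y" "mtop X" h _ f]
    unfolding homeomorphic_maps_def smooth_map_def o_def by blast
  fix c d assume c: "c \<in> charts Y" and "d \<in> charts (image_mfd f X)"
  then obtain d0 where d: "d = image_chart f X d0" "d0 \<in> charts X"
    using charts_image_mfd[OF X f] by blast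
  have sub: "fst c \<subseteq> pts Y" using Y c unfolding differentiable_atlas_def by blast
  have hX: "h q \<in> pts X" if "q \<in> pts Y" for q using h that unfolding smooth_map_def continuous_map_def by blast
  have "smooth_on (snd d0 \<circ> h \<circ> chart_inv c) (snd c ` (fst c \<inter> h -` fst d0))"
    using h c d unfolding smooth_map_def by blast
  moreover have "fst c \<inter> h -` fst d0 = fst c \<inter> (\<lambda>q. f (h q)) -` fst d"
    using mem_image_chart[OF X f d(2) hX] sub d(1) by auto
  ultimately have "smooth_on (snd d0 \<circ> h \<circ> chart_inv c) (snd c ` (fst c \<inter> (\<lambda>q. f (h q)) -` fst d))" by simp
  then show "smooth_on (snd d \<circ> (\<lambda>q. f (h q)) \<circ> chart_inv c) (snd c ` (fst c \<inter> (\<lambda>q. f (h q)) -` fst d))"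
  proof (rule smooth_on_cong_superset[where B = "snd c ` fst c"])
    show "open (snd c ` fst c)" using Y c by (simp add: differentiable_atlas_def)
    fix x assume "x \<in> snd c ` fst c"
    then have "chart_inv c x \<in> fst c" by (rule inv_into_into)
    then have "h (chart_inv c x) \<in> pts X" using sub hX by blast
    then show "(snd d0 \<circ> h \<circ> chart_inv c) x = (snd d \<circ> (\<lambda>q. f (h q)) \<circ> chart_inv c) x"
      using image_chart_apply[OF X f] by (simp add: d(1))
  qed auto
qed

lemma smooth_map_ident:
  assumes X: "smooth_manifold X"
  shows "smooth_map X X (\<lambda>q. q)"
  using X by (auto simp: smooth_map_def smooth_manifold_def comp_def vimage_def)

text \<open>Used for the canonical leaves, which have to be smooth manifolds in their own
  right.\<close>

lemma smooth_manifold_image_mfd: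
  assumes X: "smooth_manifold X" and f: "inj_on f (pts X)"
  shows "smooth_manifold (image_mfd f X)"
proof -
  note Xa = smooth_manifold_imp_differentiable_atlas[OF X]
  let ?Y = "image_mfd f X" and ?g = "inv_into (pts X) f"
  note hm = homeomorphic_maps_image_mfd[OF Xa f]
  have hs: "mtop X homeomorphic_space mtop ?Y"
    using hm unfolding homeomorphic_space_def by blast
  note sub = chart_subset_pts[OF Xa f]
  have ne: "pts ?Y \<noteq> {}" using X pts_image_mfd[OF Xa f] by (auto simp: smooth_manifold_def)
  have T2: "Hausdorff_space (mtop ?Y)" "second_countable (mtop ?Y)"
    using X homeomorphic_Hausdorff_space[OF hs] homeomorphic_space_second_countability[OF hs]
    by (auto simp: smooth_manifold_def)
  have cover: "(\<Union>c\<in>charts ?Y. fst c) = pts ?Y"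
    using differentiable_atlas_image_mfd[OF Xa f] by (simp add: differentiable_atlas_def)
  have ch: "openin (mtop ?Y) (fst c) \<and> open (snd c ` fst c) \<and>
      homeomorphic_map (subtopology (mtop ?Y) (fst c)) (top_of_set (snd c ` fst c)) (snd c)"
    if cY: "c \<in> charts ?Y" for c
  proof -
    obtain c0 where c: "c = image_chart f X c0" "c0 \<in> charts X"
      using cY unfolding charts_image_mfd[OF Xa f] by blast
    have img: "snd c ` fst c = snd c0 ` fst c0"
      using image_chart_image[OF Xa f c(2), of UNIV] by (simp add: c(1))
    have "homeomorphic_maps (subtopology (mtop X) (fst c0)) (subtopology (mtop ?Y) (fst c)) f ?g"
      by (rule homeomorphic_maps_subtopologies[OF hm])
        (use sub[OF c(2)] pts_image_mfd[OF Xa f] in \<open>auto simp: c(1) image_chart_def\<close>)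
    then have 1: "homeomorphic_map (subtopology (mtop ?Y) (fst c)) (subtopology (mtop X) (fst c0)) ?g"
      using homeomorphic_maps_map by blast
    have 2: "homeomorphic_map (subtopology (mtop X) (fst c0)) (top_of_set (snd c0 ` fst c0)) (snd c0)"
      using X c(2) by (simp add: smooth_manifold_def)
    have "homeomorphic_map (subtopology (mtop ?Y) (fst c)) (top_of_set (snd c ` fst c)) (snd c)"
      using homeomorphic_map_compose[OF 1 2] unfolding img by (simp add: c(1) image_chart_def)
    moreover have "openin (mtop ?Y) (fst c)"
      using openin_image_chart[OF Xa f] smooth_manifold_charts(1)[OF X c(2)] by (simp add: c(1))
    ultimately show ?thesis using smooth_manifold_charts(3)[OF X c(2)] img by simp
  qed
  \<comment> \<open>Smoothness of the transitions is smoothness of the identity, which the two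
    transport lemmas derive from the identity of \<open>X\<close>.\<close>
  have "smooth_map ?Y ?Y (\<lambda>q. q)"
    using smooth_map_from_image_mfd[OF Xa f smooth_map_to_image_mfd[OF Xa f Xa smooth_map_ident[OF X]]] by simp
  then have "smooth_on (snd d \<circ> chart_inv c) (snd c ` (fst c \<inter> fst d))"
    if "c \<in> charts ?Y" "d \<in> charts ?Y" for c d
    using that by (simp add: smooth_map_def comp_def vimage_def)
  then show ?thesis
    using ne T2 cover ch unfolding smooth_manifold_def by blast
qed

section \<open>The hypersurface in coordinates\<close>

context normal_exponential
begin

abbreviation F :: "('a \<times> real, 's \<times> real) manifold" where "F \<equiv> flow_mfd S \<O>"

abbreviation H :: "('a, 's \<times> real) manifold" where "H \<equiv> emanating_hypersurface \<Phi> \<O> S"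

definition flow_chart :: "('a, 's) chart \<Rightarrow> ('a \<times> real, 's \<times> real) chart" where
  "flow_chart c = ((fst c \<times> UNIV) \<inter> \<O>, \<lambda>(p, t). (snd c p, t))"

text \<open>The coordinate image of \<open>flow_chart c\<close>, by \<open>flow_chart_image\<close>
  with \<open>A = UNIV\<close>. In this form its slices in either variable are plain
  preimages.\<close>

definition flow_range :: "('a, 's) chart \<Rightarrow> ('s \<times> real) set" where
  "flow_range c = {(y, s). y \<in> snd c ` fst c \<and> (chart_inv c y, s) \<in> \<O>}"

lemma flow_chart_apply [simp]: "snd (flow_chart c) (p, t) = (snd c p, t)"
  by (simp add: flow_chart_def)

lemma mem_flow_chart: "(p, t) \<in> fst (flow_chart c) \<longleftrightarrow> p \<in> fst c \<and> (p, t) \<in> \<O>"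
  by (simp add: flow_chart_def)

lemma charts_F: "charts F = flow_chart ` charts S"
  by (auto simp: flow_mfd_def open_submfd_def product_line_def flow_chart_def image_image)

lemma pts_F: "pts F = \<O>"
  by (auto simp: flow_mfd_def open_submfd_def product_line_def flow_domain_def)

lemma charts_at_F: "(p, t) \<in> \<O> \<Longrightarrow> charts_at F (p, t) = flow_chart ` charts_at S p"
  by (auto simp: charts_at_def charts_F mem_flow_chart)

lemma S_chart_inv: "c \<in> charts S \<Longrightarrow> p \<in> fst c \<Longrightarrow> chart_inv c (snd c p) = p"
  by (rule chart_inv_chart[OF S_atlas])

lemma flow_chart_image:
  assumes c: "c \<in> charts S"
  shows "snd (flow_chart c) ` (fst (flow_chart c) \<inter> (A \<times> UNIV)) = flow_range c \<inter> (snd c ` (fst c \<inter> A) \<times> UNIV)"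
proof (intro equalityI subsetI)
  fix z assume z: "z \<in> flow_range c \<inter> (snd c ` (fst c \<inter> A) \<times> UNIV)"
  then obtain p s where p: "p \<in> fst c" "p \<in> A" "z = (snd c p, s)" by blast
  with z have "(p, s) \<in> \<O>" using S_chart_inv[OF c p(1)] by (simp add: flow_range_def)
  note p = p this
  then have "(p, s) \<in> fst (flow_chart c) \<inter> (A \<times> UNIV)" and "z = snd (flow_chart c) (p, s)"
    by (auto simp: mem_flow_chart)
  then show "z \<in> snd (flow_chart c) ` (fst (flow_chart c) \<inter> (A \<times> UNIV))" by blast
qed (use S_chart_inv[OF c] in \<open>auto simp: flow_range_def mem_flow_chart\<close>)

text \<open>This is the openness of the flow domain in S x R. The neighbourhoods come from
  \<open>flow_twice_differentiable\<close>, and ultimately from the openness of \<open>V\<close> in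
  \<open>N\<close>.\<close>

lemma open_flow_range:
  assumes c: "c \<in> charts S"
  shows "open (flow_range c)"
  unfolding open_subopen[of "flow_range c"]
proof
  fix z assume "z \<in> flow_range c"
  then obtain p t where p: "p \<in> fst c" "z = (snd c p, t)" "(p, t) \<in> \<O>"
    using S_chart_inv[OF c] by (auto simp: flow_range_def)
  have cp: "c \<in> charts_at S p" using c p by (simp add: charts_at_def)
  obtain d where d: "d \<in> charts_at M (\<Phi> (p, t))"
    using charts_at_nonempty[OF M_atlas flow_in_M[OF p(3)]] by blast
  obtain B where B: "(snd c p, t) \<in> B"
    "\<And>y s. (y, s) \<in> B \<Longrightarrow> y \<in> snd c ` fst c \<and> (chart_inv c y, s) \<in> \<O> \<and> \<Phi> (chart_inv c y, s) \<in> fst d"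
    "twice_differentiable_on (\<lambda>(y, s). snd d (\<Phi> (chart_inv c y, s))) B"
    using flow_twice_differentiable[OF p(3) cp d] by blast
  then have "open B \<and> z \<in> B \<and> B \<subseteq> flow_range c"
    by (auto simp: p flow_range_def twice_differentiable_on_def)
  then show "\<exists>B. open B \<and> z \<in> B \<and> B \<subseteq> flow_range c" by blast
qed

lemma flow_range_mem: "(p, t) \<in> \<O> \<Longrightarrow> c \<in> charts_at S p \<Longrightarrow> (snd c p, t) \<in> flow_range c"
  by (auto simp: flow_range_def charts_at_def S_chart_inv)

lemma flow_chart_inj: "c \<in> charts S \<Longrightarrow> inj_on (snd (flow_chart c)) (fst (flow_chart c))"
  using smooth_manifold_charts(2)[OF S_manifold] by (fastforce simp: inj_on_def mem_flow_chart)

lemma flow_chart_inv: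
  assumes c: "c \<in> charts S" and y: "(y, s) \<in> flow_range c"
  shows "chart_inv (flow_chart c) (y, s) = (chart_inv c y, s)"
proof (rule inv_into_f_eq[OF flow_chart_inj[OF c]])
  show "(chart_inv c y, s) \<in> fst (flow_chart c)" "snd (flow_chart c) (chart_inv c y, s) = (y, s)"
    using y by (auto simp: mem_flow_chart flow_range_def inv_into_into f_inv_into_f)
qed

lemma eventually_flow_range:
  assumes "(p, t) \<in> \<O>" and "c \<in> charts_at S p"
  shows "\<forall>\<^sub>F z in nhds (snd c p, t). z \<in> flow_range c"
  using eventually_nhds_in_open[OF open_flow_range flow_range_mem[OF assms]] assms
  by (simp add: charts_at_def)

lemma flow_transition:
  assumes pt: "(p, t) \<in> \<O>" and c: "c \<in> charts_at S p" and d: "d \<in> charts_at S p"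
  shows "((snd (flow_chart d) \<circ> chart_inv (flow_chart c)) has_derivative
    (\<lambda>v. (transition_derivative c d p (fst v), snd v))) (at (snd c p, t))"
proof -
  have cc: "c \<in> charts S" using c by (simp add: charts_at_def)
  have "((snd d \<circ> chart_inv c) has_derivative transition_derivative c d p) (at (fst (snd c p, t)))"
    using has_chart_derivative_transition[OF S_atlas c d] by (simp add: has_chart_derivative_def o_def)
  from has_derivative_compose[OF bounded_linear_imp_has_derivative[OF bounded_linear_fst] this]
  have "((\<lambda>z. (snd d (chart_inv c (fst z)), snd z)) has_derivative
      (\<lambda>v. (transition_derivative c d p (fst v), snd v))) (at (snd c p, t))"
    by (intro has_derivative_Pair bounded_linear_imp_has_derivative[OF bounded_linear_snd]) (simp add: o_def)
  then show ?thesis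
    by (rule has_derivative_cong_eventually[rotated])
      (rule eventually_mono[OF eventually_flow_range[OF pt c]], auto simp: flow_chart_inv[OF cc])
qed

lemma F_atlas: "differentiable_atlas F"
  unfolding differentiable_atlas_def charts_F pts_F
proof (intro conjI ballI)
  fix c assume "c \<in> flow_chart ` charts S"
  then obtain c0 where c: "c = flow_chart c0" "c0 \<in> charts S" by blast
  show "inj_on (snd c) (fst c)" using c flow_chart_inj by blast
  show "open (snd c ` fst c)"
    using flow_chart_image[OF c(2), of UNIV] open_flow_range[OF c(2)] smooth_manifold_charts(3)[OF S_manifold c(2)]
    by (simp add: c(1) open_Int open_Times)
next
  show "(\<Union>c\<in>flow_chart ` charts S. fst c) = \<O>"
  proof -
    have "\<exists>c\<in>charts S. p \<in> fst c" if "(p, t) \<in> \<O>" for p t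
      using that charts_at_nonempty[OF S_atlas, of p] unfolding mem_O_iff charts_at_def by blast
    then show ?thesis by (fastforce simp: mem_flow_chart)
  qed
next
  fix c d z assume "c \<in> flow_chart ` charts S" "d \<in> flow_chart ` charts S"
  then obtain c0 d0 where c: "c = flow_chart c0" "c0 \<in> charts S"
    and d: "d = flow_chart d0" "d0 \<in> charts S" by blast
  have "fst c \<inter> fst d = fst c \<inter> (fst d0 \<times> UNIV)" by (auto simp: c d mem_flow_chart)
  then show "open (snd c ` (fst c \<inter> fst d))"
    using flow_chart_image[OF c(2), of "fst d0"] open_flow_range[OF c(2)] S_atlas c d
    by (simp add: open_Int open_Times differentiable_atlas_def)
  assume "z \<in> fst c \<inter> fst d"
  then obtain p t where z: "z = (p, t)" "(p, t) \<in> \<O>" "c0 \<in> charts_at S p" "d0 \<in> charts_at S p"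
    using c d by (cases z) (auto simp: mem_flow_chart charts_at_def)
  show "(snd d \<circ> chart_inv c) differentiable (at (snd c z))"
    using flow_transition[OF z(2-4)] unfolding c(1) d(1) z(1) flow_chart_apply differentiable_def by blast
qed

definition hyp_chart :: "('a, 's) chart \<Rightarrow> ('a, 's \<times> real) chart" where
  "hyp_chart c = image_chart \<Phi> F (flow_chart c)"

lemma inj_on_flow_F: "inj_on \<Phi> (pts F)"
  using inj_on_flow by (simp add: pts_F)

lemma H_eq: "H = image_mfd \<Phi> F"
  by (simp add: emanating_hypersurface_def)

lemma H_atlas: "differentiable_atlas H"
  unfolding H_eq by (rule differentiable_atlas_image_mfd[OF F_atlas inj_on_flow_F])

lemma pts_H: "pts H = \<Phi> ` \<O>"
  using pts_image_mfd[OF F_atlas inj_on_flow_F] by (simp add: H_eq pts_F)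

lemma charts_at_H:
  assumes "(p, t) \<in> \<O>"
  shows "charts_at H (\<Phi> (p, t)) = hyp_chart ` charts_at S p"
  using charts_at_image_mfd[OF F_atlas inj_on_flow_F, of "(p, t)"] assms
  by (simp add: H_eq pts_F charts_at_F hyp_chart_def image_image)

lemma hyp_chart_apply: "(p, t) \<in> \<O> \<Longrightarrow> snd (hyp_chart c) (\<Phi> (p, t)) = (snd c p, t)"
  using image_chart_apply[OF F_atlas inj_on_flow_F, of "(p, t)"] by (simp add: hyp_chart_def pts_F)

lemma hyp_chart_inv:
  assumes c: "c \<in> charts S" and y: "(y, s) \<in> flow_range c"
  shows "chart_inv (hyp_chart c) (y, s) = \<Phi> (chart_inv c y, s)"
proof -
  have "(y, s) \<in> snd (flow_chart c) ` fst (flow_chart c)"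
    using flow_chart_image[OF c, of UNIV] y by (auto simp: flow_range_def)
  then show ?thesis
    using image_chart_inv[OF F_atlas inj_on_flow_F, of "flow_chart c" "(y, s)"] c flow_chart_inv[OF c y]
    by (simp add: hyp_chart_def charts_F)
qed

lemma openin_H_chart:
  assumes "d \<in> charts H"
  shows "openin (mtop H) (fst d)"
proof -
  obtain c where c: "d = image_chart \<Phi> F (flow_chart c)" "c \<in> charts S"
    using assms by (auto simp: H_eq charts_image_mfd[OF F_atlas inj_on_flow_F] charts_F)
  have "openin (prod_topology (mtop S) euclideanreal) (fst c \<times> UNIV)"
    using smooth_manifold_charts(1)[OF S_manifold c(2)] by (simp add: openin_prod_Times_iff)
  then have "openin (mtop F) (fst (flow_chart c))"
    by (simp add: flow_mfd_def open_submfd_def product_line_def flow_chart_def openin_subtopology_Int)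
  then show ?thesis
    using openin_image_chart[OF F_atlas inj_on_flow_F] by (simp add: H_eq c(1))
qed

lemma inv_flow: "(p, t) \<in> \<O> \<Longrightarrow> inv_into \<O> \<Phi> (\<Phi> (p, t)) = (p, t)"
  using inj_on_flow by simp

section \<open>Maps between \<open>S\<close>, the flow domain, the hypersurface and
  \<open>M\<close>\<close>

text \<open>The source is all of \<open>S\<close>, although (q, t) may leave the flow domain away
  from \<open>p\<close>: a chart derivative sees only points near \<open>p\<close>. This permits
  \<open>S\<close> in place of the open slice.\<close>

lemma has_chart_derivative_slice:
  assumes pt: "(p, t) \<in> \<O>" and c: "c \<in> charts_at S p"
  shows "has_chart_derivative S F (\<lambda>q. (q, t)) p c (flow_chart c) (\<lambda>v. (v, 0))"
proof -
  have cc: "c \<in> charts S" using c by (simp add: charts_at_def)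
  have "open ((\<lambda>y. (y, t)) -` flow_range c)"
    by (intro open_vimage open_flow_range[OF cc] continuous_intros)
  then have "\<forall>\<^sub>F y in nhds (snd c p). y \<in> (\<lambda>y. (y, t)) -` flow_range c"
    using flow_range_mem[OF pt c] by (intro eventually_nhds_in_open) auto
  then have 1: "\<forall>\<^sub>F y in nhds (snd c p). (chart_inv c y, t) \<in> fst (flow_chart c)"
    by (rule eventually_mono) (auto simp: flow_range_def mem_flow_chart inv_into_into)
  have "((\<lambda>y. snd (flow_chart c) (chart_inv c y, t)) has_derivative (\<lambda>v. (v, 0))) (at (snd c p))"
  proof (rule has_derivative_cong_eventually[of "\<lambda>y. (y, t)"])
    show "\<forall>\<^sub>F y in nhds (snd c p). (y, t) = snd (flow_chart c) (chart_inv c y, t)"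
      using eventually_in_chart_overlap[OF S_atlas c c] by (rule eventually_mono) simp
    show "((\<lambda>y. (y, t)) has_derivative (\<lambda>v. (v, 0))) (at (snd c p))"
      by (intro has_derivative_Pair has_derivative_ident has_derivative_const)
  qed
  then show ?thesis
    using 1 c pt by (simp add: has_chart_derivative_def charts_at_F)
qed

lemma has_chart_derivative_fst:
  assumes pt: "(p, t) \<in> \<O>" and c: "c \<in> charts_at S p"
  shows "has_chart_derivative F S fst (p, t) (flow_chart c) c fst"
proof -
  have cc: "c \<in> charts S" using c by (simp add: charts_at_def)
  note ev = eventually_flow_range[OF pt c]
  have "((\<lambda>z. snd c (fst (chart_inv (flow_chart c) z))) has_derivative fst) (at (snd c p, t))"
  proof (rule has_derivative_cong_eventually[OF _ bounded_linear_imp_has_derivative[OF bounded_linear_fst]])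
    show "\<forall>\<^sub>F z in nhds (snd c p, t). fst z = snd c (fst (chart_inv (flow_chart c) z))"
      using ev by (rule eventually_mono) (auto simp: flow_chart_inv[OF cc] flow_range_def f_inv_into_f)
  qed
  moreover have "\<forall>\<^sub>F z in nhds (snd c p, t). fst (chart_inv (flow_chart c) z) \<in> fst c"
    using ev by (rule eventually_mono) (auto simp: flow_chart_inv[OF cc] flow_range_def inv_into_into)
  ultimately show ?thesis
    using c pt by (simp add: has_chart_derivative_def charts_at_F)
qed

text \<open>The flow in the coordinates of \<open>c\<close> and \<open>d\<close>. Its derivative in
  direction (0, 1) gives the components of U, and in direction (a, 0) those of the slice
  vectors.\<close>

definition flow_coord :: "('a, 's) chart \<Rightarrow> ('a, 'e) chart \<Rightarrow> 's \<times> real \<Rightarrow> 'e" where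
  "flow_coord c d = (\<lambda>(y, s). snd d (\<Phi> (chart_inv c y, s)))"

lemma flow_coord_apply: "p \<in> fst c \<Longrightarrow> c \<in> charts S \<Longrightarrow> flow_coord c d (snd c p, t) = snd d (\<Phi> (p, t))"
  by (simp add: flow_coord_def S_chart_inv)

lemma flow_coord_neighbourhood:
  assumes "(p, t) \<in> \<O>" and "c \<in> charts_at S p" and "d \<in> charts_at M (\<Phi> (p, t))"
  obtains B where "open B" "(snd c p, t) \<in> B" "B \<subseteq> flow_range c"
    "\<And>y s. (y, s) \<in> B \<Longrightarrow> \<Phi> (chart_inv c y, s) \<in> fst d"
    "twice_differentiable_on (flow_coord c d) B"
proof -
  obtain B where B: "(snd c p, t) \<in> B"
    "\<And>y s. (y, s) \<in> B \<Longrightarrow> y \<in> snd c ` fst c \<and> (chart_inv c y, s) \<in> \<O> \<and> \<Phi> (chart_inv c y, s) \<in> fst d"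
    "twice_differentiable_on (\<lambda>(y, s). snd d (\<Phi> (chart_inv c y, s))) B"
    using flow_twice_differentiable[OF assms] by blast
  show ?thesis
  proof (rule that[of B])
    show "open B" using B(3) by (simp add: twice_differentiable_on_def)
    show "B \<subseteq> flow_range c" using B(2) by (auto simp: flow_range_def)
    show "twice_differentiable_on (flow_coord c d) B" using B(3) by (simp add: flow_coord_def)
  qed (use B in auto)
qed

lemma has_chart_derivative_flow:
  assumes pt: "(p, t) \<in> \<O>" and c: "c \<in> charts_at S p" and d: "d \<in> charts_at M (\<Phi> (p, t))"
  shows "has_chart_derivative F M \<Phi> (p, t) (flow_chart c) d
    (frechet_derivative (flow_coord c d) (at (snd c p, t)))"
proof -
  have cc: "c \<in> charts S" using c by (simp add: charts_at_def)
  obtain B where B: "open B" "(snd c p, t) \<in> B" "B \<subseteq> flow_range c"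
    "\<And>y s. (y, s) \<in> B \<Longrightarrow> \<Phi> (chart_inv c y, s) \<in> fst d" "twice_differentiable_on (flow_coord c d) B"
    using flow_coord_neighbourhood[OF assms] by blast
  have ev: "\<forall>\<^sub>F z in nhds (snd c p, t). z \<in> B" using B(1,2) by (rule eventually_nhds_in_open)
  have "((\<lambda>z. snd d (\<Phi> (chart_inv (flow_chart c) z))) has_derivative
      frechet_derivative (flow_coord c d) (at (snd c p, t))) (at (snd c p, t))"
  proof (rule has_derivative_cong_eventually[OF _ twice_differentiable_onD(3)[OF B(5,2)]])
    show "\<forall>\<^sub>F z in nhds (snd c p, t). flow_coord c d z = snd d (\<Phi> (chart_inv (flow_chart c) z))"
      using ev
    proof (rule eventually_mono)
      fix z assume "z \<in> B"
      then have "(fst z, snd z) \<in> flow_range c" using B(3) by auto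
      from flow_chart_inv[OF cc this] show "flow_coord c d z = snd d (\<Phi> (chart_inv (flow_chart c) z))"
        by (simp add: flow_coord_def case_prod_beta')
    qed
  qed
  moreover have "\<forall>\<^sub>F z in nhds (snd c p, t). \<Phi> (chart_inv (flow_chart c) z) \<in> fst d"
    using ev
  proof (rule eventually_mono)
    fix z assume z: "z \<in> B"
    then have "(fst z, snd z) \<in> flow_range c" using B(3) by auto
    from flow_chart_inv[OF cc this] show "\<Phi> (chart_inv (flow_chart c) z) \<in> fst d"
      using B(4)[of "fst z" "snd z"] z by simp
  qed
  ultimately show ?thesis
    using c d pt by (simp add: has_chart_derivative_def charts_at_F)
qed

lemma has_chart_derivative_F_H:
  assumes pt: "(p, t) \<in> \<O>" and c: "c \<in> charts_at S p"
  shows "has_chart_derivative F H \<Phi> (p, t) (flow_chart c) (hyp_chart c) (\<lambda>v. v)"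
  using has_chart_derivative_to_image_mfd[OF F_atlas inj_on_flow_F, of "flow_chart c" "(p, t)"] pt c
  by (simp add: H_eq hyp_chart_def charts_at_F)

lemma has_chart_derivative_H_M:
  assumes "(p, t) \<in> \<O>" and "c \<in> charts_at S p" and "d \<in> charts_at M (\<Phi> (p, t))"
  shows "has_chart_derivative H M (\<lambda>x. x) (\<Phi> (p, t)) (hyp_chart c) d
    (frechet_derivative (flow_coord c d) (at (snd c p, t)))"
  using has_chart_derivative_from_image_mfd[OF F_atlas inj_on_flow_F has_chart_derivative_flow[OF assms],
      of "\<lambda>x. x"] by (simp add: H_eq hyp_chart_def)

lemma has_chart_derivative_S_H:
  assumes "(p, t) \<in> \<O>" and "c \<in> charts_at S p"
  shows "has_chart_derivative S H (\<lambda>q. \<Phi> (q, t)) p c (hyp_chart c) (\<lambda>v. (v, 0))"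
  using has_chart_derivative_compose[OF S_atlas F_atlas has_chart_derivative_slice[OF assms]
      has_chart_derivative_F_H[OF assms]] .

lemma has_chart_derivative_S_M:
  assumes "(p, t) \<in> \<O>" and "c \<in> charts_at S p" and "d \<in> charts_at M (\<Phi> (p, t))"
  shows "has_chart_derivative S M (\<lambda>q. \<Phi> (q, t)) p c d
    (\<lambda>v. frechet_derivative (flow_coord c d) (at (snd c p, t)) (v, 0))"
  using has_chart_derivative_compose[OF S_atlas F_atlas has_chart_derivative_slice[OF assms(1,2)]
      has_chart_derivative_flow[OF assms]] .

lemma flow_projection_flow: "(p, t) \<in> \<O> \<Longrightarrow> flow_projection \<Phi> \<O> (\<Phi> (p, t)) = p"
  by (simp add: flow_projection_def inv_flow)

lemma has_chart_derivative_projection: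
  assumes "(p, t) \<in> \<O>" and "c \<in> charts_at S p"
  shows "has_chart_derivative H S (flow_projection \<Phi> \<O>) (\<Phi> (p, t)) (hyp_chart c) c fst"
  using has_chart_derivative_from_image_mfd[OF F_atlas inj_on_flow_F has_chart_derivative_fst[OF assms],
      of "flow_projection \<Phi> \<O>"] flow_projection_flow
  by (auto simp: H_eq hyp_chart_def pts_F)

lemma S_chart_exists: "(p, t) \<in> \<O> \<Longrightarrow> \<exists>c. c \<in> charts_at S p"
  using charts_at_nonempty[OF S_atlas] by (simp add: mem_O_iff)

lemma M_chart_exists: "(p, t) \<in> \<O> \<Longrightarrow> \<exists>d. d \<in> charts_at M (\<Phi> (p, t))"
  using charts_at_nonempty[OF M_atlas] flow_in_M by blast

text \<open>The definition works on the open submanifold of those \<open>q\<close> with (q, t) in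
  the flow domain. Near \<open>p\<close> its charts invert in the same way as those of
  \<open>S\<close>, so both descriptions give exactly the vectors with components (a, 0) in
  \<open>hyp_chart c\<close>.\<close>

lemma screen_distribution_eq:
  assumes pt: "(p, t) \<in> \<O>"
  shows "screen_distribution \<Phi> \<O> S (\<Phi> (p, t)) = differential S H (\<lambda>q. \<Phi> (q, t)) p ` tangent_space S p"
proof -
  define W where "W = {q. (q, t) \<in> \<O>}"
  define Y where "Y = open_submfd S W"
  obtain c where c: "c \<in> charts_at S p" using S_chart_exists[OF pt] by blast
  have cc: "c \<in> charts S" "p \<in> fst c" using c by (auto simp: charts_at_def)
  have pW: "p \<in> W" using pt by (simp add: W_def)
  define r where "r = (\<lambda>c :: ('a, 's) chart. (fst c \<inter> W, snd c))"
  have chY: "charts Y = r ` charts S" by (simp add: Y_def open_submfd_def r_def)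
  have chatY: "charts_at Y p = r ` charts_at S p" using pW by (auto simp: charts_at_def chY r_def)
  have W_open: "open (snd e ` (fst e \<inter> W))" if e: "e \<in> charts S" for e
  proof -
    have "snd e ` (fst e \<inter> W) = (\<lambda>y. (y, t)) -` flow_range e"
      using S_chart_inv[OF e] by (force simp: W_def flow_range_def)
    then show ?thesis
      using open_flow_range[OF e] by (simp only:) (intro open_vimage continuous_intros)
  qed
  have inj: "inj_on (snd e) (fst e)" if "e \<in> charts S" for e
    using smooth_manifold_charts(2)[OF S_manifold that] .
  have r_inv: "chart_inv (r e) (snd e q) = q" if "e \<in> charts S" "q \<in> fst e" "q \<in> W" for e q
    using inj[OF that(1)] that by (intro inv_into_f_eq) (auto simp: r_def intro: inj_on_subset)
  have ev: "\<forall>\<^sub>F y in nhds (snd e q). y \<in> snd e ` (fst e \<inter> W)" if "e \<in> charts S" "q \<in> fst e" "q \<in> W" for e q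
    using W_open[OF that(1)] that by (intro eventually_nhds_in_open) auto
  have eq: "\<forall>\<^sub>F y in nhds (snd e q). chart_inv (r e) y = chart_inv e y" if "e \<in> charts S" "q \<in> fst e" "q \<in> W" for e q
    using ev[OF that] by (rule eventually_mono) (use r_inv[OF that(1)] S_chart_inv[OF that(1)] in auto)
  have Y: "differentiable_atlas Y"
    unfolding differentiable_atlas_def chY
  proof (intro conjI ballI)
    fix c assume "c \<in> r ` charts S"
    then obtain e where e: "c = r e" "e \<in> charts S" by blast
    show "inj_on (snd c) (fst c)" using inj[OF e(2)] by (auto simp: e r_def intro: inj_on_subset)
    show "open (snd c ` fst c)" using W_open[OF e(2)] by (simp add: e r_def)
  next
    show "(\<Union>c\<in>r ` charts S. fst c) = pts Y"
      using S_atlas by (auto simp: r_def Y_def open_submfd_def differentiable_atlas_def)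
  next
    fix c d q assume "c \<in> r ` charts S" "d \<in> r ` charts S"
    then obtain e f where e: "c = r e" "e \<in> charts S" and f: "d = r f" "f \<in> charts S" by blast
    have "snd c ` (fst c \<inter> fst d) = snd e ` (fst e \<inter> fst f) \<inter> snd e ` (fst e \<inter> W)"
      using inj_on_image_Int[OF inj[OF e(2)], of "fst e \<inter> fst f" "fst e \<inter> W"]
      by (simp add: e f r_def Int_ac)
    then show "open (snd c ` (fst c \<inter> fst d))"
      using W_open[OF e(2)] S_atlas e f by (simp add: open_Int differentiable_atlas_def)
    assume q: "q \<in> fst c \<inter> fst d"
    then have q': "q \<in> fst e" "q \<in> fst f" "q \<in> W" by (auto simp: e f r_def)
    have "(snd f \<circ> chart_inv e) differentiable (at (snd e q))"
      using S_atlas e f q' unfolding differentiable_atlas_def by blast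
    then have "(snd d \<circ> chart_inv c) differentiable (at (snd e q))"
      by (rule differentiable_cong_eventually[rotated])
        (use eq[OF e(2) q'(1,3)] in \<open>auto simp: e f r_def elim: eventually_mono\<close>)
    then show "(snd d \<circ> chart_inv c) differentiable (at (snd c q))" by (simp add: e r_def)
  qed
  have YF: "has_chart_derivative Y F (\<lambda>q. (q, t)) p (r c) (flow_chart c) (\<lambda>v. (v, 0))"
  proof -
    have sl: "(\<forall>\<^sub>F x in nhds (snd c p). (chart_inv c x, t) \<in> fst (flow_chart c))"
      "((\<lambda>x. snd (flow_chart c) (chart_inv c x, t)) has_derivative (\<lambda>v. (v, 0))) (at (snd c p))"
      using has_chart_derivative_slice[OF pt c] by (auto simp: has_chart_derivative_def)
    note eqc = eq[OF cc pW]
    have "((\<lambda>x. snd (flow_chart c) (chart_inv (r c) x, t)) has_derivative (\<lambda>v. (v, 0))) (at (snd c p))"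
      by (rule has_derivative_cong_eventually[OF _ sl(2)]) (use eqc in \<open>auto elim: eventually_mono\<close>)
    moreover have "\<forall>\<^sub>F x in nhds (snd c p). (chart_inv (r c) x, t) \<in> fst (flow_chart c)"
      using sl(1) eqc by eventually_elim simp
    moreover have "snd (r c) = snd c" by (simp add: r_def)
    ultimately show ?thesis
      using c pt unfolding has_chart_derivative_def charts_at_F[OF pt] chatY by simp
  qed
  have rc: "r c \<in> charts_at Y p" using c chatY by blast
  have hc: "hyp_chart c \<in> charts_at H (\<Phi> (p, t))" using c charts_at_H[OF pt] by blast
  have YH: "differential F H \<Phi> (p, t) (differential Y F (\<lambda>q. (q, t)) p w) =
      tangent_of_components H (hyp_chart c) (\<Phi> (p, t)) (w (r c), 0)" if w: "w \<in> tangent_space Y p" for w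
  proof -
    have "differential F H \<Phi> (p, t) (differential Y F (\<lambda>q. (q, t)) p w) =
        differential Y H (\<lambda>q. \<Phi> (q, t)) p w"
      using differential_compose[OF Y F_atlas H_atlas mfd_differentiableI[OF YF]
          mfd_differentiableI[OF has_chart_derivative_F_H[OF pt c]] w] .
    also have "\<dots> = tangent_of_components H (hyp_chart c) (\<Phi> (p, t)) (w (r c), 0)"
      using differential_eq[OF Y H_atlas has_chart_derivative_compose[OF Y F_atlas YF
            has_chart_derivative_F_H[OF pt c]] w] .
    finally show ?thesis .
  qed
  have SH: "differential S H (\<lambda>q. \<Phi> (q, t)) p w =
      tangent_of_components H (hyp_chart c) (\<Phi> (p, t)) (w c, 0)" if w: "w \<in> tangent_space S p" for w
    using differential_eq[OF S_atlas H_atlas has_chart_derivative_S_H[OF pt c] w] .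
  have "screen_distribution \<Phi> \<O> S (\<Phi> (p, t)) =
      (\<lambda>w. differential F H \<Phi> (p, t) (differential Y F (\<lambda>q. (q, t)) p w)) ` tangent_space Y p"
    by (simp add: screen_distribution_def inv_flow[OF pt] Y_def W_def Let_def)
  also have "\<dots> = (\<lambda>w. tangent_of_components H (hyp_chart c) (\<Phi> (p, t)) (w (r c), 0)) ` tangent_space Y p"
    using YH by (rule image_cong[OF refl])
  also have "\<dots> = range (\<lambda>a. tangent_of_components H (hyp_chart c) (\<Phi> (p, t)) (a, 0))"
  proof (intro equalityI subsetI)
    fix x assume "x \<in> range (\<lambda>a. tangent_of_components H (hyp_chart c) (\<Phi> (p, t)) (a, 0))"
    then obtain a where "x = tangent_of_components H (hyp_chart c) (\<Phi> (p, t)) (a, 0)" by blast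
    then show "x \<in> (\<lambda>w. tangent_of_components H (hyp_chart c) (\<Phi> (p, t)) (w (r c), 0)) ` tangent_space Y p"
      using tangent_of_components_self[OF Y rc, of a] tangent_of_components_in_tangent_space[OF Y rc, of a]
      by (intro image_eqI[of _ _ "tangent_of_components Y (r c) p a"]) auto
  qed auto
  also have "\<dots> = (\<lambda>w. tangent_of_components H (hyp_chart c) (\<Phi> (p, t)) (w c, 0)) ` tangent_space S p"
  proof (intro equalityI subsetI)
    fix x assume "x \<in> range (\<lambda>a. tangent_of_components H (hyp_chart c) (\<Phi> (p, t)) (a, 0))"
    then obtain a where "x = tangent_of_components H (hyp_chart c) (\<Phi> (p, t)) (a, 0)" by blast
    then show "x \<in> (\<lambda>w. tangent_of_components H (hyp_chart c) (\<Phi> (p, t)) (w c, 0)) ` tangent_space S p"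
      using tangent_of_components_self[OF S_atlas c, of a] tangent_of_components_in_tangent_space[OF S_atlas c, of a]
      by (intro image_eqI[of _ _ "tangent_of_components S c p a"]) auto
  qed auto
  also have "\<dots> = differential S H (\<lambda>q. \<Phi> (q, t)) p ` tangent_space S p"
    using SH by (rule image_cong[OF refl, symmetric])
  finally show ?thesis .
qed

end

section \<open>The metric along the generators\<close>

context normal_exponential
begin

abbreviation U :: "'a \<Rightarrow> ('a, 's \<times> real) tvec" where "U \<equiv> generator_field \<Phi> \<O> S"

lemma generator_component:
  assumes pt: "(p, t) \<in> \<O>" and c: "c \<in> charts_at S p" and d: "d \<in> charts_at M (\<Phi> (p, t))"
  shows "differential H M (\<lambda>x. x) (\<Phi> (p, t)) (U (\<Phi> (p, t))) d =
    frechet_derivative (flow_coord c d) (at (snd c p, t)) (0, 1)"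
proof -
  define v where "v = velocity F (\<lambda>s. (p, s)) t"
  \<comment> \<open>The vertical line through \<open>p\<close> has velocity (0, 1) in every flow
    chart, whatever the chart of \<open>S\<close>.\<close>
  have vel: "v (flow_chart e) = (0, 1)" if e: "e \<in> charts_at S p" for e
  proof -
    have "((\<lambda>s. (snd e p, s)) has_vector_derivative (0, 1)) (at t)"
      by (auto simp: has_vector_derivative_def intro!: derivative_eq_intros)
    then have "vector_derivative (snd (flow_chart e) \<circ> (\<lambda>s. (p, s))) (at t) = (0, 1)"
      by (simp add: o_def vector_derivative_at)
    then show ?thesis
      using e by (simp add: v_def velocity_def charts_at_F[OF pt])
  qed
  have v: "v \<in> tangent_space F (p, t)"
    unfolding tangent_space_def
  proof (intro CollectI conjI ballI allI impI)
    fix a b assume "a \<in> charts_at F (p, t)" "b \<in> charts_at F (p, t)"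
    then obtain a0 b0 where a: "a = flow_chart a0" "a0 \<in> charts_at S p"
      and b: "b = flow_chart b0" "b0 \<in> charts_at S p" by (auto simp: charts_at_F[OF pt])
    show "v b = transition_derivative a b (p, t) (v a)"
      using frechet_derivative_eqI[OF flow_transition[OF pt a(2) b(2)]] vel[OF a(2)] vel[OF b(2)]
        linear_0[OF transition_derivative_linear[OF S_atlas a(2) b(2)]]
      by (simp add: a(1) b(1))
  qed (simp add: v_def velocity_def)
  have "differential H M (\<lambda>x. x) (\<Phi> (p, t)) (U (\<Phi> (p, t))) = differential F M \<Phi> (p, t) v"
    using differential_compose[OF F_atlas H_atlas M_atlas
        mfd_differentiableI[OF has_chart_derivative_F_H[OF pt c]]
        mfd_differentiableI[OF has_chart_derivative_H_M[OF pt c d]] v]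
    by (simp add: generator_field_def inv_flow[OF pt] v_def)
  then show ?thesis
    using differential_component[OF F_atlas M_atlas has_chart_derivative_flow[OF pt c d] v] vel[OF c]
    by simp
qed

abbreviation nabla_U :: "'a \<Rightarrow> ('a, 's \<times> real) tvec \<Rightarrow> ('a, 'e) tvec" where
  "nabla_U \<equiv> covariant_derivative H M \<Gamma> (\<lambda>y. differential H M (\<lambda>z. z) y (U y))"

text \<open>\<open>covariant_derivative\<close> works in the chart chosen by
  \<open>chart_at\<close>, and the premise \<open>ch\<close> names the chart of \<open>S\<close>
  behind it. Since U is the time derivative of the flow, second derivatives of
  \<open>flow_coord\<close> appear.\<close>

lemma nabla_U_component:
  assumes pt: "(p, t) \<in> \<O>" and c: "c \<in> charts_at S p" and ch: "chart_at H (\<Phi> (p, t)) = hyp_chart c"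
    and d: "d \<in> charts_at M (\<Phi> (p, t))" and X: "X \<in> tangent_space H (\<Phi> (p, t))"
  shows "nabla_U (\<Phi> (p, t)) X d =
    frechet_derivative (\<lambda>z. frechet_derivative (flow_coord c d) (at z) (0, 1)) (at (snd c p, t)) (X (hyp_chart c)) +
    \<Gamma> d (\<Phi> (p, t)) (frechet_derivative (flow_coord c d) (at (snd c p, t)) (X (hyp_chart c)))
      (frechet_derivative (flow_coord c d) (at (snd c p, t)) (0, 1))"
proof -
  have cc: "c \<in> charts S" using c by (simp add: charts_at_def)
  obtain B where B: "open B" "(snd c p, t) \<in> B" "B \<subseteq> flow_range c"
    "\<And>y s. (y, s) \<in> B \<Longrightarrow> \<Phi> (chart_inv c y, s) \<in> fst d" "twice_differentiable_on (flow_coord c d) B"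
    using flow_coord_neighbourhood[OF pt c d] by blast
  have eq: "differential H M (\<lambda>z. z) (chart_inv (hyp_chart c) z) (U (chart_inv (hyp_chart c) z)) d =
      frechet_derivative (flow_coord c d) (at z) (0, 1)" if z: "z \<in> B" for z
  proof -
    obtain y s where ys: "z = (y, s)" by (cases z)
    have r: "(y, s) \<in> flow_range c" using z B(3) ys by auto
    then have q: "chart_inv c y \<in> fst c" "(chart_inv c y, s) \<in> \<O>" "snd c (chart_inv c y) = y"
      by (auto simp: flow_range_def inv_into_into f_inv_into_f)
    have "c \<in> charts_at S (chart_inv c y)" using cc q by (simp add: charts_at_def)
    moreover have "d \<in> charts_at M (\<Phi> (chart_inv c y, s))"
      using d B(4)[of y s] z by (simp add: charts_at_def ys)
    ultimately show ?thesis
      using generator_component[OF q(2), of c d] by (simp add: ys hyp_chart_inv[OF cc r] q(3))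
  qed
  have "\<forall>\<^sub>F z in nhds (snd c p, t). z \<in> B" using B(1,2) by (rule eventually_nhds_in_open)
  then have "\<forall>\<^sub>F z in nhds (snd c p, t).
      differential H M (\<lambda>z. z) (chart_inv (hyp_chart c) z) (U (chart_inv (hyp_chart c) z)) d =
      frechet_derivative (flow_coord c d) (at z) (0, 1)"
    by (rule eventually_mono) (rule eq)
  from frechet_derivative_cong_eventually[OF this]
  have 1: "frechet_derivative (\<lambda>z. differential H M (\<lambda>z. z) (chart_inv (hyp_chart c) z) (U (chart_inv (hyp_chart c) z)) d)
      (at (snd c p, t)) = frechet_derivative (\<lambda>z. frechet_derivative (flow_coord c d) (at z) (0, 1)) (at (snd c p, t))" .
  show ?thesis
    using d differential_component[OF H_atlas M_atlas has_chart_derivative_H_M[OF pt c d] X]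
      generator_component[OF pt c d] 1
    by (simp add: covariant_derivative_def Let_def ch hyp_chart_apply[OF pt])
qed

lemma chart_at_H:
  assumes pt: "(p, t) \<in> \<O>"
  obtains c where "c \<in> charts_at S p" "chart_at H (\<Phi> (p, t)) = hyp_chart c"
proof -
  have "\<Phi> (p, t) \<in> pts H" using pt by (auto simp: pts_H)
  from chart_at_in_charts_at[OF H_atlas this] show ?thesis
    using that by (auto simp: charts_at_H[OF pt])
qed

text \<open>The second derivative of the chart transition in the transformation law of the connection
  is cancelled by the one that arises from differentiating the components of \<open>U\<close>.\<close>

lemma nabla_U_in_tangent_space:
  assumes pt: "(p, t) \<in> \<O>" and X: "X \<in> tangent_space H (\<Phi> (p, t))"
  shows "nabla_U (\<Phi> (p, t)) X \<in> tangent_space M (\<Phi> (p, t))"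
  unfolding tangent_space_def
proof (intro CollectI conjI ballI allI impI)
  obtain c where c: "c \<in> charts_at S p" "chart_at H (\<Phi> (p, t)) = hyp_chart c"
    using chart_at_H[OF pt] by blast
  have cc: "c \<in> charts S" "p \<in> fst c" using c(1) by (auto simp: charts_at_def)
  fix d e assume d: "d \<in> charts_at M (\<Phi> (p, t))" and e: "e \<in> charts_at M (\<Phi> (p, t))"
  then have dd: "d \<in> charts M" "\<Phi> (p, t) \<in> fst d" and ee: "e \<in> charts M" "\<Phi> (p, t) \<in> fst e"
    by (auto simp: charts_at_def)
  obtain B where B: "open B" "(snd c p, t) \<in> B" "B \<subseteq> flow_range c"
    "\<And>y s. (y, s) \<in> B \<Longrightarrow> \<Phi> (chart_inv c y, s) \<in> fst d" "twice_differentiable_on (flow_coord c d) B"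
    using flow_coord_neighbourhood[OF pt c(1) d] by blast
  obtain C where C: "open C" "(snd c p, t) \<in> C" "C \<subseteq> flow_range c"
    "\<And>y s. (y, s) \<in> C \<Longrightarrow> \<Phi> (chart_inv c y, s) \<in> fst e" "twice_differentiable_on (flow_coord c e) C"
    using flow_coord_neighbourhood[OF pt c(1) e] by blast
  define z0 where "z0 = (snd c p, t)"
  define \<phi> where "\<phi> = flow_coord c d"
  define h where "h = snd e \<circ> chart_inv d"
  define A where "A = snd d ` (fst d \<inter> fst e)"
  have A: "open A" using M_atlas dd ee unfolding differentiable_atlas_def A_def by blast
  have "smooth_on h A" using M_manifold dd ee unfolding smooth_manifold_def h_def A_def by blast
  then have h: "twice_differentiable_on h A" using A by (rule smooth_on_imp_twice_differentiable_on)
  have z0: "z0 \<in> B \<inter> C" using B C by (simp add: z0_def)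
  have ev: "\<forall>\<^sub>F z in nhds z0. z \<in> B \<inter> C" using B C z0 by (intro eventually_nhds_in_open) auto
  have \<phi>A: "\<phi> z \<in> A" and eqh: "flow_coord c e z = h (\<phi> z)" if "z \<in> B \<inter> C" for z
  proof -
    have "\<Phi> (chart_inv c (fst z), snd z) \<in> fst d \<inter> fst e"
      using that B(4)[of "fst z" "snd z"] C(4)[of "fst z" "snd z"] by auto
    then show "\<phi> z \<in> A" "flow_coord c e z = h (\<phi> z)"
      using chart_inv_chart[OF M_atlas dd(1)] by (auto simp: \<phi>_def flow_coord_def A_def h_def case_prod_beta')
  qed
  have \<phi>0: "\<phi> z0 = snd d (\<Phi> (p, t))"
    using flow_coord_apply[OF cc(2,1)] by (simp add: \<phi>_def z0_def)
  have \<phi>2: "twice_differentiable_on \<phi> B" using B(5) by (simp add: \<phi>_def)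
  define k where "k = X (hyp_chart c)"
  define u where "u = frechet_derivative \<phi> (at z0) k"
  define V0 where "V0 = frechet_derivative \<phi> (at z0) (0, 1)"
  define w where "w z = frechet_derivative \<phi> (at z) (0, 1)" for z
  have De: "frechet_derivative (flow_coord c e) (at z) v = frechet_derivative h (at (\<phi> z)) (frechet_derivative \<phi> (at z) v)"
    if z: "z \<in> B \<inter> C" for z v
  proof -
    have "\<forall>\<^sub>F y in nhds z. y \<in> B \<inter> C" using B C z by (intro eventually_nhds_in_open) auto
    then have "\<forall>\<^sub>F y in nhds z. flow_coord c e y = h (\<phi> y)" by (rule eventually_mono) (rule eqh)
    from frechet_derivative_cong_eventually[OF this] show ?thesis
      using frechet_derivative_comp[of h \<phi> z v] twice_differentiable_onD(1)[OF h \<phi>A[OF z]]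
        twice_differentiable_onD(1)[OF \<phi>2] z by auto
  qed
  have "\<forall>\<^sub>F z in nhds z0. frechet_derivative (flow_coord c e) (at z) (0, 1) = frechet_derivative h (at (\<phi> z)) (w z)"
    using ev by (rule eventually_mono) (simp add: De w_def)
  note cong = frechet_derivative_cong_eventually[OF this]
  have \<phi>z0: "\<phi> z0 \<in> A" and z0B: "z0 \<in> B" using z0 \<phi>A by auto
  have lin: "\<forall>\<^sub>F z in nhds z0. linear (frechet_derivative h (at (\<phi> z)))"
    using ev by (rule eventually_mono) (use \<phi>A twice_differentiable_onD(4)[OF h] in blast)
  have K: "(\<lambda>z. frechet_derivative h (at (\<phi> z)) v) differentiable (at z0)" for v
    using differentiable_chain_at[OF twice_differentiable_onD(1)[OF \<phi>2 z0B] twice_differentiable_onD(2)[OF h \<phi>z0]]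
    by (simp add: o_def)
  have w: "(w has_derivative frechet_derivative w (at z0)) (at z0)"
    using twice_differentiable_onD(2)[OF \<phi>2 z0B] frechet_derivative_works unfolding w_def by blast
  \<comment> \<open>The product rule separates the second derivative of the transition
    \<open>h\<close>, with the components of U frozen at \<open>z0\<close>, from the derivative of
    those components.\<close>
  have "frechet_derivative (\<lambda>z. frechet_derivative h (at (\<phi> z)) (w z)) (at z0) k =
      frechet_derivative (\<lambda>z. frechet_derivative h (at (\<phi> z)) (w z0)) (at z0) k
        + frechet_derivative h (at (\<phi> z0)) (frechet_derivative w (at z0) k)"
    using frechet_derivative_eqI[OF has_derivative_linear_family[OF lin K w]] by simp
  also have "frechet_derivative (\<lambda>z. frechet_derivative h (at (\<phi> z)) (w z0)) (at z0) k =
      frechet_derivative (\<lambda>y. frechet_derivative h (at y) V0) (at (\<phi> z0)) u"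
    using frechet_derivative_comp[of "\<lambda>y. frechet_derivative h (at y) V0" \<phi> z0 k]
      twice_differentiable_onD(2)[OF h \<phi>z0] twice_differentiable_onD(1)[OF \<phi>2 z0B]
    by (simp add: w_def V0_def u_def)
  finally have D2: "frechet_derivative (\<lambda>z. frechet_derivative (flow_coord c e) (at z) (0, 1)) (at z0) k =
      frechet_derivative (\<lambda>y. frechet_derivative h (at y) V0) (at (\<phi> z0)) u +
      frechet_derivative h (at (\<phi> z0)) (frechet_derivative w (at z0) k)"
    by (simp add: cong)
  have "affine_connection M \<Gamma>" using levi_civita by (simp add: levi_civita_def)
  then have tr: "frechet_derivative h (at (\<phi> z0)) (\<Gamma> d (\<Phi> (p, t)) u V0) =
      \<Gamma> e (\<Phi> (p, t)) (frechet_derivative h (at (\<phi> z0)) u) (frechet_derivative h (at (\<phi> z0)) V0) +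
      frechet_derivative (\<lambda>x. frechet_derivative h (at x) V0) (at (\<phi> z0)) u"
    using dd ee unfolding affine_connection_def Let_def h_def \<phi>0 by blast
  have linh: "linear (frechet_derivative h (at (\<phi> z0)))" using twice_differentiable_onD(4)[OF h \<phi>z0] .
  have "nabla_U (\<Phi> (p, t)) X e = frechet_derivative (\<lambda>y. frechet_derivative h (at y) V0) (at (\<phi> z0)) u +
      frechet_derivative h (at (\<phi> z0)) (frechet_derivative w (at z0) k) +
      \<Gamma> e (\<Phi> (p, t)) (frechet_derivative h (at (\<phi> z0)) u) (frechet_derivative h (at (\<phi> z0)) V0)"
    using nabla_U_component[OF pt c e X] De[OF z0] D2
    unfolding z0_def[symmetric] k_def[symmetric] u_def V0_def by simp
  also have "\<dots> = frechet_derivative h (at (\<phi> z0)) (frechet_derivative w (at z0) k + \<Gamma> d (\<Phi> (p, t)) u V0)"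
    using tr by (simp add: linear_add[OF linh])
  also have "frechet_derivative w (at z0) k + \<Gamma> d (\<Phi> (p, t)) u V0 = nabla_U (\<Phi> (p, t)) X d"
    using nabla_U_component[OF pt c d X]
    unfolding z0_def[symmetric] k_def[symmetric] \<phi>_def[symmetric] u_def V0_def w_def by simp
  finally show "nabla_U (\<Phi> (p, t)) X e = transition_derivative d e (\<Phi> (p, t)) (nabla_U (\<Phi> (p, t)) X d)"
    unfolding h_def \<phi>0 .
qed (simp add: covariant_derivative_def)

abbreviation slice_differential :: "real \<Rightarrow> 'a \<Rightarrow> ('a, 's) tvec \<Rightarrow> ('a, 'e) tvec" where
  "slice_differential t \<equiv> differential S M (\<lambda>q. \<Phi> (q, t))"

lemma slice_differential_zero:
  assumes p: "p \<in> pts S" and w: "w \<in> tangent_space S p"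
  shows "slice_differential 0 p w = differential S M (\<lambda>q. q) p w"
  by (rule differential_cong[OF S_atlas M_atlas inclusion_differentiable[OF p] w, symmetric])
    (simp add: flow_zero)

text \<open>The vectors lie in varying tangent spaces. The function of \<open>s\<close> is therefore
  first written in one chart \<open>d\<close> that is valid for all \<open>s\<close> near
  \<open>t\<close>, and only then differentiated.\<close>

lemma metric_derivative_along_generator:
  assumes tg: "totally_geodesic M g \<Gamma> H U" and pt: "(p, t) \<in> \<O>"
    and w1: "w1 \<in> tangent_space S p" and w2: "w2 \<in> tangent_space S p"
  shows "((\<lambda>s. g (\<Phi> (p, s)) (slice_differential s p w1) (slice_differential s p w2)) has_derivative (\<lambda>_. 0)) (at t)"
proof -
  obtain c where c: "c \<in> charts_at S p" "chart_at H (\<Phi> (p, t)) = hyp_chart c"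
    using chart_at_H[OF pt] by blast
  have cc: "c \<in> charts S" "p \<in> fst c" using c(1) by (auto simp: charts_at_def)
  obtain d where d: "d \<in> charts_at M (\<Phi> (p, t))" using M_chart_exists[OF pt] by blast
  then have dd: "d \<in> charts M" "\<Phi> (p, t) \<in> fst d" by (auto simp: charts_at_def)
  obtain B where B: "open B" "(snd c p, t) \<in> B" "B \<subseteq> flow_range c"
    "\<And>y s. (y, s) \<in> B \<Longrightarrow> \<Phi> (chart_inv c y, s) \<in> fst d" "twice_differentiable_on (flow_coord c d) B"
    using flow_coord_neighbourhood[OF pt c(1) d] by blast
  define \<phi> where "\<phi> = flow_coord c d"
  have \<phi>2: "twice_differentiable_on \<phi> B" using B(5) by (simp add: \<phi>_def)
  \<comment> \<open>\<open>x s\<close> is the generator through \<open>p\<close> in the chart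
    \<open>d\<close>, \<open>W a s\<close> holds the components of the slice vector with parameter
    \<open>a\<close>, and \<open>G\<close> the metric coefficients as functions of the
    coordinates.\<close>
  define z where "z s = (snd c p, s)" for s :: real
  define x where "x s = \<phi> (z s)" for s
  define W where "W a s = frechet_derivative \<phi> (at (z s)) (a, 0)" for a s
  define G where "G y = metric_components M g d (chart_inv d y)" for y
  have zt: "z t \<in> B" using B(2) by (simp add: z_def)
  have x_eq: "x s = snd d (\<Phi> (p, s))" for s
    using flow_coord_apply[OF cc(2,1)] by (simp add: x_def \<phi>_def z_def)
  have "open (z -` B)" unfolding z_def by (intro open_vimage B(1) continuous_intros)
  then have ev: "\<forall>\<^sub>F s in nhds t. s \<in> z -` B" using zt by (intro eventually_nhds_in_open) auto
  have near: "(p, s) \<in> \<O>" "d \<in> charts_at M (\<Phi> (p, s))" if "s \<in> z -` B" for s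
  proof -
    have s: "(snd c p, s) \<in> B" using that by (simp add: z_def)
    then show "(p, s) \<in> \<O>" using B(3) S_chart_inv[OF cc] by (auto simp: flow_range_def)
    show "d \<in> charts_at M (\<Phi> (p, s))" using B(4)[OF s] S_chart_inv[OF cc] dd by (simp add: charts_at_def)
  qed
  have comp: "slice_differential s p w d = W (w c) s" "slice_differential s p w \<in> tangent_space M (\<Phi> (p, s))"
    if s: "s \<in> z -` B" and w: "w \<in> tangent_space S p" for s w
  proof -
    note D = has_chart_derivative_S_M[OF near(1)[OF s] c(1) near(2)[OF s]]
    show "slice_differential s p w d = W (w c) s"
      using differential_component[OF S_atlas M_atlas D w] by (simp add: W_def \<phi>_def z_def)
    show "slice_differential s p w \<in> tangent_space M (\<Phi> (p, s))"
      using differential_in_tangent_space[OF S_atlas M_atlas mfd_differentiableI[OF D] w] .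
  qed
  have xinv: "chart_inv d (x s) = \<Phi> (p, s)" if "s \<in> z -` B" for s
    using near(2)[OF that] chart_inv_chart[OF M_atlas dd(1)] by (simp add: x_eq charts_at_def)
  have local: "g (\<Phi> (p, s)) (slice_differential s p w1) (slice_differential s p w2) = G (x s) (W (w1 c) s) (W (w2 c) s)"
    if s: "s \<in> z -` B" for s
    using metric_eq_components[OF comp(2)[OF s w1] comp(2)[OF s w2] near(2)[OF s], of g]
    by (simp add: comp(1)[OF s] w1 w2 G_def xinv[OF s])
  define V0 where "V0 = frechet_derivative \<phi> (at (z t)) (0, 1)"
  have z': "(z has_derivative (\<lambda>h. h *\<^sub>R (0, 1))) (at s)" for s
    unfolding z_def by (auto intro!: derivative_eq_intros)
  have x': "(x has_derivative (\<lambda>h. h *\<^sub>R V0)) (at t)"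
    using has_derivative_compose[OF z' twice_differentiable_onD(3)[OF \<phi>2 zt]]
    unfolding linear_scale[OF twice_differentiable_onD(4)[OF \<phi>2 zt]] x_def V0_def .
  \<comment> \<open>The derivative of the components of U along the slice. By symmetry of second
    derivatives it is also the time derivative of \<open>W a\<close>.\<close>
  define W1 where "W1 a = frechet_derivative (\<lambda>y. frechet_derivative \<phi> (at y) (0, 1)) (at (z t)) (a, 0)" for a
  have W': "(W a has_derivative (\<lambda>h. h *\<^sub>R W1 a)) (at t)" for a
  proof -
    note dif = twice_differentiable_onD(2)[OF \<phi>2 zt, of "(a, 0)"]
    have "((\<lambda>s. frechet_derivative \<phi> (at (z s)) (a, 0)) has_derivative
        (\<lambda>h. frechet_derivative (\<lambda>y. frechet_derivative \<phi> (at y) (a, 0)) (at (z t)) (h *\<^sub>R (0, 1)))) (at t)"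
      using has_derivative_compose[OF z'[of t], of "\<lambda>y. frechet_derivative \<phi> (at y) (a, 0)"]
        dif[unfolded frechet_derivative_works] by simp
    moreover have "frechet_derivative (\<lambda>y. frechet_derivative \<phi> (at y) (a, 0)) (at (z t)) (h *\<^sub>R (0, 1)) = h *\<^sub>R W1 a" for h
      unfolding linear_scale[OF linear_frechet[OF dif]] W1_def
      using second_derivative_symmetric[OF \<phi>2 zt, of "(a, 0)" "(0, 1)"] by simp
    ultimately show ?thesis unfolding W_def by simp
  qed
  have bil: "bilinear (G (x s))" if "s \<in> z -` B" for s
    using bilinear_metric[OF near(2)[OF that]] by (simp add: G_def xinv[OF that])
  have tB: "t \<in> z -` B" using zt by simp
  \<comment> \<open>Metric compatibility, which is formulated for constant components, is applied
    along the generator with velocity \<open>V0\<close>.\<close>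
  have G': "((\<lambda>s. G (x s) a b) has_derivative
      (\<lambda>h. h *\<^sub>R (G (x t) (\<Gamma> d (\<Phi> (p, t)) V0 a) b + G (x t) a (\<Gamma> d (\<Phi> (p, t)) V0 b)))) (at t)" for a b
  proof -
    have "smooth_on (\<lambda>y. G y a b) (snd d ` fst d)"
      using spacetime dd unfolding spacetime_def lorentzian_metric_def G_def by blast
    then have tw: "twice_differentiable_on (\<lambda>y. G y a b) (snd d ` fst d)"
      using smooth_manifold_charts(3)[OF M_manifold dd(1)] by (rule smooth_on_imp_twice_differentiable_on)
    have xt: "x t \<in> snd d ` fst d" using dd by (simp add: x_eq)
    have "frechet_derivative (\<lambda>y. G y a b) (at (x t)) V0 =
        G (x t) (\<Gamma> d (\<Phi> (p, t)) V0 a) b + G (x t) a (\<Gamma> d (\<Phi> (p, t)) V0 b)"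
      using levi_civita dd unfolding levi_civita_def by (simp add: G_def x_eq chart_inv_chart[OF M_atlas dd])
    then show ?thesis
      using has_derivative_compose[OF x' twice_differentiable_onD(3)[OF tw xt]]
        linear_scale[OF twice_differentiable_onD(4)[OF tw xt]] by simp
  qed
  define A1 where "A1 = W (w1 c) t"
  define A2 where "A2 = W (w2 c) t"
  \<comment> \<open>The two slice vectors are released one after the other: here the first moves
    while \<open>b\<close> is fixed, and in \<open>outer\<close> the second moves as well.\<close>
  have inner: "((\<lambda>s. G (x s) (W (w1 c) s) b) has_derivative
      (\<lambda>h. h *\<^sub>R (G (x t) (\<Gamma> d (\<Phi> (p, t)) V0 A1) b + G (x t) A1 (\<Gamma> d (\<Phi> (p, t)) V0 b) + G (x t) (W1 (w1 c)) b))) (at t)" for b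
  proof -
    have lin: "\<forall>\<^sub>F s in nhds t. linear (\<lambda>a. G (x s) a b)"
      using ev by (rule eventually_mono) (use bil in \<open>simp add: bilinear_def\<close>)
    have K: "(\<lambda>s. G (x s) a b) differentiable (at t)" for a
      using G' unfolding differentiable_def by blast
    have "G (x t) (h *\<^sub>R W1 (w1 c)) b = h *\<^sub>R G (x t) (W1 (w1 c)) b" for h
      using bilinear_lmul[OF bil[OF tB]] by simp
    then show ?thesis
      using has_derivative_linear_family[OF lin K W'[of "w1 c"]] frechet_derivative_eqI[OF G'[of "W (w1 c) t" b]]
      by (simp add: A1_def algebra_simps)
  qed
  have outer: "((\<lambda>s. G (x s) (W (w1 c) s) (W (w2 c) s)) has_derivative
      (\<lambda>h. h *\<^sub>R (G (x t) (\<Gamma> d (\<Phi> (p, t)) V0 A1) A2 + G (x t) A1 (\<Gamma> d (\<Phi> (p, t)) V0 A2)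
        + G (x t) (W1 (w1 c)) A2 + G (x t) A1 (W1 (w2 c))))) (at t)"
  proof -
    have lin: "\<forall>\<^sub>F s in nhds t. linear (\<lambda>b. G (x s) (W (w1 c) s) b)"
      using ev by (rule eventually_mono) (use bil in \<open>simp add: bilinear_def\<close>)
    have K: "(\<lambda>s. G (x s) (W (w1 c) s) b) differentiable (at t)" for b
      using inner unfolding differentiable_def by blast
    have "G (x t) (W (w1 c) t) (h *\<^sub>R W1 (w2 c)) = h *\<^sub>R G (x t) (W (w1 c) t) (W1 (w2 c))" for h
      using bilinear_rmul[OF bil[OF tB]] by simp
    then show ?thesis
      using has_derivative_linear_family[OF lin K W'[of "w2 c"]] frechet_derivative_eqI[OF inner[of "W (w2 c) t"]]
      by (simp add: A1_def A2_def algebra_simps)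
  qed
  \<comment> \<open>The slice vector with parameter \<open>a\<close>, as a tangent vector of the
    hypersurface on which the null second form can be evaluated.\<close>
  have lift: "tangent_of_components H (hyp_chart c) (\<Phi> (p, t)) (a, 0) \<in> tangent_space H (\<Phi> (p, t))"
    and lift_self: "tangent_of_components H (hyp_chart c) (\<Phi> (p, t)) (a, 0) (hyp_chart c) = (a, 0)" for a
  proof -
    have "hyp_chart c \<in> charts_at H (\<Phi> (p, t))" using c(1) by (simp add: charts_at_H[OF pt])
    then show "tangent_of_components H (hyp_chart c) (\<Phi> (p, t)) (a, 0) \<in> tangent_space H (\<Phi> (p, t))"
      and "tangent_of_components H (hyp_chart c) (\<Phi> (p, t)) (a, 0) (hyp_chart c) = (a, 0)"
      using tangent_of_components_in_tangent_space[OF H_atlas] tangent_of_components_self[OF H_atlas] by blast+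
  qed
  have \<Gamma>_sym: "\<Gamma> d (\<Phi> (p, t)) u v = \<Gamma> d (\<Phi> (p, t)) v u" for u v
    using levi_civita dd unfolding levi_civita_def by blast
  have Gsym: "G (x t) u v = G (x t) v u" for u v
    using spacetime dd unfolding spacetime_def lorentzian_metric_def Let_def by (simp add: G_def xinv[OF tB])
  \<comment> \<open>The null second form vanishes on two slice vectors. Symmetry of \<Gamma>
    exchanges its arguments, so that the derivative of U along the slice appears as the derivative
    of the slice vector along U.\<close>
  have zero: "G (x t) (W1 a + \<Gamma> d (\<Phi> (p, t)) V0 (W a t)) (W b t) = 0" for a b
  proof -
    let ?X = "tangent_of_components H (hyp_chart c) (\<Phi> (p, t)) (a, 0)"
    let ?Y = "tangent_of_components H (hyp_chart c) (\<Phi> (p, t)) (b, 0)"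
    have "\<Phi> (p, t) \<in> pts H" using pt by (auto simp: pts_H)
    then have 0: "g (\<Phi> (p, t)) (nabla_U (\<Phi> (p, t)) ?X) (differential H M (\<lambda>z. z) (\<Phi> (p, t)) ?Y) = 0"
      using tg lift[of a] lift[of b] unfolding totally_geodesic_def null_second_form_def by fastforce
    have dY: "differential H M (\<lambda>z. z) (\<Phi> (p, t)) ?Y \<in> tangent_space M (\<Phi> (p, t))"
      using differential_in_tangent_space[OF H_atlas M_atlas mfd_differentiableI[OF has_chart_derivative_H_M[OF pt c(1) d]] lift] .
    have "differential H M (\<lambda>z. z) (\<Phi> (p, t)) ?Y d = W b t"
      using differential_component[OF H_atlas M_atlas has_chart_derivative_H_M[OF pt c(1) d] lift]
      by (simp add: lift_self W_def \<phi>_def z_def)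
    moreover have "nabla_U (\<Phi> (p, t)) ?X d = W1 a + \<Gamma> d (\<Phi> (p, t)) V0 (W a t)"
      using nabla_U_component[OF pt c d lift, of a] \<Gamma>_sym
      by (simp add: lift_self W1_def W_def V0_def \<phi>_def z_def)
    ultimately show ?thesis
      using metric_eq_components[OF nabla_U_in_tangent_space[OF pt lift[of a]] dY d, of g] 0
      by (simp add: G_def xinv[OF tB])
  qed
  note bt = bil[OF tB]
  have "G (x t) (\<Gamma> d (\<Phi> (p, t)) V0 A1) A2 + G (x t) A1 (\<Gamma> d (\<Phi> (p, t)) V0 A2)
        + G (x t) (W1 (w1 c)) A2 + G (x t) A1 (W1 (w2 c)) =
      G (x t) (W1 (w1 c) + \<Gamma> d (\<Phi> (p, t)) V0 A1) A2 + G (x t) (W1 (w2 c) + \<Gamma> d (\<Phi> (p, t)) V0 A2) A1"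
    using Gsym[of A1] by (simp add: bilinear_ladd[OF bt])
  also have "\<dots> = 0" unfolding A1_def A2_def by (simp add: zero)
  finally have sum0: "G (x t) (\<Gamma> d (\<Phi> (p, t)) V0 A1) A2 + G (x t) A1 (\<Gamma> d (\<Phi> (p, t)) V0 A2)
        + G (x t) (W1 (w1 c)) A2 + G (x t) A1 (W1 (w2 c)) = 0" .
  have "((\<lambda>s. G (x s) (W (w1 c) s) (W (w2 c) s)) has_derivative (\<lambda>_. 0)) (at t)"
    using outer unfolding sum0 by simp
  then show ?thesis
    by (rule has_derivative_cong_eventually[rotated]) (use ev in \<open>auto simp: local elim: eventually_mono\<close>)
qed

lemma slice_metric_constant:
  assumes tg: "totally_geodesic M g \<Gamma> H U" and pt: "(p, t) \<in> \<O>"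
    and w1: "w1 \<in> tangent_space S p" and w2: "w2 \<in> tangent_space S p"
  shows "g (\<Phi> (p, t)) (slice_differential t p w1) (slice_differential t p w2) = induced_metric M g S p w1 w2"
proof -
  define f where "f s = g (\<Phi> (p, s)) (slice_differential s p w1) (slice_differential s p w2)" for s
  have p: "p \<in> pts S" using pt by (simp add: mem_O_iff)
  \<comment> \<open>A closed segment covers both signs of \<open>t\<close>, and it stays in the flow
    domain by star-shapedness.\<close>
  have "\<exists>k. \<forall>s\<in>closed_segment 0 t. f s = k"
  proof (rule has_derivative_zero_constant)
    fix s assume "s \<in> closed_segment 0 t"
    then obtain r where "0 \<le> r" "r \<le> 1" "s = r * t" by (auto simp: in_segment)
    then have "(p, s) \<in> \<O>" using mem_O_scale[OF pt] by simp
    from metric_derivative_along_generator[OF tg this w1 w2]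
    show "(f has_derivative (\<lambda>h. 0)) (at s within closed_segment 0 t)"
      unfolding f_def by (rule has_derivative_at_withinI)
  qed simp
  then have "f t = f 0" by (metis ends_in_segment)
  then show ?thesis
    using slice_differential_zero[OF p w1] slice_differential_zero[OF p w2] flow_zero[OF p]
    by (simp add: f_def induced_metric_def)
qed

end

section \<open>The conformal factor and the leaves\<close>

text \<open>Derivatives of all orders are needed here: with \<open>a\<close> as the time, this gives
  the smoothness of the inclusion of a slice. The constant varies in the induction because
  differentiation replaces it by 0.\<close>

lemma times_differentiable_on_Pair_const:
  assumes "open A" and "times_differentiable_on k f A"
  shows "times_differentiable_on k (\<lambda>x. (f x, a)) A"
  using assms(2)
proof (induction k arbitrary: f a)
  case 0
  then show ?case by (auto intro: continuous_on_Pair)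
next
  case (Suc k)
  have D: "((\<lambda>x. (f x, a)) has_derivative (\<lambda>v. (frechet_derivative f (at x) v, 0))) (at x)" if "x \<in> A" for x
    using Suc.prems that
    by (intro has_derivative_Pair has_derivative_const) (simp flip: frechet_derivative_works)
  have "times_differentiable_on k (\<lambda>x. frechet_derivative (\<lambda>x. (f x, a)) (at x) v) A" for v
  proof (rule times_differentiable_on_cong[OF assms(1) _ order_refl])
    show "times_differentiable_on k (\<lambda>x. (frechet_derivative f (at x) v, 0 :: 'c)) A"
      using Suc.prems by (intro Suc.IH) simp
    show "(frechet_derivative f (at x) v, 0) = frechet_derivative (\<lambda>x. (f x, a)) (at x) v" if "x \<in> A" for x
      by (simp add: frechet_derivative_eqI[OF D[OF that]])
  qed
  then show ?case
    using D by (auto simp: differentiable_def)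
qed

lemma smooth_on_Pair_const: "open A \<Longrightarrow> smooth_on f A \<Longrightarrow> smooth_on (\<lambda>x. (f x, a)) A"
  by (simp add: smooth_on_def times_differentiable_on_Pair_const)

text \<open>Used for an inverse given by \<open>inv_into\<close>, whose values are known only on the
  points of the manifold.\<close>

lemma smooth_map_cong:
  assumes X: "differentiable_atlas X" and f: "smooth_map X Y f" and eq: "\<And>q. q \<in> pts X \<Longrightarrow> f q = g q"
  shows "smooth_map X Y g"
  unfolding smooth_map_def
proof (intro conjI ballI)
  show "continuous_map (mtop X) (mtop Y) g"
    using f continuous_map_eq eq unfolding smooth_map_def by blast
  fix c d assume c: "c \<in> charts X" and d: "d \<in> charts Y"
  have sub: "fst c \<subseteq> pts X" using X c unfolding differentiable_atlas_def by blast
  have "smooth_on (snd d \<circ> f \<circ> chart_inv c) (snd c ` (fst c \<inter> f -` fst d))"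
    using f c d unfolding smooth_map_def by blast
  moreover have "fst c \<inter> f -` fst d = fst c \<inter> g -` fst d" using sub eq by auto
  ultimately have "smooth_on (snd d \<circ> f \<circ> chart_inv c) (snd c ` (fst c \<inter> g -` fst d))" by simp
  then show "smooth_on (snd d \<circ> g \<circ> chart_inv c) (snd c ` (fst c \<inter> g -` fst d))"
  proof (rule smooth_on_cong_superset[where B = "snd c ` fst c"])
    show "open (snd c ` fst c)" using X c by (simp add: differentiable_atlas_def)
    fix x assume "x \<in> snd c ` fst c"
    then have "chart_inv c x \<in> fst c" by (rule inv_into_into)
    then show "(snd d \<circ> f \<circ> chart_inv c) x = (snd d \<circ> g \<circ> chart_inv c) x" using sub eq by auto
  qed auto
qed

text \<open>By the fundamental theorem the integral has derivative \<open>f t\<close> in its upper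
  limit, yet it is identically 0. The derivative is taken within the interval, and
  \<open>a < b\<close> makes it unique even at the endpoints.\<close>

lemma integral_zero_imp_zero:
  fixes f :: "real \<Rightarrow> real"
  assumes ab: "a < b" "0 \<in> {a..b}" and f: "continuous_on {a..b} f"
    and zero: "\<And>u. u \<in> {a..b} \<Longrightarrow> (LBINT s=0..ereal u. f s) = 0" and t: "t \<in> {a..b}"
  shows "f t = 0"
proof -
  have "((\<lambda>u. LBINT s=ereal 0..ereal u. f s) has_vector_derivative f t) (at t within {a..b})"
    using ab t f by (intro interval_integral_FTC2) auto
  then have "((\<lambda>u. 0) has_vector_derivative f t) (at t within {a..b})"
    by (rule has_vector_derivative_transform[rotated 2]) (use t zero in \<open>auto simp: zero_ereal_def\<close>)
  moreover have "((\<lambda>u. 0) has_vector_derivative 0) (at t within {a..b})" by simp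
  ultimately show ?thesis
    using vector_derivative_unique_within_closed_interval[of a b t "\<lambda>u. 0" "f t" 0] ab(1) t
    by (simp add: cbox_interval)
qed

context normal_exponential
begin

lemma S_nonempty: "\<exists>p. p \<in> pts S"
proof -
  have "pts S \<noteq> {}" using S_manifold unfolding smooth_manifold_def by (rule conjunct1)
  then show ?thesis by blast
qed

lemma conformal_factor_flow:
  "(p, t) \<in> \<O> \<Longrightarrow> conformal_factor \<Phi> \<O> \<mu> (\<Phi> (p, t)) = exp (- 2 * (LBINT s=0..ereal t. \<mu> (\<Phi> (p, s))))"
  by (simp add: conformal_factor_def inv_flow)

lemma constant_conformal_factor_eq_1:
  assumes k: "\<forall>x\<in>pts H. conformal_factor \<Phi> \<O> \<mu> x = k"
  shows "k = 1"
proof -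
  obtain p where "p \<in> pts S" using S_nonempty by blast
  then have p: "(p, 0) \<in> \<O>" by (rule zero_mem_O)
  then have "\<Phi> (p, 0) \<in> pts H" by (auto simp: pts_H)
  then show ?thesis
    using k conformal_factor_flow[OF p, of \<mu>] by (simp add: zero_ereal_def)
qed

text \<open>This is the continuity of the integrand for the fundamental theorem. Smoothness of \<mu>
  is given in charts of the hypersurface, in which a generator is a vertical line.\<close>

lemma continuous_along_generator:
  assumes \<mu>: "smooth_map H euclidean_mfd \<mu>" and pt: "(p, t) \<in> \<O>"
  shows "isCont (\<lambda>s. \<mu> (\<Phi> (p, s)) :: real) t"
proof -
  obtain c where c: "c \<in> charts_at S p" using S_chart_exists[OF pt] by blast
  then have cc: "c \<in> charts S" "p \<in> fst c" by (auto simp: charts_at_def)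
  have hc: "hyp_chart c \<in> charts H" using c charts_at_H[OF pt] by (auto simp: charts_at_def)
  have id: "(UNIV, id) \<in> charts (euclidean_mfd :: (real, real) manifold)" by (simp add: euclidean_mfd_def)
  have "\<forall>c\<in>charts H. \<forall>d\<in>charts (euclidean_mfd :: (real, real) manifold).
      smooth_on (snd d \<circ> \<mu> \<circ> chart_inv c) (snd c ` (fst c \<inter> \<mu> -` fst d))"
    using \<mu> unfolding smooth_map_def by (rule conjunct2)
  from bspec[OF bspec[OF this hc] id]
  have "smooth_on (\<mu> \<circ> chart_inv (hyp_chart c)) (snd (hyp_chart c) ` fst (hyp_chart c))"
    by simp
  moreover have "snd (hyp_chart c) ` fst (hyp_chart c) = flow_range c"
    using image_chart_image[OF F_atlas inj_on_flow_F, of "flow_chart c" UNIV] flow_chart_image[OF cc(1), of UNIV] cc(1)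
    by (auto simp: hyp_chart_def charts_F flow_range_def)
  ultimately have "smooth_on (\<mu> \<circ> chart_inv (hyp_chart c)) (flow_range c)" by simp
  then have "twice_differentiable_on (\<mu> \<circ> chart_inv (hyp_chart c)) (flow_range c)"
    using open_flow_range[OF cc(1)] by (rule smooth_on_imp_twice_differentiable_on)
  from twice_differentiable_onD(1)[OF this flow_range_mem[OF pt c]]
  have "isCont (\<mu> \<circ> chart_inv (hyp_chart c)) (snd c p, t)" by (rule differentiable_imp_continuous_within)
  moreover have "isCont (\<lambda>s. (snd c p, s)) t" by (intro continuous_intros)
  ultimately have cont: "isCont (\<lambda>s. (\<mu> \<circ> chart_inv (hyp_chart c)) (snd c p, s)) t"
    by (rule isCont_o2[rotated])
  have "open ((\<lambda>s. (snd c p, s)) -` flow_range c)" by (intro open_vimage open_flow_range cc continuous_intros)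
  then have "\<forall>\<^sub>F s in nhds t. s \<in> (\<lambda>s. (snd c p, s)) -` flow_range c"
    using flow_range_mem[OF pt c] by (intro eventually_nhds_in_open) auto
  then have "\<forall>\<^sub>F s in nhds t. (\<mu> \<circ> chart_inv (hyp_chart c)) (snd c p, s) = \<mu> (\<Phi> (p, s))"
    by (rule eventually_mono) (simp add: hyp_chart_inv[OF cc(1)] S_chart_inv[OF cc])
  then show ?thesis
    using cont isCont_cong by fast
qed

lemma umbilicity_factor_zero:
  assumes \<mu>: "smooth_map H euclidean_mfd \<mu>" and one: "\<forall>x\<in>pts H. conformal_factor \<Phi> \<O> \<mu> x = 1"
    and pt: "(p, t) \<in> \<O>"
  shows "\<mu> (\<Phi> (p, t)) = (0::real)"
proof -
  obtain c where c: "c \<in> charts_at S p" using S_chart_exists[OF pt] by blast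
  then have cc: "c \<in> charts S" "p \<in> fst c" by (auto simp: charts_at_def)
  have p: "p \<in> pts S" using pt by (simp add: mem_O_iff)
  define I where "I = {s. (p, s) \<in> \<O>}"
  have I: "open I"
  proof -
    have "I = (\<lambda>s. (snd c p, s)) -` flow_range c"
      using cc by (auto simp: I_def flow_range_def S_chart_inv)
    then show ?thesis by (simp only:) (intro open_vimage open_flow_range cc continuous_intros)
  qed
  have scale: "r * s \<in> I" if "s \<in> I" "0 \<le> r" "r \<le> 1" for r s
    using mem_O_scale that by (simp add: I_def)
  \<comment> \<open>The interval must contain 0 and \<open>t\<close> and be nondegenerate even for
    \<open>t = 0\<close>; openness of the time domain lets \<open>b\<close> exceed both.\<close>
  define a where "a = min 0 t"
  have a: "a \<le> 0" "a \<in> I" using pt zero_mem_O[OF p] by (auto simp: a_def I_def min_def)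
  have "max 0 t \<in> I" using pt zero_mem_O[OF p] by (auto simp: I_def max_def)
  then obtain e where e: "e > 0" "ball (max 0 t) e \<subseteq> I" using I open_contains_ball by blast
  define b where "b = max 0 t + e / 2"
  have "b \<in> ball (max 0 t) e" using e(1) by (simp add: b_def dist_real_def)
  then have b: "b > 0" "b \<in> I" "t < b" using e by (auto simp: b_def)
  \<comment> \<open>Positive times are multiples of \<open>b\<close>, and negative ones multiples of
    \<open>a\<close>, which is then negative itself.\<close>
  have sub: "s \<in> I" if s: "s \<in> {a..b}" for s
  proof (cases "s \<ge> 0")
    case True
    then show ?thesis using scale[OF b(2), of "s / b"] s b(1) by (simp add: field_simps)
  next
    case False
    then show ?thesis using scale[OF a(2), of "s / a"] s by (simp add: field_simps)
  qed
  show ?thesis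
  proof (rule integral_zero_imp_zero[of a b "\<lambda>s. \<mu> (\<Phi> (p, s))" t])
    show "a < b" "0 \<in> {a..b}" "t \<in> {a..b}" using a b by (auto simp: a_def)
    show "continuous_on {a..b} (\<lambda>s. \<mu> (\<Phi> (p, s)))"
      using continuous_along_generator[OF \<mu>] sub
      by (intro continuous_at_imp_continuous_on ballI) (simp add: I_def)
    fix u assume "u \<in> {a..b}"
    then have pu: "(p, u) \<in> \<O>" using sub by (simp add: I_def)
    then have "conformal_factor \<Phi> \<O> \<mu> (\<Phi> (p, u)) = 1" using one by (auto simp: pts_H)
    then show "(LBINT s=0..ereal u. \<mu> (\<Phi> (p, s))) = 0"
      by (simp add: conformal_factor_flow[OF pu])
  qed
qed

lemma totally_geodesic_of_constant_conformal_factor: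
  assumes u: "totally_umbilical_with M g \<Gamma> H U \<mu>" and one: "\<forall>x\<in>pts H. conformal_factor \<Phi> \<O> \<mu> x = 1"
  shows "totally_geodesic M g \<Gamma> H U"
  unfolding totally_geodesic_def
proof (intro ballI)
  fix x X Y assume x: "x \<in> pts H" and "X \<in> tangent_space H x" "Y \<in> tangent_space H x"
  then have "null_second_form M g \<Gamma> H U x X Y = \<mu> x * induced_metric M g H x X Y"
    using u unfolding totally_umbilical_with_def by blast
  moreover have "\<mu> x = 0"
    using umbilicity_factor_zero[OF _ one] u x by (auto simp: pts_H totally_umbilical_with_def)
  ultimately show "null_second_form M g \<Gamma> H U x X Y = 0" by simp
qed

section \<open>Integral manifolds of the screen distribution\<close>

lemma integral_mfd_pts:
  assumes "connected_integral_mfd H D L" and "x \<in> pts L"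
  obtains p t where "(p, t) \<in> \<O>" "x = \<Phi> (p, t)"
proof -
  have "x \<in> \<Phi> ` \<O>" using assms unfolding connected_integral_mfd_def immersed_submfd_def pts_H by blast
  then obtain z where "z \<in> \<O>" "x = \<Phi> z" by blast
  then show ?thesis using that[of "fst z" "snd z"] by simp
qed

lemma integral_mfd_inclusion:
  assumes L: "connected_integral_mfd H D L" and x: "x \<in> pts L"
  shows "mfd_differentiable L H (\<lambda>y. y) x"
  using L x openin_H_chart unfolding connected_integral_mfd_def immersed_submfd_def
  by (intro smooth_map_mfd_differentiable[OF _ H_atlas]) auto

lemma isometry_of_projection:
  fixes L :: "('a, 's) manifold"
  assumes tg: "totally_geodesic M g \<Gamma> H U"
    and L: "connected_integral_mfd H (screen_distribution \<Phi> \<O> S) L"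
    and diffeo: "diffeomorphism L S (flow_projection \<Phi> \<O>)"
  shows "isometry L (induced_metric M g L) S (induced_metric M g S) (flow_projection \<Phi> \<O>)"
  unfolding isometry_def
proof (intro conjI ballI)
  show "diffeomorphism L S (flow_projection \<Phi> \<O>)" by (rule diffeo)
  fix x u1 u2 assume x: "x \<in> pts L" and u1: "u1 \<in> tangent_space L x" and u2: "u2 \<in> tangent_space L x"
  have La: "differentiable_atlas L"
    using L smooth_manifold_imp_differentiable_atlas unfolding connected_integral_mfd_def immersed_submfd_def by blast
  obtain p t where pt: "(p, t) \<in> \<O>" and xp: "x = \<Phi> (p, t)" using integral_mfd_pts[OF L x] by blast
  obtain c where c: "c \<in> charts_at S p" using S_chart_exists[OF pt] by blast
  obtain d where d: "d \<in> charts_at M (\<Phi> (p, t))" using M_chart_exists[OF pt] by blast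
  note SH = has_chart_derivative_S_H[OF pt c] and HS = has_chart_derivative_projection[OF pt c]
    and HM = has_chart_derivative_H_M[OF pt c d]
  note LH = integral_mfd_inclusion[OF L x]
  \<comment> \<open>The inclusion of \<open>L\<close> in \<open>M\<close> and the projection of
    \<open>L\<close> to \<open>S\<close> both factor through the hypersurface, where
    \<open>u\<close> becomes the image of a vector \<open>w\<close> of \<open>S\<close>. One
    \<open>w\<close> thus computes both differentials.\<close>
  have "\<exists>w\<in>tangent_space S p. differential L S (flow_projection \<Phi> \<O>) x u = w \<and>
      differential L M (\<lambda>y. y) x u = slice_differential t p w" if u: "u \<in> tangent_space L x" for u
  proof -
    have "differential L H (\<lambda>y. y) x u \<in> screen_distribution \<Phi> \<O> S x"
      using L x u unfolding connected_integral_mfd_def by blast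
    then obtain w where w: "w \<in> tangent_space S p"
      and eq: "differential L H (\<lambda>y. y) x u = differential S H (\<lambda>q. \<Phi> (q, t)) p w"
      unfolding xp screen_distribution_eq[OF pt] by blast
    have dw: "differential S H (\<lambda>q. \<Phi> (q, t)) p w \<in> tangent_space H (\<Phi> (p, t))"
      using differential_in_tangent_space[OF S_atlas H_atlas mfd_differentiableI[OF SH] w] .
    have "differential L S (flow_projection \<Phi> \<O>) x u =
        differential H S (flow_projection \<Phi> \<O>) (\<Phi> (p, t)) (differential S H (\<lambda>q. \<Phi> (q, t)) p w)"
      using differential_compose[OF La H_atlas S_atlas LH _ u] mfd_differentiableI[OF HS] eq by (simp add: xp)
    also have "\<dots> = w"
      using differential_eq[OF H_atlas S_atlas HS dw] differential_component[OF S_atlas H_atlas SH w]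
        tangent_of_components_eq[OF w c] by (simp add: flow_projection_flow[OF pt])
    finally have 1: "differential L S (flow_projection \<Phi> \<O>) x u = w" .
    have "differential L M (\<lambda>y. y) x u =
        differential H M (\<lambda>y. y) (\<Phi> (p, t)) (differential S H (\<lambda>q. \<Phi> (q, t)) p w)"
      using differential_compose[OF La H_atlas M_atlas LH _ u] mfd_differentiableI[OF HM] eq by (simp add: xp)
    also have "\<dots> = slice_differential t p w"
      using differential_compose[OF S_atlas H_atlas M_atlas mfd_differentiableI[OF SH] mfd_differentiableI[OF HM] w] .
    finally show ?thesis using w 1 by blast
  qed
  from this[OF u1] this[OF u2] obtain w1 w2 where
    w1: "w1 \<in> tangent_space S p" "differential L S (flow_projection \<Phi> \<O>) x u1 = w1"
      "differential L M (\<lambda>y. y) x u1 = slice_differential t p w1" and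
    w2: "w2 \<in> tangent_space S p" "differential L S (flow_projection \<Phi> \<O>) x u2 = w2"
      "differential L M (\<lambda>y. y) x u2 = slice_differential t p w2"
    by blast
  show "induced_metric M g S (flow_projection \<Phi> \<O> x) (differential L S (flow_projection \<Phi> \<O>) x u1)
      (differential L S (flow_projection \<Phi> \<O>) x u2) = induced_metric M g L x u1 u2"
    using slice_metric_constant[OF tg pt w1(1) w2(1)] w1 w2
    by (simp add: induced_metric_def[of M g L] xp flow_projection_flow[OF pt])
qed

text \<open>\<open>W\<close> is open in the topology of \<open>L\<close> itself, which may be finer
  than that of the hypersurface. In charts the time coordinate of the inclusion has zero derivative
  on a ball, hence is constant there by convexity.\<close>

lemma integral_mfd_time_locally_constant:
  fixes L :: "('a, 's) manifold"
  assumes L: "connected_integral_mfd H (screen_distribution \<Phi> \<O> S) L" and x: "x \<in> pts L"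
  shows "\<exists>W. openin (mtop L) W \<and> x \<in> W \<and> (\<forall>y\<in>W. snd (inv_into \<O> \<Phi> y) = snd (inv_into \<O> \<Phi> x))"
proof -
  have Lm: "smooth_manifold L" and sm: "smooth_map L H (\<lambda>y. y)"
    and int: "\<And>y. y \<in> pts L \<Longrightarrow> differential L H (\<lambda>y. y) y ` tangent_space L y = screen_distribution \<Phi> \<O> S y"
    using L unfolding connected_integral_mfd_def immersed_submfd_def by blast+
  note La = smooth_manifold_imp_differentiable_atlas[OF Lm]
  obtain p t where pt: "(p, t) \<in> \<O>" and xp: "x = \<Phi> (p, t)" using integral_mfd_pts[OF L x] by blast
  obtain c where c: "c \<in> charts_at S p" using S_chart_exists[OF pt] by blast
  then have cc: "c \<in> charts S" by (simp add: charts_at_def)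
  have hc: "hyp_chart c \<in> charts_at H x" using c charts_at_H[OF pt] by (simp add: xp)
  then have hcc: "hyp_chart c \<in> charts H" by (simp add: charts_at_def)
  obtain e where e: "e \<in> charts_at L x" using charts_at_nonempty[OF La x] by blast
  then have ee: "e \<in> charts L" "x \<in> fst e" by (auto simp: charts_at_def)
  define \<psi> where "\<psi> y = snd (hyp_chart c) (chart_inv e y)" for y
  have "\<forall>\<^sub>F y in nhds (snd e x). chart_inv e y \<in> fst (hyp_chart c)"
    using smooth_map_has_chart_derivative(1)[OF Lm hc openin_H_chart[OF hcc] sm e]
    by (simp add: has_chart_derivative_def)
  then have "\<forall>\<^sub>F y in nhds (snd e x). chart_inv e y \<in> fst (hyp_chart c) \<and> chart_inv e y \<in> fst e \<and> snd e (chart_inv e y) = y"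
    using eventually_in_chart_overlap[OF La e e] by eventually_elim simp
  then obtain r where r: "r > 0" and rB: "\<And>y. y \<in> ball (snd e x) r \<Longrightarrow>
      chart_inv e y \<in> fst (hyp_chart c) \<and> chart_inv e y \<in> fst e \<and> snd e (chart_inv e y) = y"
    unfolding eventually_nhds_metric by (auto simp: dist_commute)
  have time: "snd (\<psi> y) = snd (inv_into \<O> \<Phi> (chart_inv e y))"
    and der: "((\<lambda>y. snd (\<psi> y)) has_derivative (\<lambda>_. 0)) (at y)" if y: "y \<in> ball (snd e x) r" for y
  proof -
    define q where "q = chart_inv e y"
    have q: "q \<in> fst (hyp_chart c)" "q \<in> fst e" "snd e q = y" using rB[OF y] by (auto simp: q_def)
    have eq: "e \<in> charts_at L q" and hq: "hyp_chart c \<in> charts_at H q"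
      using ee hcc q by (auto simp: charts_at_def)
    have qL: "q \<in> pts L" using charts_at_pts[OF La eq] .
    obtain p' s where ps: "(p', s) \<in> \<O>" and qp: "q = \<Phi> (p', s)" using integral_mfd_pts[OF L qL] by blast
    have "p' \<in> fst c"
      using mem_image_chart[OF F_atlas inj_on_flow_F, of "flow_chart c" "(p', s)"] q(1) ps cc
      by (simp add: hyp_chart_def qp charts_F pts_F mem_flow_chart)
    then have cp: "c \<in> charts_at S p'" using cc by (simp add: charts_at_def)
    show "snd (\<psi> y) = snd (inv_into \<O> \<Phi> (chart_inv e y))"
      unfolding \<psi>_def q_def[symmetric] qp using hyp_chart_apply[OF ps] inv_flow[OF ps] by simp
    obtain D where D: "has_chart_derivative L H (\<lambda>y. y) q e (hyp_chart c) D"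
      using smooth_map_has_chart_derivative(1)[OF Lm hq openin_H_chart[OF hcc] sm eq] by blast
    \<comment> \<open>The differential of the inclusion takes values in the screen distribution,
      whose vectors have time component 0.\<close>
    have "snd (D v) = 0" for v
    proof -
      have u: "tangent_of_components L e q v \<in> tangent_space L q"
        by (rule tangent_of_components_in_tangent_space[OF La eq])
      then have "differential L H (\<lambda>y. y) q (tangent_of_components L e q v) \<in> screen_distribution \<Phi> \<O> S q"
        using int[OF qL] by blast
      then obtain w where w: "w \<in> tangent_space S p'"
        "differential L H (\<lambda>y. y) q (tangent_of_components L e q v) = differential S H (\<lambda>q. \<Phi> (q, s)) p' w"
        unfolding qp screen_distribution_eq[OF ps] by blast
      have "D v = differential L H (\<lambda>y. y) q (tangent_of_components L e q v) (hyp_chart c)"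
        using differential_component[OF La H_atlas D u] tangent_of_components_self[OF La eq] by simp
      also have "\<dots> = (w c, 0)"
        unfolding w(2) using differential_component[OF S_atlas H_atlas has_chart_derivative_S_H[OF ps cp] w(1)] .
      finally show ?thesis by simp
    qed
    moreover have "(\<psi> has_derivative D) (at y)"
      using D q(3) by (simp add: has_chart_derivative_def \<psi>_def[abs_def])
    then have "((\<lambda>y. snd (\<psi> y)) has_derivative (\<lambda>v. snd (D v))) (at y)" by (rule has_derivative_snd)
    ultimately show "((\<lambda>y. snd (\<psi> y)) has_derivative (\<lambda>_. 0)) (at y)" by simp
  qed
  have "\<exists>k. \<forall>y\<in>ball (snd e x) r. snd (\<psi> y) = k"
  proof (rule has_derivative_zero_constant)
    show "((\<lambda>y. snd (\<psi> y)) has_derivative (\<lambda>_. 0)) (at y within ball (snd e x) r)"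
      if "y \<in> ball (snd e x) r" for y
      using der[OF that] by (rule has_derivative_at_withinI)
  qed simp
  then obtain k where k: "\<And>y. y \<in> ball (snd e x) r \<Longrightarrow> snd (inv_into \<O> \<Phi> (chart_inv e y)) = k"
    using time by auto
  have inv: "chart_inv e (snd e y) = y" if "y \<in> fst e" for y using chart_inv_chart[OF La ee(1) that] .
  show ?thesis
  proof (intro exI[of _ "fst e \<inter> snd e -` ball (snd e x) r"] conjI ballI)
    show "openin (mtop L) (fst e \<inter> snd e -` ball (snd e x) r)"
      by (rule chart_preimage_open[OF Lm ee(1)]) simp
    show "x \<in> fst e \<inter> snd e -` ball (snd e x) r" using ee r by simp
    fix y assume "y \<in> fst e \<inter> snd e -` ball (snd e x) r"
    then show "snd (inv_into \<O> \<Phi> y) = snd (inv_into \<O> \<Phi> x)"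
      using k[of "snd e y"] k[of "snd e x"] inv ee r by simp
  qed
qed

lemma integral_mfd_time_constant:
  fixes L :: "('a, 's) manifold"
  assumes L: "connected_integral_mfd H (screen_distribution \<Phi> \<O> S) L" and x: "x \<in> pts L" and y: "y \<in> pts L"
  shows "snd (inv_into \<O> \<Phi> y) = snd (inv_into \<O> \<Phi> x)"
proof -
  define \<tau> where "\<tau> z = snd (inv_into \<O> \<Phi> z)" for z
  define A where "A = {z \<in> pts L. \<tau> z = \<tau> x}"
  note loc = integral_mfd_time_locally_constant[OF L, folded \<tau>_def]
  \<comment> \<open>An arbitrary predicate on times gives openness of the level set and of its
    complement at once.\<close>
  have opn: "openin (mtop L) {z \<in> pts L. P (\<tau> z)}" for P
  proof (subst openin_subopen, clarify)
    fix z assume z: "z \<in> pts L" "P (\<tau> z)"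
    obtain W where W: "openin (mtop L) W" "z \<in> W" "\<forall>y\<in>W. \<tau> y = \<tau> z" using loc[OF z(1)] by blast
    have "W \<subseteq> {z \<in> pts L. P (\<tau> z)}"
    proof
      fix y assume y: "y \<in> W"
      then have "\<tau> y = \<tau> z" using W(3) by blast
      then show "y \<in> {z \<in> pts L. P (\<tau> z)}" using z(2) y openin_subset[OF W(1)] by auto
    qed
    then show "\<exists>W. openin (mtop L) W \<and> z \<in> W \<and> W \<subseteq> {z \<in> pts L. P (\<tau> z)}"
      using W(1,2) by blast
  qed
  have "openin (mtop L) A" unfolding A_def by (rule opn)
  moreover have "pts L - A = {z \<in> pts L. \<tau> z \<noteq> \<tau> x}" by (auto simp: A_def)
  then have "openin (mtop L) (pts L - A)" by (simp only: opn[of "\<lambda>s. s \<noteq> \<tau> x"])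
  then have "closedin (mtop L) A" by (simp add: closedin_def A_def)
  moreover have "connected_space (mtop L)" using L by (simp add: connected_integral_mfd_def)
  ultimately have "A = {} \<or> A = pts L" using connected_space_clopen_in by blast
  then show ?thesis using x y by (auto simp: A_def \<tau>_def)
qed

section \<open>The canonical leaves\<close>

context
  fixes t :: real
  assumes t: "t \<in> common_times S \<O>"
begin

abbreviation L_t :: "('a, 's) manifold" where "L_t \<equiv> canonical_leaf \<Phi> S t"

lemma common_time: "p \<in> pts S \<Longrightarrow> (p, t) \<in> \<O>"
  using t by (simp add: common_times_def)

lemma inj_on_slice: "inj_on (\<lambda>p. \<Phi> (p, t)) (pts S)"
  using inj_on_flow common_time by (fastforce simp: inj_on_def)

lemma L_t_eq: "L_t = image_mfd (\<lambda>p. \<Phi> (p, t)) S"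
  by (simp add: canonical_leaf_def)

lemma pts_L_t: "pts L_t = (\<lambda>p. \<Phi> (p, t)) ` pts S"
  unfolding L_t_eq by (rule pts_image_mfd[OF S_atlas inj_on_slice])

text \<open>In charts this is a transition of \<open>S\<close> with the constant \<open>t\<close>
  appended.\<close>

lemma smooth_map_slice: "smooth_map S F (\<lambda>q. (q, t))"
  unfolding smooth_map_def
proof (intro conjI ballI)
  have "continuous_map (mtop S) (prod_topology (mtop S) euclideanreal) (\<lambda>q. (q, t))"
    by (intro continuous_map_pairedI continuous_map_id[unfolded id_def] continuous_map_const[THEN iffD2]) simp
  then show "continuous_map (mtop S) (mtop F) (\<lambda>q. (q, t))"
    using common_time by (auto simp: flow_mfd_def open_submfd_def product_line_def continuous_map_in_subtopology)
  fix c d assume c: "c \<in> charts S" and "d \<in> charts F"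
  then obtain e where e: "d = flow_chart e" "e \<in> charts S" by (auto simp: charts_F)
  have sub: "fst c \<subseteq> pts S" using smooth_manifold_charts(4)[OF S_manifold c] .
  have "fst c \<inter> (\<lambda>q. (q, t)) -` fst d = fst c \<inter> fst e"
    using sub common_time by (auto simp: e mem_flow_chart)
  moreover have "smooth_on (snd e \<circ> chart_inv c) (snd c ` (fst c \<inter> fst e))"
    using S_manifold c e unfolding smooth_manifold_def by blast
  moreover have "open (snd c ` (fst c \<inter> fst e))" using S_atlas c e unfolding differentiable_atlas_def by blast
  ultimately show "smooth_on (snd d \<circ> (\<lambda>q. (q, t)) \<circ> chart_inv c) (snd c ` (fst c \<inter> (\<lambda>q. (q, t)) -` fst d))"
    using smooth_on_Pair_const[of "snd c ` (fst c \<inter> fst e)" "snd e \<circ> chart_inv c" t] by (simp add: e(1) o_def)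
qed

text \<open>\<open>L_t\<close> carries the charts of \<open>S\<close>, so its inclusion and the
  slice map have the same coordinate derivative v -> (v, 0). Injectivity and the equality with the
  screen distribution are read off from it.\<close>

lemma canonical_leaf_integral: "connected_integral_mfd H (screen_distribution \<Phi> \<O> S) L_t"
proof -
  have Lm: "smooth_manifold L_t" unfolding L_t_eq by (rule smooth_manifold_image_mfd[OF S_manifold inj_on_slice])
  note La = smooth_manifold_imp_differentiable_atlas[OF Lm]
  have sub: "pts L_t \<subseteq> pts H" using common_time by (auto simp: pts_L_t pts_H)
  have "smooth_map S H (\<lambda>q. \<Phi> (q, t))"
    unfolding H_eq using smooth_map_to_image_mfd[OF F_atlas inj_on_flow_F S_atlas smooth_map_slice] .
  then have sm: "smooth_map L_t H (\<lambda>x. x)"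
    unfolding L_t_eq by (rule smooth_map_from_image_mfd[OF S_atlas inj_on_slice]) simp
  have conn: "connected_space (mtop L_t)"
    using homeomorphic_maps_image_mfd[OF S_atlas inj_on_slice] connected homeomorphic_connected_space
    unfolding L_t_eq homeomorphic_space_def by blast
  have pointwise: "inj_on (differential L_t H (\<lambda>x. x) x) (tangent_space L_t x) \<and>
      differential L_t H (\<lambda>x. x) x ` tangent_space L_t x = screen_distribution \<Phi> \<O> S x"
    if x: "x \<in> pts L_t" for x
  proof -
    obtain p where p: "p \<in> pts S" "x = \<Phi> (p, t)" using x by (auto simp: pts_L_t)
    note pt = common_time[OF p(1)]
    obtain c where c: "c \<in> charts_at S p" using S_chart_exists[OF pt] by blast
    define l where "l = image_chart (\<lambda>p. \<Phi> (p, t)) S c"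
    note SH = has_chart_derivative_S_H[OF pt c]
    have LH: "has_chart_derivative L_t H (\<lambda>x. x) x l (hyp_chart c) (\<lambda>v. (v, 0))"
      using has_chart_derivative_from_image_mfd[OF S_atlas inj_on_slice SH, of "\<lambda>x. x"]
      by (simp add: p(2) l_def canonical_leaf_def)
    then have l: "l \<in> charts_at L_t x" by (simp add: has_chart_derivative_def)
    have "inj_on (differential L_t H (\<lambda>x. x) x) (tangent_space L_t x)"
    proof (rule inj_onI)
      fix u v assume u: "u \<in> tangent_space L_t x" and v: "v \<in> tangent_space L_t x"
        and "differential L_t H (\<lambda>x. x) x u = differential L_t H (\<lambda>x. x) x v"
      then have "u l = v l"
        using differential_component[OF La H_atlas LH u] differential_component[OF La H_atlas LH v] by simp
      then show "u = v" using tangent_space_eqI[OF u v l] by simp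
    qed
    moreover have "differential L_t H (\<lambda>x. x) x ` tangent_space L_t x =
        differential S H (\<lambda>q. \<Phi> (q, t)) p ` tangent_space S p"
    proof (intro equalityI subsetI)
      fix z assume "z \<in> differential L_t H (\<lambda>x. x) x ` tangent_space L_t x"
      then obtain u where u: "u \<in> tangent_space L_t x" "z = differential L_t H (\<lambda>x. x) x u" by blast
      note w = tangent_of_components_in_tangent_space[OF S_atlas c, of "u l"]
      have "z = differential S H (\<lambda>q. \<Phi> (q, t)) p (tangent_of_components S c p (u l))"
        using differential_eq[OF La H_atlas LH u(1)] differential_eq[OF S_atlas H_atlas SH w]
          tangent_of_components_self[OF S_atlas c] by (simp add: u(2) p(2))
      then show "z \<in> differential S H (\<lambda>q. \<Phi> (q, t)) p ` tangent_space S p" using w by blast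
    next
      fix z assume "z \<in> differential S H (\<lambda>q. \<Phi> (q, t)) p ` tangent_space S p"
      then obtain w where w: "w \<in> tangent_space S p" "z = differential S H (\<lambda>q. \<Phi> (q, t)) p w" by blast
      note u = tangent_of_components_in_tangent_space[OF La l, of "w c"]
      have "z = differential L_t H (\<lambda>x. x) x (tangent_of_components L_t l x (w c))"
        using differential_eq[OF S_atlas H_atlas SH w(1)] differential_eq[OF La H_atlas LH u]
          tangent_of_components_self[OF La l] by (simp add: w(2) p(2))
      then show "z \<in> differential L_t H (\<lambda>x. x) x ` tangent_space L_t x" using u by blast
    qed
    ultimately show ?thesis by (simp add: p(2) screen_distribution_eq[OF pt])
  qed
  show ?thesis
    unfolding connected_integral_mfd_def immersed_submfd_def
    using Lm sub sm conn pointwise by blast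
qed

lemma canonical_leaf_is_leaf: "leaf H (screen_distribution \<Phi> \<O> S) L_t"
  unfolding leaf_def
proof (intro conjI allI impI)
  show "connected_integral_mfd H (screen_distribution \<Phi> \<O> S) L_t" by (rule canonical_leaf_integral)
  fix L' :: "('a, 's) manifold"
  assume "connected_integral_mfd H (screen_distribution \<Phi> \<O> S) L' \<and> pts L_t \<subseteq> pts L'"
  then have L': "connected_integral_mfd H (screen_distribution \<Phi> \<O> S) L'" and sub: "pts L_t \<subseteq> pts L'" by auto
  \<comment> \<open>A single point of the slice fixes the common time of \<open>L'\<close> to be
    \<open>t\<close>.\<close>
  obtain p where p: "p \<in> pts S" using S_nonempty by blast
  have "pts L' \<subseteq> pts L_t"
  proof
    fix y assume y: "y \<in> pts L'"
    obtain q s where qs: "(q, s) \<in> \<O>" "y = \<Phi> (q, s)" using integral_mfd_pts[OF L' y] by blast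
    have "\<Phi> (p, t) \<in> pts L'" using sub p by (auto simp: pts_L_t)
    from integral_mfd_time_constant[OF L' this y] have "s = t"
      using inv_flow[OF qs(1)] inv_flow[OF common_time[OF p]] by (simp add: qs(2))
    then show "y \<in> pts L_t" using qs by (auto simp: pts_L_t mem_O_iff)
  qed
  then show "pts L' = pts L_t" using sub by blast
qed

text \<open>With the charts of \<open>L_t\<close> transported from \<open>S\<close>, the projection
  and its inverse, the slice map, both come from the identity of \<open>S\<close>.\<close>

lemma canonical_leaf_diffeomorphism: "diffeomorphism L_t S (flow_projection \<Phi> \<O>)"
  unfolding diffeomorphism_def
proof (intro conjI)
  have proj: "flow_projection \<Phi> \<O> (\<Phi> (p, t)) = p" if "p \<in> pts S" for p
    using flow_projection_flow[OF common_time[OF that]] .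
  show bij: "bij_betw (flow_projection \<Phi> \<O>) (pts L_t) (pts S)"
    by (rule bij_betw_byWitness[of _ "\<lambda>p. \<Phi> (p, t)"]) (auto simp: pts_L_t proj)
  show "smooth_map L_t S (flow_projection \<Phi> \<O>)"
    unfolding L_t_eq by (rule smooth_map_from_image_mfd[OF S_atlas inj_on_slice smooth_map_ident[OF S_manifold] proj])
  have "smooth_map S L_t (\<lambda>p. \<Phi> (p, t))"
    unfolding L_t_eq
    using smooth_map_to_image_mfd[OF S_atlas inj_on_slice S_atlas smooth_map_ident[OF S_manifold]] .
  then show "smooth_map S L_t (inv_into (pts L_t) (flow_projection \<Phi> \<O>))"
  proof (rule smooth_map_cong[OF S_atlas])
    fix q assume q: "q \<in> pts S"
    then have "\<Phi> (q, t) \<in> pts L_t" by (auto simp: pts_L_t)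
    with inv_into_f_eq[OF bij_betw_imp_inj_on[OF bij] this proj[OF q]]
    show "\<Phi> (q, t) = inv_into (pts L_t) (flow_projection \<Phi> \<O>) q" by simp
  qed
qed

end

lemma constant_conformal_factor_consequences:
  assumes u: "totally_umbilical_with M g \<Gamma> H U \<mu>"
    and k: "\<exists>k. \<forall>x\<in>pts H. conformal_factor \<Phi> \<O> \<mu> x = k"
  shows "(\<forall>x\<in>pts H. conformal_factor \<Phi> \<O> \<mu> x = 1) \<and>
    totally_geodesic M g \<Gamma> H U \<and>
    (\<forall>L :: ('a, 's) manifold.
       leaf H (screen_distribution \<Phi> \<O> S) L \<and> diffeomorphism L S (flow_projection \<Phi> \<O>) \<longrightarrow>
       isometry L (induced_metric M g L) S (induced_metric M g S) (flow_projection \<Phi> \<O>)) \<and>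
    (\<forall>t\<in>common_times S \<O>.
       leaf H (screen_distribution \<Phi> \<O> S) (canonical_leaf \<Phi> S t) \<and>
       isometry (canonical_leaf \<Phi> S t) (induced_metric M g (canonical_leaf \<Phi> S t))
         S (induced_metric M g S) (flow_projection \<Phi> \<O>))"
proof -
  have one: "\<forall>x\<in>pts H. conformal_factor \<Phi> \<O> \<mu> x = 1"
    using k constant_conformal_factor_eq_1 by blast
  have tg: "totally_geodesic M g \<Gamma> H U"
    using totally_geodesic_of_constant_conformal_factor[OF u one] .
  have iso: "isometry L (induced_metric M g L) S (induced_metric M g S) (flow_projection \<Phi> \<O>)"
    if "leaf H (screen_distribution \<Phi> \<O> S) L" "diffeomorphism L S (flow_projection \<Phi> \<O>)"
    for L :: "('a, 's) manifold"
    using isometry_of_projection[OF tg] that unfolding leaf_def by blast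
  show ?thesis
    using one tg iso canonical_leaf_is_leaf canonical_leaf_diffeomorphism by blast
qed

end

theorem corollary7p6:
  fixes M :: "('a, 'e::euclidean_space) manifold"
    and g :: "('a, 'e) metric"
    and T :: "'a \<Rightarrow> ('a, 'e) tvec"
    and \<Gamma> :: "('a, 'e) connection"
    and S :: "('a, 's::euclidean_space) manifold"
    and \<xi> :: "'a \<Rightarrow> ('a, 'e) tvec"
    and N :: "('a \<times> ('a, 'e) tvec, 'e) manifold"
    and V :: "('a \<times> ('a, 'e) tvec) set"
    and \<O> :: "('a \<times> real) set"
    and \<Phi> :: "'a \<times> real \<Rightarrow> 'a"
    and H :: "('a, 's \<times> real) manifold"
    and U :: "'a \<Rightarrow> ('a, 's \<times> real) tvec"
    and \<mu> :: "'a \<Rightarrow> real"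
  assumes "spacetime M g T"
    and "levi_civita M g \<Gamma>"
    and "DIM('e) = DIM('s) + 2" and "DIM('e) \<ge> 4"
    and "embedded_submfd S M" and "connected_space (mtop S)" and "spacelike_submfd M g S"
    and "lightlike_normal_field M g S \<xi>"
    and "normal_bundle M g S N" and "normal_exp_domain M \<Gamma> S N V"
    and "\<O> = flow_domain S \<xi> V"
    and "\<Phi> = normal_flow M \<Gamma> \<xi>"
    and "H = emanating_hypersurface \<Phi> \<O> S"
    and "U = generator_field \<Phi> \<O> S"
    and "totally_umbilical_with M g \<Gamma> H U \<mu>"
    and "\<exists>k. \<forall>x\<in>pts H. conformal_factor \<Phi> \<O> \<mu> x = k"
  shows "(\<forall>x\<in>pts H. conformal_factor \<Phi> \<O> \<mu> x = 1) \<and>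
    totally_geodesic M g \<Gamma> H U \<and>
    (\<forall>L :: ('a, 's) manifold.
       leaf H (screen_distribution \<Phi> \<O> S) L \<and> diffeomorphism L S (flow_projection \<Phi> \<O>) \<longrightarrow>
       isometry L (induced_metric M g L) S (induced_metric M g S) (flow_projection \<Phi> \<O>)) \<and>
    (\<forall>t\<in>common_times S \<O>.
       leaf H (screen_distribution \<Phi> \<O> S) (canonical_leaf \<Phi> S t) \<and>
       isometry (canonical_leaf \<Phi> S t) (induced_metric M g (canonical_leaf \<Phi> S t))
         S (induced_metric M g S) (flow_projection \<Phi> \<O>))"
proof -
  interpret normal_exponential M g T \<Gamma> S \<xi> N V
    by unfold_locales (fact assms)+
  show ?thesis
    using constant_conformal_factor_consequences assms(15,16) unfolding assms(11-14) by blast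
qed

end
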